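(* For any good polygon $Q$ there is a path in $\mathcal{X}$, the space of similarity classes of pup tents, which, up to similarity, converges to $Q$ in the Hausdorff metric. That is, there is a continuous path $s\mapsto \xi_s\in\mathcal{X}$, $s\in[0,1)$, and for each $s$ a subset $T_s\subset\mathbb{R}^3$ that is similar to a pup tent in the class $\xi_s$, such that $T_s\to Q$ in the Hausdorff metric as $s\to 1$.
   Context: Good polygons: (1) any rectangle; (2) any trapezoid whose two diagonals have the same length as its long side; (3) any equilateral triangle. A good polygon is regarded as a (filled, two-dimensional) compact subset of $\mathbb{R}^3$ by embedding it in some plane. The Hausdorff distance between two compact subsets of a metric space is the infimal $\epsilon$ such that each is contained in the $\epsilon$-neighborhood of the other. A flat torus is a quotient $\mathbb{R}^2/\Lambda$ with $\Lambda$ a lattice of translations. A paper torus is a piecewise linear isometric embedding of a flat torus into $\mathbb{R}^3$; equivalently, an embedded topological torus in $\mathbb{R}^3$ made from finitely many triangles such that the cone angle (sum of the incident triangle angles) at each vertex is $2\pi$. Uniform triangulation: the triangulation $K$ of the torus with vertex set $\{0,\dots,7\}=\mathbb{Z}/8$ and the 16 triangles $\{a,a+1,a+3\}$ and $\{a,a+2,a+3\}$ (mod 8), $a\in\mathbb{Z}/8$. Pup tent: an 8-vertex paper torus triangulated by $K$, with vertices $p_0,\dots,p_7\in\mathbb{R}^3$ (each triangle of $K$ is mapped affinely onto the triangle with the corresponding vertices; the resulting map is injective; all cone angles are $2\pi$), such that: (i) it is invariant under $\rho(u,v,w)=(-u,-v,w)$, with $p_{7-j}=\rho(p_j)$ for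 all $j$; (ii) exactly 6 of the 16 triangles lie in the boundary of the convex hull of the torus, namely $\{1,2,7\},\{1,2,4\},\{2,4,5\},\{2,3,5\},\{3,5,6\},\{0,5,6\}$. $\mathcal{X}$ is the space of similarity classes (under similarities of $\mathbb{R}^3$) of pup tents, topologized via the vertex tuples $(p_0,\dots,p_7)\in(\mathbb{R}^3)^8$ (quotient topology). *)

theory Defs
  imports "HOL-Analysis.Analysis"
begin

section \<open>Similarities and the Hausdorff distance\<close>

definition similarity :: "('a::metric_space \<Rightarrow> 'a) \<Rightarrow> bool" where
  "similarity f \<longleftrightarrow> surj f \<and> (\<exists>c>0. \<forall>x y. dist (f x) (f y) = c * dist x y)"

definition similar :: "'a::metric_space set \<Rightarrow> 'a set \<Rightarrow> bool" where
  "similar A B \<longleftrightarrow> (\<exists>f. similarity f \<and> f ` A = B)"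

(* Used only for nonempty bounded sets, where the infimum is over a nonempty set. *)
definition hausdorff_dist :: "'a::metric_space set \<Rightarrow> 'a set \<Rightarrow> real" where
  "hausdorff_dist A B =
     Inf {\<epsilon>. \<epsilon> > 0 \<and> A \<subseteq> (\<Union>b\<in>B. ball b \<epsilon>) \<and> B \<subseteq> (\<Union>a\<in>A. ball a \<epsilon>)}"

section \<open>Good polygons\<close>

definition is_rectangle :: "(real^3) set \<Rightarrow> bool" where
  "is_rectangle Q \<longleftrightarrow>
     (\<exists>a u v. u \<noteq> 0 \<and> v \<noteq> 0 \<and> u \<bullet> v = 0 \<and> Q = convex hull {a, a + u, a + u + v, a + v})"

(* The parallel sides are a b and d c; the bound t < 1 makes a b the longer one, and t > 0
   makes a, b, c, d the cyclic order of the vertices. When the diagonals a c and b d are both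
   as long as a b, the legs are shorter than a b, so a b is also the longest of all four sides. *)
definition is_long_diagonal_trapezoid :: "(real^3) set \<Rightarrow> bool" where
  "is_long_diagonal_trapezoid Q \<longleftrightarrow>
     (\<exists>a b c d. \<not> collinear {a, b, d} \<and>
        (\<exists>t. 0 < t \<and> t < 1 \<and> c - d = t *\<^sub>R (b - a)) \<and>
        dist a c = dist a b \<and> dist b d = dist a b \<and>
        Q = convex hull {a, b, c, d})"

definition is_equilateral_triangle :: "(real^3) set \<Rightarrow> bool" where
  "is_equilateral_triangle Q \<longleftrightarrow>
     (\<exists>a b c. a \<noteq> b \<and> dist a b = dist b c \<and> dist b c = dist c a \<and> Q = convex hull {a, b, c})"

definition good_polygon :: "(real^3) set \<Rightarrow> bool" where
  "good_polygon Q \<longleftrightarrow>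
     is_rectangle Q \<or> is_long_diagonal_trapezoid Q \<or> is_equilateral_triangle Q"

section \<open>The uniform triangulation and its maps into space\<close>

(* The numeral type 8 is the ring of integers mod 8. *)
definition uniform_triangulation :: "8 set set" where
  "uniform_triangulation = range (\<lambda>a. {a, a + 1, a + 3}) \<union> range (\<lambda>a. {a, a + 2, a + 3})"

(* Geometric realization, in barycentric coordinates. *)
definition realization :: "(real^8) set" where
  "realization = {x. (\<forall>i. 0 \<le> x $ i) \<and> (\<Sum>i\<in>UNIV. x $ i) = 1 \<and>
                     (\<exists>t\<in>uniform_triangulation. {i. x $ i \<noteq> 0} \<subseteq> t)}"

definition affine_extension :: "(real^3)^8 \<Rightarrow> real^8 \<Rightarrow> real^3" where
  "affine_extension p x = (\<Sum>i\<in>UNIV. x $ i *\<^sub>R p $ i)"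

definition torus :: "(real^3)^8 \<Rightarrow> (real^3) set" where
  "torus p = affine_extension p ` realization"

definition angle_at :: "'a::real_inner \<Rightarrow> 'a \<Rightarrow> 'a \<Rightarrow> real" where
  "angle_at a b c = arccos (((b - a) \<bullet> (c - a)) / (norm (b - a) * norm (c - a)))"

(* The condition b < c only serves to count each triangle {v, b, c} once; b and c differ from v
   because every member of the triangulation has three elements. *)
definition cone_angle :: "(real^3)^8 \<Rightarrow> 8 \<Rightarrow> real" where
  "cone_angle p v =
     (\<Sum>(b, c) \<in> {(b, c). b < c \<and> {v, b, c} \<in> uniform_triangulation}.
        angle_at (p $ v) (p $ b) (p $ c))"

definition paper_torus :: "(real^3)^8 \<Rightarrow> bool" where
  "paper_torus p \<longleftrightarrow> inj_on (affine_extension p) realization \<and> (\<forall>v. cone_angle p v = 2 * pi)"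

section \<open>Pup tents and their similarity classes\<close>

definition \<rho> :: "real^3 \<Rightarrow> real^3" where
  "\<rho> x = vector [- (x $ 1), - (x $ 2), x $ 3]"

definition hull_triangles :: "(real^3)^8 \<Rightarrow> 8 set set" where
  "hull_triangles p =
     {t \<in> uniform_triangulation.
        convex hull ((\<lambda>j. p $ j) ` t) \<subseteq> frontier (convex hull (torus p))}"

definition pup_tent :: "(real^3)^8 \<Rightarrow> bool" where
  "pup_tent p \<longleftrightarrow>
     paper_torus p \<and>
     \<rho> ` torus p = torus p \<and> (\<forall>j. p $ (7 - j) = \<rho> (p $ j)) \<and>
     hull_triangles p = {{1,2,7}, {1,2,4}, {2,4,5}, {2,3,5}, {3,5,6}, {0,5,6}}"

definition pup_tents :: "((real^3)^8) set" where
  "pup_tents = {p. pup_tent p}"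

definition pup_similarity :: "((real^3)^8) rel" where
  "pup_similarity =
     {(p, q). p \<in> pup_tents \<and> q \<in> pup_tents \<and> (\<exists>f. similarity f \<and> (\<forall>j. q $ j = f (p $ j)))}"

definition pup_space :: "((real^3)^8) set topology" where
  "pup_space =
     topology (\<lambda>U. U \<subseteq> pup_tents // pup_similarity \<and> openin (top_of_set pup_tents) (\<Union>U))"

lemma similarity_comp: "similarity f \<Longrightarrow> similarity g \<Longrightarrow> similarity (f \<circ> g)"
proof -
  assume f: "similarity f" and g: "similarity g"
  obtain c where c: "c > 0" "\<And>x y. dist (f x) (f y) = c * dist x y"
    using f unfolding similarity_def by blast
  obtain d where d: "d > 0" "\<And>x y. dist (g x) (g y) = d * dist x y"
    using g unfolding similarity_def by blast
  have "surj (f \<circ> g)" using f g comp_surj[of g f] by (simp add: similarity_def)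
  moreover have "c * d > 0" using c(1) d(1) by simp
  moreover have "\<forall>x y. dist ((f \<circ> g) x) ((f \<circ> g) y) = (c * d) * dist x y"
    by (simp add: c(2) d(2))
  ultimately show ?thesis unfolding similarity_def by blast
qed

lemma similarity_inj:
  assumes "similarity f" shows "inj f"
proof (rule injI)
  fix x y assume "f x = f y"
  moreover obtain c where "c > 0" "dist (f x) (f y) = c * dist x y"
    using assms unfolding similarity_def by blast
  ultimately show "x = y" by simp
qed

lemma similarity_inv:
  assumes "similarity f" shows "similarity (inv f)"
proof -
  from assms obtain c where c: "c > 0" "\<And>x y. dist (f x) (f y) = c * dist x y" and s: "surj f"
    unfolding similarity_def by blast
  have "inj f" using assms by (rule similarity_inj)
  then have "surj (inv f)" by (simp add: inj_imp_surj_inv)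
  moreover have "dist (inv f x) (inv f y) = (1 / c) * dist x y" for x y
    using c(2)[of "inv f x" "inv f y"] c(1) s by (simp add: surj_f_inv_f)
  ultimately show ?thesis unfolding similarity_def using c(1)
    by (intro conjI exI[of _ "1 / c"]) simp_all
qed

lemma equiv_pup_similarity: "equiv pup_tents pup_similarity"
proof (rule equivI)
  have id: "similarity (id :: real^3 \<Rightarrow> real^3)"
    unfolding similarity_def by (intro conjI exI[of _ 1]) simp_all
  have "(p, p) \<in> pup_similarity" if "p \<in> pup_tents" for p
  proof -
    have "\<exists>f. similarity f \<and> (\<forall>j. p $ j = f (p $ j))" using id by (intro exI[of _ id]) simp
    then show ?thesis using that by (simp add: pup_similarity_def)
  qed
  then show "refl_on pup_tents pup_similarity"
    by (intro refl_onI)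
  show "pup_similarity \<subseteq> pup_tents \<times> pup_tents" by (auto simp: pup_similarity_def)
  show "sym pup_similarity"
  proof (rule symI)
    fix p q assume "(p, q) \<in> pup_similarity"
    then obtain f where f: "p \<in> pup_tents" "q \<in> pup_tents" "similarity f" "\<forall>j. q $ j = f (p $ j)"
      by (auto simp: pup_similarity_def)
    have "\<forall>j. p $ j = inv f (q $ j)" using f similarity_inj[OF f(3)] by simp
    then show "(q, p) \<in> pup_similarity"
      using f(1,2) similarity_inv[OF f(3)] unfolding pup_similarity_def by blast
  qed
  show "trans pup_similarity"
  proof (rule transI)
    fix p q r assume "(p, q) \<in> pup_similarity" "(q, r) \<in> pup_similarity"
    then obtain f g where fg: "p \<in> pup_tents" "r \<in> pup_tents" "similarity f" "similarity g"
      "\<forall>j. q $ j = f (p $ j)" "\<forall>j. r $ j = g (q $ j)"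
      unfolding pup_similarity_def by blast
    have "\<exists>h. similarity h \<and> (\<forall>j. r $ j = h (p $ j))"
      using fg similarity_comp[of g f] by (intro exI[of _ "g \<circ> f"]) simp
    then show "(p, r) \<in> pup_similarity"
      using fg(1,2) by (simp add: pup_similarity_def)
  qed
qed

lemma openin_pup_space:
  "openin pup_space U \<longleftrightarrow>
     U \<subseteq> pup_tents // pup_similarity \<and> openin (top_of_set pup_tents) (\<Union>U)"
proof -
  let ?X = "pup_tents // pup_similarity"
  have Int: "\<Union>(S \<inter> T) = \<Union>S \<inter> \<Union>T" if "S \<subseteq> ?X" "T \<subseteq> ?X" for S T
    using that quotient_disj[OF equiv_pup_similarity] by blast
  have "istopology (\<lambda>U. U \<subseteq> ?X \<and> openin (top_of_set pup_tents) (\<Union>U))"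
    unfolding istopology_def
  proof (intro conjI allI impI)
    fix S T assume "S \<subseteq> ?X \<and> openin (top_of_set pup_tents) (\<Union>S)"
      and "T \<subseteq> ?X \<and> openin (top_of_set pup_tents) (\<Union>T)"
    then show "S \<inter> T \<subseteq> ?X" "openin (top_of_set pup_tents) (\<Union>(S \<inter> T))"
      using Int[of S T] openin_Int by (blast, simp add: openin_Int)
  next
    fix K assume K: "\<forall>S\<in>K. S \<subseteq> ?X \<and> openin (top_of_set pup_tents) (\<Union>S)"
    then show "\<Union>K \<subseteq> ?X" by blast
    have "\<Union>(\<Union>K) = \<Union>(Union ` K)" by blast
    moreover have "openin (top_of_set pup_tents) (\<Union>(Union ` K))"
      by (rule openin_Union) (use K in blast)
    ultimately show "openin (top_of_set pup_tents) (\<Union>(\<Union>K))" by simp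
  qed
  then show ?thesis unfolding pup_space_def by (simp add: topology_inverse')
qed

lemma topspace_pup_space: "topspace pup_space = pup_tents // pup_similarity"
proof -
  have "openin pup_space (pup_tents // pup_similarity)"
    by (simp add: openin_pup_space Union_quotient[OF equiv_pup_similarity])
  moreover have "topspace pup_space \<subseteq> pup_tents // pup_similarity"
    using openin_pup_space[of "topspace pup_space"] by simp
  ultimately show ?thesis using openin_subset by blast
qed

lemma quotient_map_pup_space:
  "quotient_map (top_of_set pup_tents) pup_space (\<lambda>p. pup_similarity `` {p})"
proof -
  have "{p \<in> pup_tents. pup_similarity `` {p} \<in> U} = \<Union>U"
    if "U \<subseteq> pup_tents // pup_similarity" for U
  proof (intro equalityI subsetI)
    fix p assume "p \<in> {p \<in> pup_tents. pup_similarity `` {p} \<in> U}"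
    then show "p \<in> \<Union>U" using equiv_class_self[OF equiv_pup_similarity] by blast
  next
    fix p assume "p \<in> \<Union>U"
    then obtain C where C: "p \<in> C" "C \<in> U" by blast
    then have q: "C \<in> pup_tents // pup_similarity" using that by blast
    then have "p \<in> pup_tents" using C Union_quotient[OF equiv_pup_similarity] by blast
    moreover have "C = pup_similarity `` {p}"
      using q
    proof (rule quotientE)
      fix x assume x: "C = pup_similarity `` {x}" "x \<in> pup_tents"
      then have "(x, p) \<in> pup_similarity" using C(1) by simp
      then show ?thesis using x(1) equiv_class_eq[OF equiv_pup_similarity] by simp
    qed
    ultimately show "p \<in> {p \<in> pup_tents. pup_similarity `` {p} \<in> U}" using C(2) by blast
  qed
  moreover have "(\<lambda>p. pup_similarity `` {p}) ` pup_tents = pup_tents // pup_similarity"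
    unfolding quotient_def by blast
  ultimately show ?thesis
    unfolding quotient_map_def topspace_pup_space by (simp add: openin_pup_space)
qed

end

theory Submission
  imports Defs
begin

text \<open>With coordinates adapted to the symmetry \<open>\<rho>\<close>, flatness of a tent means that its edge lengths are
  those of a doubly periodic planar development. The lengths give finitely many polynomial equations
  with a small parameter \<open>e\<close>; after rescaling the unknowns by suitable powers of \<open>e\<close> the system becomes
  constant as \<open>e\<close> tends to \<open>0\<close>, so that a contraction argument yields solutions depending continuously
  on \<open>e\<close>. Embeddedness and the list of faces in the convex hull depend only on the signs of 25
  determinants of vertex quadruples, which are read off from their leading terms. The two choices of
  powers of \<open>e\<close> make the torus collapse onto an arbitrary rectangle, or onto an arbitrary isosceles trapezoid
  whose diagonals are as long as its base; equilateral triangles are the degenerate trapezoids. The Hausdorff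
  distance to the collapsed torus is at most the distance of the vertex tuples.\<close>

text \<open>In the limit the eight points are coplanar, so all 25 determinants vanish, and
  coefficients of the flatness equations degenerate: \<open>2*y - n\<close> when \<open>y\<close>
  tends to 0, \<open>\<eta> + B - b\<close> in the rectangle family. Signs and solvability are
  therefore decided by comparing small scales. The vertex \<open>p\<^sub>0\<close> has height
  \<open>L - d\<close>, while \<open>p\<^sub>1\<close>, \<open>p\<^sub>2\<close>,
  \<open>p\<^sub>3\<close> have heights \<open>d\<close>, \<open>- d\<close>, \<open>0\<close>; a
  further scale \<open>\<kappa>\<close> measures the offsets \<open>K\<close> and \<open>n\<close>.
  The signs come out right when \<open>\<kappa>\<close> is small against \<open>y\<close>,
  \<open>d*y\<close> against \<open>(L - d)*\<kappa>\<close> and \<open>c*\<kappa>\<close> against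
  \<open>b\<close>, and when \<open>K/\<kappa>\<close> has a positive and \<open>n/\<kappa>\<close>
  a nonnegative limit. The parameters are tuned for the last condition: it asks for a positive
  \<open>z - c\<close> of the right order. Since \<open>L^2 = \<eta>^2 - 2*\<eta>*y\<close>, there
  are two ways to collapse: \<open>y\<close> tends to 0 and the tent folds into the plane of
  vanishing second coordinate (trapezoids), or \<open>L\<close> tends to 0 and it is flattened into
  the plane of vanishing third coordinate (rectangles).\<close>

lemma UNIV_8: "(UNIV::8 set) = {0,1,2,3,4,5,6,7}"
proof -
  have "x \<in> {0,1,2,3,4,5,6,7}" for x :: 8
  proof -
    obtain z where z: "x = of_int z" "0 \<le> z" "z < int CARD(8)"
      using bit0_cases[of x] by auto
    then have "z \<in> {0,1,2,3,4,5,6,7}" by auto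
    then show ?thesis using z(1) by auto
  qed
  then show ?thesis by blast
qed

lemma all_8: "(\<forall>i::8. P i) \<longleftrightarrow> P 0 \<and> P 1 \<and> P 2 \<and> P 3 \<and> P 4 \<and> P 5 \<and> P 6 \<and> P 7"
proof -
  have "(\<forall>i. P i) \<longleftrightarrow> (\<forall>i\<in>{0,1,2,3,4,5,6,7::8}. P i)"
    unfolding UNIV_8[symmetric] by simp
  then show ?thesis by simp
qed

lemma ex_8: "(\<exists>i::8. P i) \<longleftrightarrow> P 0 \<or> P 1 \<or> P 2 \<or> P 3 \<or> P 4 \<or> P 5 \<or> P 6 \<or> P 7"
proof -
  have "(\<exists>i. P i) \<longleftrightarrow> (\<exists>i\<in>{0,1,2,3,4,5,6,7::8}. P i)"
    unfolding UNIV_8[symmetric] by simp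
  then show ?thesis by simp
qed

section \<open>Translation invariance and vertex links of the triangulation\<close>

lemma uniform_triangulation_iff:
  "t \<in> uniform_triangulation \<longleftrightarrow> (\<exists>a. t = {a, a + 1, a + 3} \<or> t = {a, a + 2, a + 3})"
  unfolding uniform_triangulation_def by blast

lemma uniform_triangulation_translate:
  "{v, v + i, v + j} \<in> uniform_triangulation \<longleftrightarrow> {0, i, j} \<in> uniform_triangulation" for v :: 8
proof -
  have *: "{v + a, v + b, v + c} \<in> uniform_triangulation" if "{a,b,c} \<in> uniform_triangulation" for v a b c :: 8
  proof -
    from that obtain d where "{a,b,c} = {d, d+1, d+3} \<or> {a,b,c} = {d,d+2,d+3}"
      unfolding uniform_triangulation_iff by blast
    then have "(+) v ` {a,b,c} = (+) v ` {d,d+1,d+3} \<or> (+) v ` {a,b,c} = (+) v ` {d,d+2,d+3}"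
      by presburger
    then show ?thesis unfolding uniform_triangulation_iff
      by (intro exI[of _ "v+d"]) (simp add: add.assoc)
  qed
  show ?thesis using *[of 0 i j v] *[of v "v+i" "v+j" "-v"] by auto
qed

text \<open>The link of the vertex \<open>0\<close> as an oriented hexagon 1, 3, 2, 7, 5, 6.
  Translation carries it to every vertex, so that a cone angle is a sum of six angles in cyclic
  order.\<close>

definition link_pairs :: "(8 \<times> 8) set" where
  "link_pairs = {(1,3), (3,2), (2,7), (7,5), (5,6), (6,1)}"

lemma numeral_mod_8: "(8::8) = 0" "(9::8) = 1" "(10::8) = 2"
  by simp_all

lemma triple_eq_iff:
  assumes "y \<noteq> z" "x \<noteq> y" "x \<noteq> z"
  shows "{x, i, j} = {x, y, z} \<longleftrightarrow> i = y \<and> j = z \<or> i = z \<and> j = y"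
proof
  assume e: "{x, i, j} = {x, y, z}"
  then have "y \<in> {x,i,j}" "z \<in> {x,i,j}" by simp_all
  then show "i = y \<and> j = z \<or> i = z \<and> j = y" using assms by auto
qed (elim disjE conjE, simp_all add: insert_commute)

lemma link_pairs_iff:
  "{0, i, j} \<in> uniform_triangulation \<longleftrightarrow> (i, j) \<in> link_pairs \<or> (j, i) \<in> link_pairs"
proof
  assume "{0, i, j} \<in> uniform_triangulation"
  then obtain a where a: "{0, i, j} = {a, a + 1, a + 3} \<or> {0, i, j} = {a, a + 2, a + 3}"
    unfolding uniform_triangulation_iff by blast
  then have "0 \<in> {a, a + 1, a + 3} \<or> 0 \<in> {a, a + 2, a + 3}" by (metis insertI1)
  then have "a = 0 \<or> a + 1 = 0 \<or> a + 3 = 0 \<or> a + 2 = 0" by auto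
  then have "a = 0 \<or> a = -1 \<or> a = -3 \<or> a = -2"
    by (metis add.inverse_unique add.commute)
  moreover have "(-1::8) = 7" "(-3::8) = 5" "(-2::8) = 6" by simp_all
  ultimately have "a = 0 \<or> a = 7 \<or> a = 5 \<or> a = 6" by metis
  then consider "a = 0" | "a = 7" | "a = 5" | "a = 6" by blast
  then show "(i, j) \<in> link_pairs \<or> (j, i) \<in> link_pairs"
  proof cases
    case 1
    then have "{0, i, j} = {0, 1, 3} \<or> {0, i, j} = {0, 2, 3}" using a by (simp add: numeral_mod_8)
    then show ?thesis by (auto simp: triple_eq_iff link_pairs_def)
  next
    case 2
    then have "{0, i, j} = {7, 0, 2} \<or> {0, i, j} = {7, 1, 2}" using a by (simp add: numeral_mod_8)
    moreover have "{7, 0, 2} = {0::8, 7, 2}" by auto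
    moreover have "0 \<notin> {7, 1, 2::8}" by simp
    ultimately have "{0, i, j} = {0, 7, 2}" by (metis insertI1)
    then show ?thesis by (auto simp: triple_eq_iff link_pairs_def)
  next
    case 3
    then have "{0, i, j} = {5, 6, 0} \<or> {0, i, j} = {5, 7, 0}" using a by (simp add: numeral_mod_8)
    moreover have "{5, 6, 0} = {0::8, 5, 6}" "{5, 7, 0} = {0::8, 5, 7}" by auto
    ultimately have "{0, i, j} = {0, 5, 6} \<or> {0, i, j} = {0, 5, 7}" by metis
    then show ?thesis by (auto simp: triple_eq_iff link_pairs_def)
  next
    case 4
    then have "{0, i, j} = {6, 7, 1} \<or> {0, i, j} = {6, 0, 1}" using a by (simp add: numeral_mod_8)
    moreover have "{6, 0, 1} = {0::8, 6, 1}" by auto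
    moreover have "0 \<notin> {6, 7, 1::8}" by simp
    ultimately have "{0, i, j} = {0, 6, 1}" by (metis insertI1)
    then have "i = 6 \<and> j = 1 \<or> i = 1 \<and> j = 6" by (simp add: triple_eq_iff)
    then show ?thesis by (elim disjE conjE) (simp_all add: link_pairs_def)
  qed
next
  assume "(i, j) \<in> link_pairs \<or> (j, i) \<in> link_pairs"
  moreover have "{0, i, j} = {0, j, i}" by (simp add: insert_commute)
  moreover have "{0, i, j} \<in> uniform_triangulation" if "(i, j) \<in> link_pairs" for i j
  proof -
    have "{0,1,3} = {0::8,0+1,0+3}" "{0,3,2} = {0::8,0+2,0+3}" "{0,2,7} = {7::8,7+1,7+3}"
      "{0,7,5} = {5::8,5+2,5+3}" "{0,5,6} = {5::8,5+1,5+3}" "{0,6,1} = {6::8,6+2,6+3}"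
      by (simp_all add: numeral_mod_8 insert_commute)
    then show ?thesis using that unfolding uniform_triangulation_iff link_pairs_def by blast
  qed
  ultimately show "{0, i, j} \<in> uniform_triangulation" by metis
qed

section \<open>Cone angles computed in a planar development\<close>

lemma angle_at_commute: "angle_at a b c = angle_at a c b"
  by (simp add: angle_at_def inner_commute mult.commute)

text \<open>\<open>cone_angle\<close> counts a triangle once by demanding \<open>b < c\<close>,
  \<open>link_pairs\<close> counts it once by the orientation of the link. The map
  \<open>\<phi>\<close> sorts a pair, its inverse restores the orientation.\<close>

lemma cone_angle_eq:
  "cone_angle p v = (\<Sum>(i,j)\<in>link_pairs. angle_at (p $ v) (p $ (v + i)) (p $ (v + j)))"
proof -
  define \<phi> where "\<phi> = (\<lambda>(i::8,j::8). if v + i < v + j then (v + i, v + j) else (v + j, v + i))"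
  have ne: "i \<noteq> j" "(j, i) \<notin> link_pairs" if "(i,j) \<in> link_pairs" for i j
  proof -
    have "\<forall>x\<in>link_pairs. fst x \<noteq> snd x \<and> (snd x, fst x) \<notin> link_pairs"
      unfolding link_pairs_def by simp
    then show "i \<noteq> j" "(j, i) \<notin> link_pairs" using that by force+
  qed
  have tri: "{v, b, c} \<in> uniform_triangulation \<longleftrightarrow> (b - v, c - v) \<in> link_pairs \<or> (c - v, b - v) \<in> link_pairs" for b c
    using uniform_triangulation_translate[of v "b - v" "c - v"] link_pairs_iff[of "b - v" "c - v"] by simp
  have "bij_betw \<phi> link_pairs {(b, c). b < c \<and> {v, b, c} \<in> uniform_triangulation}"
  proof (rule bij_betwI[where g = "\<lambda>(b, c). if (b - v, c - v) \<in> link_pairs then (b - v, c - v) else (c - v, b - v)"])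
    show "\<phi> \<in> link_pairs \<rightarrow> {(b, c). b < c \<and> {v, b, c} \<in> uniform_triangulation}"
    proof
      fix x assume x: "x \<in> link_pairs"
      obtain i j where ij: "x = (i,j)" by fastforce
      show "\<phi> x \<in> {(b, c). b < c \<and> {v, b, c} \<in> uniform_triangulation}"
        using x ne[of i j] unfolding ij \<phi>_def by (auto simp: tri not_less le_less)
    qed
    show "(\<lambda>(b, c). if (b - v, c - v) \<in> link_pairs then (b - v, c - v) else (c - v, b - v))
       \<in> {(b, c). b < c \<and> {v, b, c} \<in> uniform_triangulation} \<rightarrow> link_pairs"
      by (auto simp: tri)
    fix x assume x: "x \<in> link_pairs"
    obtain i j where ij: "x = (i,j)" by fastforce
    show "(case \<phi> x of (b, c) \<Rightarrow> if (b - v, c - v) \<in> link_pairs then (b - v, c - v) else (c - v, b - v)) = x"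
      using x ne[of i j] unfolding ij \<phi>_def by auto
  next
    fix y assume y: "y \<in> {(b, c). b < c \<and> {v, b, c} \<in> uniform_triangulation}"
    obtain b c where bc: "y = (b,c)" by fastforce
    then have "b < c" using y by simp
    then show "\<phi> (case y of (b, c) \<Rightarrow> if (b - v, c - v) \<in> link_pairs then (b - v, c - v) else (c - v, b - v)) = y"
      unfolding bc \<phi>_def by (auto simp: not_less)
  qed
  then have "cone_angle p v = (\<Sum>x\<in>link_pairs. case \<phi> x of (b,c) \<Rightarrow> angle_at (p $ v) (p $ b) (p $ c))"
    unfolding cone_angle_def by (rule sum.reindex_bij_betw[symmetric])
  also have "\<dots> = (\<Sum>(i,j)\<in>link_pairs. angle_at (p $ v) (p $ (v + i)) (p $ (v + j)))"
    by (rule sum.cong) (auto simp: \<phi>_def angle_at_commute)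
  finally show ?thesis .
qed

lemma sum_link_pairs:
  "(\<Sum>(i,j)\<in>link_pairs. f i j) = f 1 3 + f 3 2 + f 2 7 + f 7 5 + f 5 6 + (f 6 1 :: real)"
  unfolding link_pairs_def by simp

text \<open>If \<open>y\<close> lies counterclockwise of \<open>x\<close>, the argument of
  \<open>y / x\<close> is strictly between 0 and \<open>pi\<close>, where \<open>arccos\<close>
  inverts the cosine. Writing angles as arguments turns their sums into products of
  quotients.\<close>

lemma Arg_quotient_eq_angle:
  assumes "Im (cnj x * y) > 0"
  shows "arccos ((x \<bullet> y) / (norm x * norm y)) = Arg (y / x)" "Arg (y / x) > 0" "Arg (y / x) < pi"
proof -
  have x: "x \<noteq> 0" and y: "y \<noteq> 0" using assms by auto
  have q: "y / x = (cnj x * y) / of_real ((norm x)\<^sup>2)"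
    using complex_div_cnj[of y x] by (simp add: mult.commute)
  have im: "Im (y / x) > 0" unfolding q Im_divide_of_real using assms x by simp
  then show "Arg (y / x) > 0" "Arg (y / x) < pi"
    using Arg_lt_pi[of "y/x"] by auto
  have re: "Re (cnj x * y) = x \<bullet> y" by (simp add: inner_complex_def)
  have "cos (Arg (y / x)) = Re (y / x) / norm (y / x)"
    using x y by (simp add: cos_Arg)
  also have "\<dots> = (x \<bullet> y) / (norm x * norm y)"
    unfolding q Re_divide_of_real re using x y
    by (simp add: norm_divide norm_mult power2_eq_square field_simps)
  finally have "(x \<bullet> y) / (norm x * norm y) = cos (Arg (y / x))" by simp
  then show "arccos ((x \<bullet> y) / (norm x * norm y)) = Arg (y / x)"
    using \<open>Arg (y / x) > 0\<close> \<open>Arg (y / x) < pi\<close> by (simp add: arccos_cos)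
qed

text \<open>By the law of cosines the side lengths determine the inner product, hence the angle,
  which may thus be measured in the developed triangle.\<close>

lemma angle_at_development:
  fixes a b c :: "'a::real_inner" and x y :: complex
  assumes "norm x = dist a b" "norm y = dist a c" "norm (y - x) = dist b c" "Im (cnj x * y) > 0"
  shows "angle_at a b c = Arg (y / x)"
proof -
  have "(b - a) \<bullet> (c - a) = x \<bullet> y"
  proof -
    have "(norm ((c - a) - (b - a)))\<^sup>2 = (norm (y - x))\<^sup>2"
      using assms(3) by (simp add: dist_norm norm_minus_commute)
    moreover have "(norm (b - a))\<^sup>2 = (norm x)\<^sup>2" "(norm (c - a))\<^sup>2 = (norm y)\<^sup>2"
      using assms(1,2) by (simp_all add: dist_norm norm_minus_commute)
    ultimately show ?thesis
      by (simp add: power2_norm_eq_inner inner_diff_left inner_diff_right inner_commute)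
  qed
  moreover have "norm (b - a) = norm x" "norm (c - a) = norm y"
    using assms(1,2) by (simp_all add: dist_norm norm_minus_commute)
  ultimately show ?thesis
    unfolding angle_at_def using Arg_quotient_eq_angle(1)[OF assms(4)] by simp
qed

lemma cis_sum_Arg:
  assumes "\<And>z. z \<in> set zs \<Longrightarrow> z \<noteq> 0"
  shows "cis (sum_list (map Arg zs)) = sgn (prod_list zs)"
  using assms by (induction zs) (auto simp: cis_mult[symmetric] sgn_mult cis_Arg)

text \<open>The three quotients multiply to -1, so the sum is \<open>pi\<close> modulo
  \<open>2 * pi\<close>. It lies strictly between 0 and \<open>3 * pi\<close>, which leaves only
  \<open>pi\<close>.\<close>

lemma angle_sum_development:
  assumes "Im (cnj x * y) > 0"
  shows "Arg (y / x) + Arg (- x / (y - x)) + Arg ((x - y) / (- y)) = pi"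
proof -
  have pos: "Im (cnj (y - x) * (- x)) > 0" "Im (cnj (- y) * (x - y)) > 0"
    using assms by (simp_all add: algebra_simps)
  note A = Arg_quotient_eq_angle(2,3)[OF assms] Arg_quotient_eq_angle(2,3)[OF pos(1)] Arg_quotient_eq_angle(2,3)[OF pos(2)]
  have nz: "x \<noteq> 0" "y \<noteq> 0" "y - x \<noteq> 0" using assms pos by auto
  let ?s = "Arg (y / x) + Arg (- x / (y - x)) + Arg ((x - y) / (- y))"
  have "cis ?s = sgn ((y / x) * (- x / (y - x)) * ((x - y) / (- y)))"
  proof -
    have "cis (sum_list (map Arg [y / x, - x / (y - x), (x - y) / (- y)])) = sgn (prod_list [y / x, - x / (y - x), (x - y) / (- y)])"
      by (rule cis_sum_Arg) (use nz in auto)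
    then show ?thesis by (simp only: list.map sum_list.Cons sum_list.Nil prod_list.Cons prod_list.Nil add_0_right mult_1_right add.assoc mult.assoc)
  qed
  also have "(y / x) * (- x / (y - x)) * ((x - y) / (- y)) = - 1"
    using nz by (simp add: divide_simps)
  finally have "cis ?s = - 1" by (simp add: sgn_minus)
  then have "cis (?s - pi) = 1" by (simp add: cis_divide[symmetric])
  then obtain n :: int where n: "?s - pi = 2 * pi * n"
    by (metis cis.simps(1) cos_one_2pi_int mult.commute mult.left_commute one_complex.simps(1))
  have "n = 0"
  proof (rule ccontr)
    assume "n \<noteq> 0"
    then have "n \<ge> 1 \<or> n \<le> -1" by linarith
    then show False
    proof
      assume "n \<ge> 1" then have "2 * pi * n \<ge> 2 * pi * 1" by (intro mult_left_mono) auto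
      then show False using n A by linarith
    next
      assume "n \<le> -1" then have "2 * pi * n \<le> 2 * pi * (-1)" by (intro mult_left_mono) auto
      then show False using n A pi_gt_zero by linarith
    qed
  qed
  then show ?thesis using n by simp
qed

lemma sum_translate_8: "(\<Sum>v\<in>(UNIV::8 set). f (v + k)) = (\<Sum>v\<in>UNIV. f v :: real)"
  by (rule sum.reindex_bij_witness[of _ "\<lambda>v. v - k" "\<lambda>v. v + k"]) auto

text \<open>\<open>A a\<close>, \<open>B a\<close>, \<open>C a\<close> are the vectors of the edges from \<open>a\<close> to \<open>a + 1\<close>, \<open>a + 2\<close>, \<open>a + 3\<close>
  in a planar development of the torus. Around a vertex the developed directions close up, so its cone
  angle is a positive multiple of \<open>2 * pi\<close>; as the 16 triangles have total angle \<open>16 * pi\<close>, every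
  cone angle must be exactly \<open>2 * pi\<close>.\<close>

lemma cone_angle_development:
  fixes p :: "(real^3)^8" and A B C :: "8 \<Rightarrow> complex"
  assumes C1: "\<And>a. C a = A a + B (a + 1)" and C2: "\<And>a. C a = B a + A (a + 2)"
    and A: "\<And>a. norm (A a) = dist (p $ a) (p $ (a + 1))"
    and B: "\<And>a. norm (B a) = dist (p $ a) (p $ (a + 2))"
    and C: "\<And>a. norm (C a) = dist (p $ a) (p $ (a + 3))"
    and or1: "\<And>a. Im (cnj (A a) * C a) > 0" and or2: "\<And>a. Im (cnj (C a) * B a) > 0"
  shows "cone_angle p v = 2 * pi"
proof -
  \<comment> \<open>The six angles at \<open>v\<close> in the order of the link. The neighbours
    \<open>v + 7\<close>, \<open>v + 5\<close>, \<open>v + 6\<close> are reached along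
    \<open>A (v + 7)\<close>, \<open>C (v + 5)\<close>, \<open>B (v + 6)\<close> traversed
    backwards, hence the minus signs.\<close>
  define \<theta>1 \<theta>2 \<theta>3 \<theta>4 \<theta>5 \<theta>6 where
    "\<theta>1 = (\<lambda>v. Arg (C v / A v))" and "\<theta>2 = (\<lambda>v. Arg (B v / C v))"
    and "\<theta>3 = (\<lambda>v. Arg (- A (v + 7) / B v))" and "\<theta>4 = (\<lambda>v. Arg (- C (v + 5) / (- A (v + 7))))"
    and "\<theta>5 = (\<lambda>v. Arg (- B (v + 6) / (- C (v + 5))))" and "\<theta>6 = (\<lambda>v. Arg (A v / (- B (v + 6))))"
  have C1': "C (v + 7) = A (v + 7) + B v" "C (v + 5) = A (v + 5) + B (v + 6)" for v
    using C1[of "v + 7"] C1[of "v + 5"] by (simp_all add: add.assoc numeral_mod_8)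
  have C2': "C (v + 6) = B (v + 6) + A v" "C (v + 5) = B (v + 5) + A (v + 7)" for v
    using C2[of "v + 6"] C2[of "v + 5"] by (simp_all add: add.assoc numeral_mod_8)
  have A': "norm (A (v + 7)) = dist (p $ v) (p $ (v + 7))" for v
    using A[of "v + 7"] by (simp add: add.assoc numeral_mod_8 dist_commute)
  have B': "norm (B (v + 6)) = dist (p $ v) (p $ (v + 6))" for v
    using B[of "v + 6"] by (simp add: add.assoc numeral_mod_8 dist_commute)
  have C': "norm (C (v + 5)) = dist (p $ v) (p $ (v + 5))" for v
    using C[of "v + 5"] by (simp add: add.assoc numeral_mod_8 dist_commute)
  have im: "Im (cnj (A v) * C v) > 0" "Im (cnj (C v) * B v) > 0"
    "Im (cnj (B v) * (- A (v + 7))) > 0" "Im (cnj (- A (v + 7)) * (- C (v + 5))) > 0"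
    "Im (cnj (- C (v + 5)) * (- B (v + 6))) > 0" "Im (cnj (- B (v + 6)) * A v) > 0" for v
  proof -
    show "Im (cnj (A v) * C v) > 0" "Im (cnj (C v) * B v) > 0" by (rule or1, rule or2)
    have *: "B v = C (v + 7) - A (v + 7)" using C1'(1)[of v] by simp
    show "Im (cnj (B v) * (- A (v + 7))) > 0" unfolding * using or1[of "v + 7"] by (simp add: algebra_simps)
    have *: "A (v + 7) = C (v + 5) - B (v + 5)" using C2'(2)[of v] by simp
    show "Im (cnj (- A (v + 7)) * (- C (v + 5))) > 0" unfolding * using or2[of "v + 5"] by (simp add: algebra_simps)
    have *: "B (v + 6) = C (v + 5) - A (v + 5)" using C1'(2)[of v] by simp
    show "Im (cnj (- C (v + 5)) * (- B (v + 6))) > 0" unfolding * using or1[of "v + 5"] by (simp add: algebra_simps)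
    have *: "A v = C (v + 6) - B (v + 6)" using C2'(1)[of v] by simp
    show "Im (cnj (- B (v + 6)) * A v) > 0" unfolding * using or2[of "v + 6"] by (simp add: algebra_simps)
  qed
  have d: "norm (C v - A v) = dist (p $ (v + 1)) (p $ (v + 3))"
    "norm (B v - C v) = dist (p $ (v + 3)) (p $ (v + 2))"
    "norm (- A (v + 7) - B v) = dist (p $ (v + 2)) (p $ (v + 7))"
    "norm (- C (v + 5) - - A (v + 7)) = dist (p $ (v + 7)) (p $ (v + 5))"
    "norm (- B (v + 6) - - C (v + 5)) = dist (p $ (v + 5)) (p $ (v + 6))"
    "norm (A v - - B (v + 6)) = dist (p $ (v + 6)) (p $ (v + 1))" for v
  proof -
    have "C v - A v = B (v + 1)" using C1[of v] by simp
    then show "norm (C v - A v) = dist (p $ (v + 1)) (p $ (v + 3))" using B[of "v + 1"] by (simp add: add.assoc numeral_mod_8)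
    have "B v - C v = - A (v + 2)" using C2[of v] by simp
    then show "norm (B v - C v) = dist (p $ (v + 3)) (p $ (v + 2))"
      using A[of "v + 2"] by (simp add: add.assoc numeral_mod_8 dist_commute)
    have "- A (v + 7) - B v = - C (v + 7)" using C1'(1)[of v] by simp
    then show "norm (- A (v + 7) - B v) = dist (p $ (v + 2)) (p $ (v + 7))"
      using C[of "v + 7"] by (simp add: add.assoc numeral_mod_8 dist_commute)
    have "- C (v + 5) - - A (v + 7) = - B (v + 5)" using C2'(2)[of v] by simp
    then show "norm (- C (v + 5) - - A (v + 7)) = dist (p $ (v + 7)) (p $ (v + 5))"
      using B[of "v + 5"] by (simp add: add.assoc numeral_mod_8 dist_commute)
    have "- B (v + 6) - - C (v + 5) = A (v + 5)" using C1'(2)[of v] by simp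
    then show "norm (- B (v + 6) - - C (v + 5)) = dist (p $ (v + 5)) (p $ (v + 6))"
      using A[of "v + 5"] by (simp add: add.assoc numeral_mod_8)
    have "A v - - B (v + 6) = C (v + 6)" using C2'(1)[of v] by simp
    then show "norm (A v - - B (v + 6)) = dist (p $ (v + 6)) (p $ (v + 1))"
      using C[of "v + 6"] by (simp add: add.assoc numeral_mod_8)
  qed
  have \<theta>: "angle_at (p $ v) (p $ (v + 1)) (p $ (v + 3)) = \<theta>1 v"
    "angle_at (p $ v) (p $ (v + 3)) (p $ (v + 2)) = \<theta>2 v"
    "angle_at (p $ v) (p $ (v + 2)) (p $ (v + 7)) = \<theta>3 v"
    "angle_at (p $ v) (p $ (v + 7)) (p $ (v + 5)) = \<theta>4 v"
    "angle_at (p $ v) (p $ (v + 5)) (p $ (v + 6)) = \<theta>5 v"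
    "angle_at (p $ v) (p $ (v + 6)) (p $ (v + 1)) = \<theta>6 v" for v
    unfolding \<theta>1_def \<theta>2_def \<theta>3_def \<theta>4_def \<theta>5_def \<theta>6_def
    by (rule angle_at_development; simp only: norm_minus_cancel A[of v] B[of v] C[of v] A' B' C' d im)+
  have cone: "cone_angle p v = \<theta>1 v + \<theta>2 v + \<theta>3 v + \<theta>4 v + \<theta>5 v + \<theta>6 v" for v
    unfolding cone_angle_eq sum_link_pairs \<theta> ..
  have ge: "cone_angle p v \<ge> 2 * pi" for v
  proof -
    have nz: "A v \<noteq> 0" "B v \<noteq> 0" "C v \<noteq> 0" for v using or1[of v] or2[of v] by auto
    let ?L = "[C v / A v, B v / C v, - A (v + 7) / B v, - C (v + 5) / (- A (v + 7)),
      - B (v + 6) / (- C (v + 5)), A v / (- B (v + 6))]"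
    \<comment> \<open>Each direction occurs once as a numerator and once as a denominator, so the
      product telescopes around the vertex.\<close>
    have "prod_list ?L = 1" using nz by (simp add: field_simps)
    moreover have "cis (sum_list (map Arg ?L)) = sgn (prod_list ?L)"
      by (rule cis_sum_Arg) (use nz in auto)
    moreover have "sum_list (map Arg ?L) = cone_angle p v"
      unfolding cone \<theta>1_def \<theta>2_def \<theta>3_def \<theta>4_def \<theta>5_def \<theta>6_def by (simp add: add.assoc numeral_mod_8)
    ultimately have "cis (cone_angle p v) = 1" by simp
    then obtain n :: int where n: "cone_angle p v = 2 * pi * n"
      by (metis cis.simps(1) cos_one_2pi_int mult.commute mult.left_commute one_complex.simps(1))
    have "\<theta>1 v > 0" "\<theta>2 v > 0" "\<theta>3 v > 0" "\<theta>4 v > 0" "\<theta>5 v > 0" "\<theta>6 v > 0"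
      unfolding \<theta>1_def \<theta>2_def \<theta>3_def \<theta>4_def \<theta>5_def \<theta>6_def
      using im[of v] by (blast intro: Arg_quotient_eq_angle(2))+
    then have "0 < 2 * pi * n" using n cone[of v] by linarith
    then have "0 < n" by (simp add: zero_less_mult_iff)
    then have "2 * pi * 1 \<le> 2 * pi * n" by (intro mult_left_mono) auto
    then show ?thesis using n by simp
  qed
  \<comment> \<open>The corners of \<open>{a, a + 1, a + 3}\<close> carry the angle types 1, 3, 5,
    those of \<open>{a, a + 2, a + 3}\<close> the types 2, 6, 4. Every type at every vertex is thus
    used exactly once.\<close>
  have tri1: "\<theta>1 a + \<theta>3 (a + 1) + \<theta>5 (a + 3) = pi" for a
  proof -
    have "\<theta>3 (a + 1) = Arg (- A a / (C a - A a))" "\<theta>5 (a + 3) = Arg ((A a - C a) / (- C a))"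
      unfolding \<theta>3_def \<theta>5_def using C1[of a] by (simp_all add: add.assoc numeral_mod_8)
    then show ?thesis using angle_sum_development[OF or1[of a]] unfolding \<theta>1_def by simp
  qed
  have tri2: "\<theta>2 a + \<theta>4 (a + 3) + \<theta>6 (a + 2) = pi" for a
  proof -
    have "\<theta>4 (a + 3) = Arg (- C a / (B a - C a))" "\<theta>6 (a + 2) = Arg ((C a - B a) / (- B a))"
      unfolding \<theta>4_def \<theta>6_def using C2[of a] by (simp_all add: add.assoc numeral_mod_8)
    then show ?thesis using angle_sum_development[OF or2[of a]] unfolding \<theta>2_def by simp
  qed
  have "(\<Sum>v\<in>UNIV. cone_angle p v) = (\<Sum>v\<in>UNIV. \<theta>1 v) + (\<Sum>v\<in>UNIV. \<theta>3 (v + 1)) + (\<Sum>v\<in>UNIV. \<theta>5 (v + 3))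
     + ((\<Sum>v\<in>UNIV. \<theta>2 v) + (\<Sum>v\<in>UNIV. \<theta>4 (v + 3)) + (\<Sum>v\<in>UNIV. \<theta>6 (v + 2)))"
    unfolding cone sum.distrib sum_translate_8 by simp
  also have "\<dots> = (\<Sum>v\<in>(UNIV::8 set). pi) + (\<Sum>v\<in>(UNIV::8 set). pi)"
    unfolding sum.distrib[symmetric] tri1 tri2 ..
  finally have tot: "(\<Sum>v\<in>UNIV. cone_angle p v) = (\<Sum>v\<in>(UNIV::8 set). 2 * pi)" by simp
  \<comment> \<open>No cone angle is below \<open>2 * pi\<close>, and their average equals
    \<open>2 * pi\<close>.\<close>
  have "\<forall>v\<in>UNIV. cone_angle p v - 2 * pi = 0"
    using sum_nonneg_eq_0_iff[of UNIV "\<lambda>v. cone_angle p v - 2 * pi"] ge tot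
    by (simp add: sum_subtractf)
  then show ?thesis by simp
qed

unbundle cross3_syntax

subsection \<open>Orientation of four points\<close>

text \<open>Six times the signed volume of a tetrahedron; the sign tells on which side of the plane
  through \<open>a\<close>, \<open>b\<close>, \<open>c\<close> the point \<open>d\<close>
  lies.\<close>

definition orient :: "real^3 \<Rightarrow> real^3 \<Rightarrow> real^3 \<Rightarrow> real^3 \<Rightarrow> real" where
  "orient a b c d = ((b - a) \<times> (c - a)) \<bullet> (d - a)"

lemma orient_coords:
  "orient a b c d =
     ((b$2 - a$2) * (c$3 - a$3) - (b$3 - a$3) * (c$2 - a$2)) * (d$1 - a$1) +
     ((b$3 - a$3) * (c$1 - a$1) - (b$1 - a$1) * (c$3 - a$3)) * (d$2 - a$2) +
     ((b$1 - a$1) * (c$2 - a$2) - (b$2 - a$2) * (c$1 - a$1)) * (d$3 - a$3)"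
  by (simp add: orient_def cross3_def inner_vec_def sum_3)

lemma orient_swap:
  "orient b a c d = - orient a b c d" "orient a c b d = - orient a b c d" "orient a b d c = - orient a b c d"
  unfolding orient_coords by algebra+

lemma orient_refl: "orient a b c a = 0" "orient a b c b = 0" "orient a b c c = 0"
  unfolding orient_coords by algebra+

lemma orient_affine: "orient a b c x = ((b - a) \<times> (c - a)) \<bullet> x - ((b - a) \<times> (c - a)) \<bullet> a"
  by (simp add: orient_def inner_diff_right)

lemma orient_\<rho>: "orient (\<rho> a) (\<rho> b) (\<rho> c) (\<rho> d) = orient a b c d"
  unfolding orient_coords \<rho>_def by (simp add: vector_3 algebra_simps)

text \<open>A vector orthogonal to \<open>u\<close> and \<open>v\<close> is parallel to
  \<open>u \<times> v\<close>. Scaling by the squared length avoids a division and covers dependent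
  \<open>u\<close>, \<open>v\<close>.\<close>

lemma dot_normal_eq:
  assumes "(n::real^3) \<bullet> u = 0" "n \<bullet> v = 0"
  shows "((u \<times> v) \<bullet> (u \<times> v)) *\<^sub>R n = (n \<bullet> (u \<times> v)) *\<^sub>R (u \<times> v)"
proof -
  have "n \<times> (u \<times> v) = 0" using assms by (simp add: Lagrange)
  then have "(u \<times> v) \<times> (n \<times> (u \<times> v)) = 0" by simp
  then show ?thesis using Lagrange[of "u \<times> v" n "u \<times> v"] by (simp add: inner_commute)
qed

text \<open>The cross product with one edge vector kills that edge and isolates the coefficient of
  the other.\<close>

lemma affine_dependence_face:
  assumes "l1 + l2 + l3 = (0::real)" "l1 *\<^sub>R a + l2 *\<^sub>R b + l3 *\<^sub>R c = (0::real^3)" "(b - a) \<times> (c - a) \<noteq> 0"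
  shows "l1 = 0" "l2 = 0" "l3 = 0"
proof -
  have "l1 = - l2 - l3" using assms(1) by simp
  then have "l2 *\<^sub>R (b - a) + l3 *\<^sub>R (c - a) = 0"
    using assms(2) unfolding \<open>l1 = - l2 - l3\<close> by (simp add: algebra_simps)
  then have "(l2 *\<^sub>R (b - a) + l3 *\<^sub>R (c - a)) \<times> (c - a) = 0" "(b - a) \<times> (l2 *\<^sub>R (b - a) + l3 *\<^sub>R (c - a)) = 0"
    by simp_all
  then have "l2 *\<^sub>R ((b - a) \<times> (c - a)) = 0" "l3 *\<^sub>R ((b - a) \<times> (c - a)) = 0"
    by (simp_all add: cross_add_left cross_add_right cross_mult_left cross_mult_right)
  then show "l2 = 0" "l3 = 0" using assms(3) by simp_all
  then show "l1 = 0" using \<open>l1 = - l2 - l3\<close> by simp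
qed

subsection \<open>Combinatorial certificate of embeddedness\<close>

text \<open>Vertices are encoded as natural numbers, so that comparisons of indices are settled by
  arithmetic when determinants are sorted; \<open>of_nat\<close> leads back to the vertices of the
  triangulation.\<close>

definition hull_list :: "(nat \<times> nat \<times> nat) list" where
  "hull_list = [(1,2,7), (1,2,4), (2,4,5), (2,3,5), (3,5,6), (0,5,6)]"

definition inner_list :: "(nat \<times> nat \<times> nat) list" where
  "inner_list = [(0,1,3), (0,2,3), (1,3,4), (3,4,6), (4,5,7), (4,6,7), (0,5,7), (1,6,7), (0,1,6), (0,2,7)]"

definition verts :: "nat \<times> nat \<times> nat \<Rightarrow> nat set" where
  "verts = (\<lambda>(i,j,k). {i,j,k})"

text \<open>An entry \<open>(s, t, e)\<close> says that the plane through the three vertices of \<open>e\<close> separates the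
  triangles \<open>s\<close> and \<open>t\<close>: the other vertices of \<open>s\<close> are on its positive side, those of \<open>t\<close> on its
  negative side, and \<open>s\<close>, \<open>t\<close> have no common vertex outside \<open>e\<close>.\<close>

definition certificates :: "((nat \<times> nat \<times> nat) \<times> (nat \<times> nat \<times> nat) \<times> (nat \<times> nat \<times> nat)) list" where
  "certificates =
  [((0,1,3),(0,1,6),(0,1,3)), ((0,1,3),(0,2,3),(1,0,3)), ((0,1,3),(0,2,7),(1,0,2)),
   ((0,1,3),(0,5,7),(5,0,7)), ((0,1,3),(1,3,4),(0,1,3)), ((0,1,3),(1,6,7),(0,1,6)),
   ((0,1,3),(3,4,6),(0,1,3)), ((0,1,3),(4,5,7),(5,0,7)), ((0,1,3),(4,6,7),(0,1,6)),
   ((0,1,6),(0,2,3),(1,0,3)), ((0,1,6),(0,2,7),(0,1,7)), ((0,1,6),(0,5,7),(0,1,5)),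
   ((0,1,6),(1,3,4),(1,3,4)), ((0,1,6),(1,6,7),(0,1,6)), ((0,1,6),(3,4,6),(1,3,6)),
   ((0,1,6),(4,5,7),(0,1,6)), ((0,1,6),(4,6,7),(0,1,6)), ((0,2,3),(0,2,7),(2,0,3)),
   ((0,2,3),(0,5,7),(0,2,5)), ((0,2,3),(1,3,4),(0,1,3)), ((0,2,3),(1,6,7),(2,0,7)),
   ((0,2,3),(3,4,6),(0,2,3)), ((0,2,3),(4,5,7),(0,2,5)), ((0,2,3),(4,6,7),(2,0,7)),
   ((0,2,7),(0,5,7),(2,0,7)), ((0,2,7),(1,3,4),(0,1,2)), ((0,2,7),(1,6,7),(1,0,7)),
   ((0,2,7),(3,4,6),(0,2,3)), ((0,2,7),(4,5,7),(2,0,7)), ((0,2,7),(4,6,7),(2,0,7)),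
   ((0,5,7),(1,3,4),(5,4,7)), ((0,5,7),(1,6,7),(0,5,7)), ((0,5,7),(3,4,6),(5,4,6)),
   ((0,5,7),(4,5,7),(5,0,7)), ((0,5,7),(4,6,7),(5,4,7)), ((1,3,4),(1,6,7),(3,1,6)),
   ((1,3,4),(3,4,6),(3,1,4)), ((1,3,4),(4,5,7),(4,5,7)), ((1,3,4),(4,6,7),(1,4,6)),
   ((1,6,7),(3,4,6),(1,3,6)), ((1,6,7),(4,5,7),(4,5,7)), ((1,6,7),(4,6,7),(1,6,7)),
   ((3,4,6),(4,5,7),(4,5,6)), ((3,4,6),(4,6,7),(3,4,6)), ((4,5,7),(4,6,7),(5,4,7))]"

text \<open>The signs of \<open>orient\<close> at these 25 of the 70 quadruples of vertices suffice; \<open>\<rho>\<close>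
  carries them over to the quadruples \<open>(7 - l, 7 - k, 7 - j, 7 - i)\<close>.\<close>

definition positive_quadruples :: "(nat \<times> nat \<times> nat \<times> nat) list" where
  "positive_quadruples =
    [(0,1,2,7), (0,1,4,6), (0,1,5,6), (0,2,3,7), (0,2,4,5), (0,2,5,6), (0,3,5,6), (0,4,5,6),
     (1,2,4,5), (1,2,4,6), (1,3,4,6)]"

definition negative_quadruples :: "(nat \<times> nat \<times> nat \<times> nat) list" where
  "negative_quadruples =
    [(0,1,2,3), (0,1,2,4), (0,1,3,4), (0,1,3,6), (0,1,5,7), (0,1,6,7), (0,2,3,4), (0,2,3,5),
     (0,2,3,6), (0,2,4,7), (0,2,5,7), (1,2,3,4), (1,2,3,5), (2,3,4,5)]"

locale pup_signs =
  fixes P :: "nat \<Rightarrow> real^3"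
  assumes sym: "\<And>i. i \<le> 7 \<Longrightarrow> P (7 - i) = \<rho> (P i)"
    and pos: "\<And>i j k l. (i,j,k,l) \<in> set positive_quadruples \<Longrightarrow> orient (P i) (P j) (P k) (P l) > 0"
    and neg: "\<And>i j k l. (i,j,k,l) \<in> set negative_quadruples \<Longrightarrow> orient (P i) (P j) (P k) (P l) < 0"
begin

definition D :: "nat \<Rightarrow> nat \<Rightarrow> nat \<Rightarrow> nat \<Rightarrow> real" where
  "D i j k l = orient (P i) (P j) (P k) (P l)"

text \<open>As conditional rewrite rules these bring the indices of a determinant into increasing
  order, where its sign can be looked up.\<close>

lemma D_sort:
  "j < i \<Longrightarrow> D i j k l = - D j i k l"
  "k < j \<Longrightarrow> D i j k l = - D i k j l"
  "l < k \<Longrightarrow> D i j k l = - D i j l k"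
  unfolding D_def by (rule orient_swap)+

text \<open>The half-turn \<open>\<rho>\<close> preserves orientation, and reversing the order of
  four points is an even permutation.\<close>

lemma D_reflect: "i \<le> 7 \<Longrightarrow> j \<le> 7 \<Longrightarrow> k \<le> 7 \<Longrightarrow> l \<le> 7 \<Longrightarrow> D (7 - l) (7 - k) (7 - j) (7 - i) = D i j k l"
proof -
  assume "i \<le> 7" "j \<le> 7" "k \<le> 7" "l \<le> 7"
  then have "D (7 - l) (7 - k) (7 - j) (7 - i) = orient (P l) (P k) (P j) (P i)"
    unfolding D_def by (simp add: sym orient_\<rho>)
  also have "\<dots> = orient (P i) (P j) (P k) (P l)"
    unfolding orient_coords by algebra
  finally show ?thesis by (simp add: D_def)
qed

lemma D_pos:
  "D 0 1 2 7 > 0" "D 0 1 4 6 > 0" "D 0 1 5 6 > 0" "D 0 2 3 7 > 0" "D 0 2 4 5 > 0" "D 0 2 5 6 > 0"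
  "D 0 3 5 6 > 0" "D 0 4 5 6 > 0" "D 1 2 4 5 > 0" "D 1 2 4 6 > 0" "D 1 3 4 6 > 0"
  by (unfold D_def; rule pos; simp add: positive_quadruples_def)+

lemma D_neg:
  "D 0 1 2 3 < 0" "D 0 1 2 4 < 0" "D 0 1 3 4 < 0" "D 0 1 3 6 < 0" "D 0 1 5 7 < 0" "D 0 1 6 7 < 0"
  "D 0 2 3 4 < 0" "D 0 2 3 5 < 0" "D 0 2 3 6 < 0" "D 0 2 4 7 < 0" "D 0 2 5 7 < 0" "D 1 2 3 4 < 0"
  "D 1 2 3 5 < 0" "D 2 3 4 5 < 0"
  by (unfold D_def; rule neg; simp add: negative_quadruples_def)+

lemmas D_signs = D_pos D_neg

text \<open>Four of the 25 quadruples are their own reflections; the other 21 yield these signs, so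
  that 46 signs are known in all.\<close>

lemma D_signs':
  "D 0 5 6 7 > 0" "D 1 3 6 7 > 0" "D 1 2 6 7 > 0" "D 0 4 5 7 > 0" "D 2 3 5 7 > 0" "D 1 2 5 7 > 0"
  "D 1 2 4 7 > 0" "D 1 2 3 7 > 0" "D 2 3 5 6 > 0" "D 1 3 5 6 > 0" "D 4 5 6 7 < 0" "D 3 5 6 7 < 0"
  "D 3 4 6 7 < 0" "D 1 4 6 7 < 0" "D 0 2 6 7 < 0" "D 3 4 5 7 < 0" "D 2 4 5 7 < 0" "D 1 4 5 7 < 0"
  "D 0 3 5 7 < 0" "D 3 4 5 6 < 0" "D 2 4 5 6 < 0"
  using D_signs D_reflect[of 0 1 2 7] D_reflect[of 0 1 4 6] D_reflect[of 0 1 5 6] D_reflect[of 0 2 3 7]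
    D_reflect[of 0 2 4 5] D_reflect[of 0 2 5 6] D_reflect[of 0 3 5 6] D_reflect[of 0 4 5 6]
    D_reflect[of 1 2 4 5] D_reflect[of 1 2 4 6] D_reflect[of 0 1 2 3] D_reflect[of 0 1 2 4]
    D_reflect[of 0 1 3 4] D_reflect[of 0 1 3 6] D_reflect[of 0 1 5 7] D_reflect[of 0 2 3 4]
    D_reflect[of 0 2 3 5] D_reflect[of 0 2 3 6] D_reflect[of 0 2 4 7] D_reflect[of 1 2 3 4]
    D_reflect[of 1 2 3 5]
  by simp_all

text \<open>The point \<open>d\<close> with nonzero determinant ensures that \<open>a\<close>,
  \<open>b\<close>, \<open>c\<close> are not collinear. A vertex common to \<open>s\<close> and
  \<open>t\<close> is forced into \<open>{a, b, c}\<close>, which is what makes the separation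
  strict enough for injectivity.\<close>

definition separating :: "nat \<times> nat \<times> nat \<Rightarrow> nat set \<Rightarrow> nat set \<Rightarrow> bool" where
  "separating = (\<lambda>(a,b,c) s t. a < 8 \<and> b < 8 \<and> c < 8 \<and> a \<noteq> b \<and> a \<noteq> c \<and> b \<noteq> c \<and> (\<exists>d\<in>{0,1,2,3,4,5,6,7}. D a b c d > 0 \<or> D a b c d < 0) \<and>
     (\<forall>i\<in>s. i \<in> {a,b,c} \<or> i \<notin> t \<and> D a b c i > 0) \<and> (\<forall>i\<in>t. i \<in> {a,b,c} \<or> i \<notin> s \<and> D a b c i < 0))"

lemma separating_commute:
  assumes "separating (a,b,c) s t" shows "separating (b,a,c) t s"
proof -
  have D: "D b a c d = - D a b c d" for d unfolding D_def by (rule orient_swap)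
  have set: "{b,a,c} = {a,b,c}" by auto
  show ?thesis using assms
    unfolding separating_def prod.case D set neg_less_0_iff_less neg_0_less_iff_less by blast
qed

lemma certificates_separating:
  "\<forall>(s, t, e)\<in>set certificates. separating e (verts s) (verts t)"
  unfolding certificates_def separating_def verts_def
  by (simp add: D_sort D_signs[unfolded One_nat_def] D_signs'[unfolded One_nat_def])

lemma inner_separating_self:
  "\<forall>t\<in>set inner_list. separating t (verts t) (verts t)"
  unfolding inner_list_def separating_def verts_def
  by (simp add: D_sort D_signs[unfolded One_nat_def] D_signs'[unfolded One_nat_def])

text \<open>The triangles of \<open>hull_list\<close>, some with two vertices exchanged, so that all
  remaining vertices are on the negative side.\<close>

definition oriented_hull_list :: "(nat \<times> nat \<times> nat) list" where
  "oriented_hull_list = [(1,2,7), (2,1,4), (2,4,5), (3,2,5), (3,5,6), (5,0,6)]"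

lemma oriented_hull_one_side:
  "\<forall>(a,b,c)\<in>set oriented_hull_list. a < 8 \<and> b < 8 \<and> c < 8 \<and> a \<noteq> b \<and> a \<noteq> c \<and> b \<noteq> c \<and>
     (\<forall>i\<in>{0,1,2,3,4,5,6,7}. i = a \<or> i = b \<or> i = c \<or> D a b c i < 0)"
  unfolding oriented_hull_list_def
  by (simp add: D_sort D_signs[unfolded One_nat_def] D_signs'[unfolded One_nat_def])

lemma inner_two_sides:
  "\<forall>(a,b,c)\<in>set inner_list. (\<exists>i\<in>{0,1,2,3,4,5,6,7}. D a b c i > 0) \<and> (\<exists>i\<in>{0,1,2,3,4,5,6,7}. D a b c i < 0)"
  unfolding inner_list_def
  by (simp add: D_sort D_signs[unfolded One_nat_def] D_signs'[unfolded One_nat_def])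

end

subsection \<open>Faces of a convex hull\<close>

text \<open>Points of the triangle maximize the normal functional over the hull, and a small move
  along the normal would increase it.\<close>

lemma convex_hull_face_frontier:
  fixes a b c :: "real^3"
  assumes S: "a \<in> S" "b \<in> S" "c \<in> S" and le: "\<And>x. x \<in> S \<Longrightarrow> orient a b c x \<le> 0" and d: "orient a b c d \<noteq> 0"
  shows "convex hull {a,b,c} \<subseteq> frontier (convex hull S)"
proof
  define n where "n = (b - a) \<times> (c - a)"
  have n0: "n \<noteq> 0" using d unfolding orient_def n_def by auto
  have o: "orient a b c x = n \<bullet> x - n \<bullet> a" for x unfolding n_def by (rule orient_affine)
  have "convex hull S \<subseteq> {x. n \<bullet> x \<le> n \<bullet> a}"
    by (rule hull_minimal) (use le o in \<open>auto simp: convex_halfspace_le\<close>)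
  then have le': "n \<bullet> x \<le> n \<bullet> a" if "x \<in> convex hull S" for x using that by auto
  fix x assume x: "x \<in> convex hull {a,b,c}"
  have "n \<bullet> b = n \<bullet> a" "n \<bullet> c = n \<bullet> a"
    using o[of b] o[of c] by (simp_all add: orient_refl)
  then have "convex hull {a,b,c} \<subseteq> {x. n \<bullet> x = n \<bullet> a}"
    by (intro hull_minimal) (simp_all add: convex_hyperplane)
  then have xn: "n \<bullet> x = n \<bullet> a" using x by auto
  have xS: "x \<in> convex hull S" using x S hull_mono[of "{a,b,c}" S] by blast
  have "x \<notin> interior (convex hull S)"
  proof
    assume "x \<in> interior (convex hull S)"
    then obtain e where e: "e > 0" "ball x e \<subseteq> convex hull S" by (meson mem_interior)
    define y where "y = x + (e / (2 * norm n)) *\<^sub>R n"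
    have "dist x y < e" unfolding y_def using e n0 by (simp add: dist_norm)
    then have "n \<bullet> y \<le> n \<bullet> a" using e le' by auto
    moreover have "n \<bullet> y = n \<bullet> a + e / (2 * norm n) * (n \<bullet> n)"
      unfolding y_def by (simp add: inner_add_right xn)
    moreover have "e / (2 * norm n) * (n \<bullet> n) > 0"
      using e n0 by (intro mult_pos_pos) simp_all
    ultimately show False by simp
  qed
  then show "x \<in> frontier (convex hull S)"
    using xS closure_subset unfolding frontier_def by blast
qed

text \<open>If the centroid were on the frontier, some nonzero functional would be minimal there
  over the hull, hence constant on the three vertices and a multiple of the normal. But the normal
  takes both signs relative to the plane. When the interior is empty, a functional constant on the
  hull serves the same purpose.\<close>

lemma convex_hull_not_face:
  fixes a b c :: "real^3"
  assumes S: "a \<in> S" "b \<in> S" "c \<in> S" and u: "u \<in> S" "orient a b c u > 0" and v: "v \<in> S" "orient a b c v < 0"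
  shows "\<not> convex hull {a,b,c} \<subseteq> frontier (convex hull S)"
proof
  assume sub: "convex hull {a,b,c} \<subseteq> frontier (convex hull S)"
  let ?H = "convex hull S"
  define q where "q = (1/3) *\<^sub>R a + (1/3) *\<^sub>R b + (1/3) *\<^sub>R c"
  have "q \<in> convex hull {a,b,c}" unfolding convex_hull_3 q_def
    by (intro CollectI exI[of _ "1/3"]) simp
  then have qf: "q \<in> frontier ?H" using sub by blast
  obtain n where n: "n \<noteq> 0" "\<And>y. y \<in> S \<Longrightarrow> n \<bullet> q \<le> n \<bullet> y"
  proof (cases "interior ?H = {}")
    case True
    then obtain n k where nk: "n \<noteq> 0" "?H \<subseteq> {x. n \<bullet> x = k}"
      using empty_interior_subset_hyperplane[of ?H] convex_convex_hull by blast
    have "q \<in> ?H"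
      using \<open>q \<in> convex hull {a,b,c}\<close> S hull_mono[of "{a,b,c}" S] by blast
    then have "n \<bullet> q = k" "\<And>y. y \<in> S \<Longrightarrow> n \<bullet> y = k" using nk hull_subset[of S convex] by auto
    then show ?thesis using that[of n] nk by simp
  next
    case False
    then have "q \<notin> rel_interior ?H" "q \<in> closure ?H"
      using qf rel_interior_nonempty_interior[of ?H] by (auto simp: frontier_def)
    then obtain n where "n \<noteq> 0" "\<And>y. y \<in> closure ?H \<Longrightarrow> n \<bullet> q \<le> n \<bullet> y"
      using supporting_hyperplane_relative_frontier[of ?H q] convex_convex_hull by metis
    then show ?thesis using that[of n] hull_subset[of S convex] closure_subset[of ?H] by blast
  qed
  have "n \<bullet> q = (n \<bullet> a + n \<bullet> b + n \<bullet> c) / 3" unfolding q_def by (simp add: inner_add_right)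
  then have eq: "n \<bullet> b = n \<bullet> a" "n \<bullet> c = n \<bullet> a" "n \<bullet> q = n \<bullet> a" using n(2)[OF S(1)] n(2)[OF S(2)] n(2)[OF S(3)] by auto
  define N where "N = (b - a) \<times> (c - a)"
  have "(N \<bullet> N) *\<^sub>R n = (n \<bullet> N) *\<^sub>R N"
    unfolding N_def by (rule dot_normal_eq) (simp_all add: eq inner_diff_right)
  then have *: "(N \<bullet> N) * (n \<bullet> (x - a)) = (n \<bullet> N) * orient a b c x" for x
    unfolding orient_def N_def[symmetric] by (metis inner_scaleR_left)
  have N0: "N \<bullet> N > 0" using u(2) unfolding orient_def N_def by auto
  have "(n \<bullet> N) * orient a b c u \<ge> 0" "(n \<bullet> N) * orient a b c v \<ge> 0"
    using *[of u] *[of v] n(2)[OF u(1)] n(2)[OF v(1)] N0 eq by (simp_all add: inner_diff_right flip: *)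
  then have "n \<bullet> N = 0" using u(2) v(2)
    by (metis less_le_not_le linorder_neqE_linordered_idom mult_neg_pos mult_pos_neg not_less)
  then have "(N \<bullet> N) *\<^sub>R n = 0" using \<open>(N \<bullet> N) *\<^sub>R n = (n \<bullet> N) *\<^sub>R N\<close> by simp
  then show False using n(1) N0 by simp
qed

subsection \<open>The realization of the uniform triangulation\<close>

lemma of_nat_8: "bij_betw (of_nat :: nat \<Rightarrow> 8) {..<8} UNIV"
proof -
  have im: "(of_nat :: nat \<Rightarrow> 8) ` {..<8} = UNIV"
  proof -
    have "{..<8::nat} = {0,1,2,3,4,5,6,7}" by auto
    then show ?thesis unfolding UNIV_8 by (simp only: image_insert image_empty of_nat_0 of_nat_1 of_nat_numeral)
  qed
  moreover have "inj_on (of_nat :: nat \<Rightarrow> 8) {..<8}"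
    by (rule eq_card_imp_inj_on) (simp_all add: im)
  ultimately show ?thesis by (simp add: bij_betw_def)
qed

lemma uniform_triangulation_eq:
  "uniform_triangulation = (\<lambda>e. of_nat ` verts e) ` set (hull_list @ inner_list)"
proof -
  have add: "(0::8) + 1 = 1" "(0::8) + 2 = 2" "(0::8) + 3 = 3" "(1::8) + 1 = 2" "(1::8) + 2 = 3"
    "(1::8) + 3 = 4" "(2::8) + 1 = 3" "(2::8) + 2 = 4" "(2::8) + 3 = 5" "(3::8) + 1 = 4"
    "(3::8) + 2 = 5" "(3::8) + 3 = 6" "(4::8) + 1 = 5" "(4::8) + 2 = 6" "(4::8) + 3 = 7"
    "(5::8) + 1 = 6" "(5::8) + 2 = 7" "(5::8) + 3 = 0" "(6::8) + 1 = 7" "(6::8) + 2 = 0"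
    "(6::8) + 3 = 1" "(7::8) + 1 = 0" "(7::8) + 2 = 1" "(7::8) + 3 = 2"
    by simp_all
  have "uniform_triangulation = (\<Union>a\<in>{0,1,2,3,4,5,6,7}. {{a, a + 1, a + 3}, {a, a + 2, a + 3}})"
    unfolding UNIV_8[symmetric] uniform_triangulation_def by blast
  also have "\<dots> = {{0,1,3},{0,2,3},{1,2,4},{1,3,4},{2,3,5},{2,4,5},{3,4,6},{3,5,6},
      {4,5,7},{4,6,7},{5,6,0},{5,7,0},{6,7,1},{6,0,1},{7,0,2},{7,1,2}}"
    by (simp only: UN_insert UN_empty Un_insert_left Un_empty_left add)
  also have "\<dots> = {{1,2,7},{1,2,4},{2,4,5},{2,3,5},{3,5,6},{0,5,6},
      {0,1,3},{0,2,3},{1,3,4},{3,4,6},{4,5,7},{4,6,7},{0,5,7},{1,6,7},{0,1,6},{0,2,7}}"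
    by (simp only: insert_commute)
  also have "\<dots> = (\<lambda>e. of_nat ` verts e) ` set (hull_list @ inner_list)"
    unfolding hull_list_def inner_list_def verts_def
    by (simp only: append.simps list.set image_insert image_empty prod.case of_nat_0 of_nat_1 of_nat_numeral)
  finally show ?thesis .
qed

lemma axis_in_realization: "axis i 1 \<in> realization"
proof -
  have "{i, i + 1, i + 3} \<in> uniform_triangulation" unfolding uniform_triangulation_iff by blast
  moreover have "{j. (axis i 1 :: real^8) $ j \<noteq> 0} \<subseteq> {i, i + 1, i + 3}" by (auto simp: axis_def)
  moreover have "(\<Sum>j\<in>UNIV. (axis i 1 :: real^8) $ j) = 1" by (simp add: axis_def)
  ultimately show ?thesis unfolding realization_def by (auto simp: axis_def)
qed

lemma affine_extension_axis: "affine_extension p (axis i 1) = p $ i"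
  unfolding affine_extension_def by (simp add: axis_def if_distrib[of "\<lambda>x. x *\<^sub>R _"] cong: if_cong)

lemma vertex_in_torus: "p $ i \<in> torus p"
  unfolding torus_def using axis_in_realization affine_extension_axis by (metis imageI)

lemma torus_subset_hull: "torus p \<subseteq> convex hull range (($) p)"
proof
  fix y assume "y \<in> torus p"
  then obtain x where x: "x \<in> realization" "y = (\<Sum>i\<in>UNIV. x $ i *\<^sub>R p $ i)"
    unfolding torus_def affine_extension_def by blast
  then have "\<forall>i. x $ i \<ge> 0" "(\<Sum>i\<in>UNIV. x $ i) = 1" unfolding realization_def by auto
  then show "y \<in> convex hull range (($) p)" unfolding x(2)
    by (intro convex_sum) (auto intro: hull_inc)
qed

lemma convex_hull_torus: "convex hull torus p = convex hull range (($) p)"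
proof (rule antisym)
  show "convex hull torus p \<subseteq> convex hull range (($) p)"
    by (intro hull_minimal torus_subset_hull convex_convex_hull)
  show "convex hull range (($) p) \<subseteq> convex hull torus p"
    by (rule hull_mono) (use vertex_in_torus in blast)
qed

lemma uniform_triangulation_reflect:
  "t \<in> uniform_triangulation \<Longrightarrow> (\<lambda>i. 7 - i) ` t \<in> uniform_triangulation"
proof -
  assume "t \<in> uniform_triangulation"
  then obtain a where "t = {a, a + 1, a + 3} \<or> t = {a, a + 2, a + 3}" unfolding uniform_triangulation_iff by blast
  \<comment> \<open>The reflection sends \<open>a + 3\<close> to \<open>4 - a\<close>, the base
    point of the reflected triangle, which belongs to the other of the two families.\<close>
  moreover define b where "b = 4 - a"
  ultimately have "(\<lambda>i. 7 - i) ` t = {b + 3, b + 2, b} \<or> (\<lambda>i. 7 - i) ` t = {b + 3, b + 1, b}"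
    by (auto simp: algebra_simps)
  then have "(\<lambda>i. 7 - i) ` t = {b, b + 2, b + 3} \<or> (\<lambda>i. 7 - i) ` t = {b, b + 1, b + 3}"
    by (simp add: insert_commute)
  then show ?thesis unfolding uniform_triangulation_iff by blast
qed

lemma \<rho>_affine_extension:
  "\<rho> (affine_extension p x) = (\<Sum>i\<in>UNIV. x $ i *\<^sub>R \<rho> (p $ i))"
  unfolding affine_extension_def \<rho>_def vec_eq_iff forall_3
  by (simp add: vector_3 sum_component sum_negf)

lemma \<rho>_torus:
  assumes "\<And>j. p $ (7 - j) = \<rho> (p $ j)"
  shows "\<rho> ` torus p = torus p"
proof -
  have sub: "\<rho> ` torus p \<subseteq> torus p"
  proof
    fix y assume "y \<in> \<rho> ` torus p"
    then obtain x where x: "x \<in> realization" "y = \<rho> (affine_extension p x)"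
      unfolding torus_def by blast
    define x' :: "real^8" where "x' = (\<chi> i. x $ (7 - i))"
    from x(1) obtain t where t: "t \<in> uniform_triangulation" "{i. x $ i \<noteq> 0} \<subseteq> t"
      unfolding realization_def by blast
    have sum: "(\<Sum>i\<in>UNIV. f (7 - i)) = (\<Sum>i\<in>UNIV. f i)" for f :: "8 \<Rightarrow> 'a::comm_monoid_add"
      by (rule sum.reindex_bij_witness[of _ "\<lambda>i. 7 - i" "\<lambda>i. 7 - i"]) auto
    have "{i. x' $ i \<noteq> 0} \<subseteq> (\<lambda>i. 7 - i) ` t"
    proof
      fix i assume "i \<in> {i. x' $ i \<noteq> 0}"
      then have "7 - i \<in> t" using t(2) by (auto simp: x'_def)
      then show "i \<in> (\<lambda>i. 7 - i) ` t" by (intro image_eqI[of _ _ "7 - i"]) simp_all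
    qed
    then have "x' \<in> realization"
      using x(1) uniform_triangulation_reflect[OF t(1)] sum[of "\<lambda>i. x $ i"]
      unfolding realization_def by (auto simp: x'_def)
    moreover have "affine_extension p x' = y"
    proof -
      have "y = (\<Sum>i\<in>UNIV. x $ i *\<^sub>R p $ (7 - i))" using x(2) assms by (simp add: \<rho>_affine_extension)
      also have "\<dots> = (\<Sum>i\<in>UNIV. x $ (7 - i) *\<^sub>R p $ i)"
        using sum[of "\<lambda>i. x $ i *\<^sub>R p $ (7 - i)"] by simp
      finally show ?thesis unfolding affine_extension_def x'_def by simp
    qed
    ultimately show "y \<in> torus p" unfolding torus_def by blast
  qed
  have inv: "\<rho> (\<rho> y) = y" for y unfolding \<rho>_def vec_eq_iff forall_3 by (simp add: vector_3)
  have "y \<in> \<rho> ` torus p" if "y \<in> torus p" for y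
    using sub that inv[of y] by (metis imageI subsetD)
  then show ?thesis using sub by blast
qed

subsection \<open>A pup tent from the signs of orientations\<close>

context pup_signs
begin

text \<open>Evaluate the affine relation \<open>l\<close> with the affine functional
  \<open>D a b c\<close>: every term \<open>l i * D a b c i\<close> is nonnegative and they sum to
  0, so all vanish. The support of \<open>l\<close> shrinks to \<open>{a, b, c}\<close>, which is
  affinely independent. In the application \<open>l\<close> is a difference of barycentric
  coordinates on two triangles.\<close>

lemma separating_imp_zero:
  assumes sep: "separating (a,b,c) s t"
    and l0: "(\<Sum>i<8. l i) = 0" and l1: "(\<Sum>i<8. l i *\<^sub>R P i) = 0"
    and nn: "\<And>i. i < 8 \<Longrightarrow> i \<notin> t \<Longrightarrow> l i \<ge> 0" and np: "\<And>i. i < 8 \<Longrightarrow> i \<notin> s \<Longrightarrow> l i \<le> 0"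
  shows "\<forall>i<8. l i = (0::real)"
proof -
  have abc: "a < 8" "b < 8" "c < 8" "a \<noteq> b" "a \<noteq> c" "b \<noteq> c"
    and nz0: "\<exists>d\<in>{0,1,2,3,4,5,6,7}. D a b c d > 0 \<or> D a b c d < 0"
    and s0: "\<forall>i\<in>s. i \<in> {a,b,c} \<or> i \<notin> t \<and> D a b c i > 0"
    and t0: "\<forall>i\<in>t. i \<in> {a,b,c} \<or> i \<notin> s \<and> D a b c i < 0"
    using sep unfolding separating_def prod.case by blast+
  have nz: "\<exists>d. D a b c d \<noteq> 0" using nz0 by (metis less_irrefl)
  have s: "i \<notin> t \<and> D a b c i > 0" if "i \<in> s" "i \<notin> {a,b,c}" for i using s0 that by blast
  have t: "i \<notin> s \<and> D a b c i < 0" if "i \<in> t" "i \<notin> {a,b,c}" for i using t0 that by blast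
  have "(\<Sum>i<8. l i * D a b c i) = 0"
  proof -
    let ?n = "(P b - P a) \<times> (P c - P a)"
    have "(\<Sum>i<8. l i * D a b c i) = (\<Sum>i<8. ?n \<bullet> (l i *\<^sub>R P i) - l i * (?n \<bullet> P a))"
      unfolding D_def orient_affine by (rule sum.cong) (simp_all add: algebra_simps)
    also have "\<dots> = ?n \<bullet> (\<Sum>i<8. l i *\<^sub>R P i) - (\<Sum>i<8. l i) * (?n \<bullet> P a)"
      by (simp add: sum_subtractf inner_sum_right sum_distrib_right)
    finally show ?thesis using l0 l1 by simp
  qed
  moreover have ge: "l i * D a b c i \<ge> 0" if "i < 8" for i
  proof -
    consider "i \<in> {a,b,c}" | "i \<notin> {a,b,c}" "i \<in> s" | "i \<notin> {a,b,c}" "i \<in> t" | "i \<notin> s" "i \<notin> t" by blast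
    then show ?thesis
    proof cases
      case 1 then have "D a b c i = 0" unfolding D_def by (auto simp: orient_refl)
      then show ?thesis by simp
    next
      case 2 then show ?thesis using s nn that by (simp add: less_imp_le)
    next
      case 3 then show ?thesis using t np that by (simp add: less_imp_le mult_nonpos_nonpos)
    next
      case 4 then have "l i = 0" using nn np that by (simp add: order_antisym)
      then show ?thesis by simp
    qed
  qed
  ultimately have z: "l i * D a b c i = 0" if "i < 8" for i
    using sum_nonneg_eq_0_iff[of "{..<8}" "\<lambda>i. l i * D a b c i"] that by auto
  have out: "l i = 0" if "i < 8" "i \<notin> {a,b,c}" for i
  proof (cases "i \<in> s \<or> i \<in> t")
    case True then show ?thesis using z[OF that(1)] s t that(2) by fastforce
  next
    case False then show ?thesis using nn np that by (simp add: order_antisym)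
  qed
  have sub: "{a,b,c} \<subseteq> {..<8}" using abc by auto
  have "(\<Sum>i\<in>{a,b,c}. l i) = 0"
    using sum.mono_neutral_right[of "{..<8}" "{a,b,c}" l] sub out l0 by fastforce
  then have e0: "l a + l b + l c = 0" using abc by simp
  have "(\<Sum>i\<in>{a,b,c}. l i *\<^sub>R P i) = 0"
    using sum.mono_neutral_right[of "{..<8}" "{a,b,c}" "\<lambda>i. l i *\<^sub>R P i"] sub out l1 by fastforce
  then have e1: "l a *\<^sub>R P a + l b *\<^sub>R P b + l c *\<^sub>R P c = 0" using abc by (simp add: add.assoc)
  have "(P b - P a) \<times> (P c - P a) \<noteq> 0" using nz unfolding D_def orient_def by auto
  from affine_dependence_face[OF e0 e1 this] out show ?thesis by blast
qed

lemma certificates_complete: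
  "\<forall>s\<in>set inner_list. \<forall>t\<in>set inner_list. s = t \<or>
     (s, t) \<in> set (map (\<lambda>(s, t, e). (s, t)) certificates) \<or> (t, s) \<in> set (map (\<lambda>(s, t, e). (s, t)) certificates)"
  by (simp add: inner_list_def certificates_def)

lemma oriented_hull_verts: "verts ` set hull_list = verts ` set oriented_hull_list"
  unfolding hull_list_def oriented_hull_list_def verts_def
  by (simp only: list.set image_insert image_empty prod.case insert_commute)

text \<open>A hull triangle is separated by its own plane from every triangle, and an inner triangle
  likewise from itself; the 45 certificates treat the pairs of distinct inner triangles.\<close>

lemma exists_separating:
  assumes "e \<in> set (hull_list @ inner_list)" "e' \<in> set (hull_list @ inner_list)"
  shows "\<exists>k. separating k (verts e) (verts e')"
proof -
  have hull: "\<exists>k. separating k (verts e) (verts e')"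
    if eh: "e \<in> set hull_list" and e': "e' \<in> set (hull_list @ inner_list)" for e e'
  proof -
    obtain k where k: "k \<in> set oriented_hull_list" "verts k = verts e"
    proof -
      have "verts e \<in> verts ` set oriented_hull_list"
        unfolding oriented_hull_verts[symmetric] using eh by (rule imageI)
      then show ?thesis using that by (elim imageE) simp
    qed
    obtain a b c where abc: "k = (a,b,c)" by (rule prod_cases3)
    have *: "a < 8 \<and> b < 8 \<and> c < 8 \<and> a \<noteq> b \<and> a \<noteq> c \<and> b \<noteq> c \<and>
       (\<forall>i\<in>{0,1,2,3,4,5,6,7}. i = a \<or> i = b \<or> i = c \<or> D a b c i < 0)"
      using bspec[OF oriented_hull_one_side k(1)] unfolding abc prod.case .
    have ve: "verts e = {a,b,c}" using k(2) unfolding abc verts_def by simp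
    have "verts e' \<subseteq> {0,1,2,3,4,5,6,7}"
    proof -
      have "\<forall>e\<in>set (hull_list @ inner_list). verts e \<subseteq> {0,1,2,3,4,5,6,7}"
        unfolding hull_list_def inner_list_def verts_def by simp
      then show ?thesis using e' by blast
    qed
    moreover have "\<exists>i\<in>{0,1,2,3,4,5,6,7}. i \<noteq> a \<and> i \<noteq> b \<and> i \<noteq> c"
    proof (rule ccontr)
      assume "\<not> ?thesis"
      then have "{0,1,2,3,4,5,6,7} \<subseteq> {a,b,c}" by blast
      then have "card {0,1,2,3,4,5,6,7::nat} \<le> card {a,b,c}" by (intro card_mono) auto
      moreover have "card {a,b,c} \<le> 3" by (simp add: card_insert_if)
      ultimately show False by simp
    qed
    ultimately have "separating (a,b,c) (verts e) (verts e')"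
    proof -
      assume sub: "verts e' \<subseteq> {0,1,2,3,4,5,6,7}" and ex: "\<exists>i\<in>{0,1,2,3,4,5,6,7}. i \<noteq> a \<and> i \<noteq> b \<and> i \<noteq> c"
      have neg: "D a b c i < 0" if "i \<in> {0,1,2,3,4,5,6,7}" "i \<notin> {a,b,c}" for i
        using * that by blast
      have "\<exists>d\<in>{0,1,2,3,4,5,6,7}. D a b c d > 0 \<or> D a b c d < 0" using ex neg by blast
      moreover have "\<forall>i\<in>verts e'. i \<in> {a,b,c} \<or> i \<notin> verts e \<and> D a b c i < 0"
        using neg sub ve by blast
      moreover have "\<forall>i\<in>verts e. i \<in> {a,b,c} \<or> i \<notin> verts e' \<and> D a b c i > 0" using ve by blast
      ultimately show ?thesis using * unfolding separating_def prod.case by blast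
    qed
    then show ?thesis by blast
  qed
  have comm: "\<exists>k. separating k t s" if "\<exists>k. separating k s t" for s t
    using that separating_commute by (metis prod_cases3)
  consider "e \<in> set hull_list" | "e' \<in> set hull_list" | "e \<in> set inner_list" "e' \<in> set inner_list"
    using assms by auto
  then show ?thesis
  proof cases
    case 1 then show ?thesis using hull assms(2) by blast
  next
    case 2 show ?thesis by (rule comm[OF hull[OF 2 assms(1)]])
  next
    case 3
    then consider "e = e'" | k where "(e, e', k) \<in> set certificates" | k where "(e', e, k) \<in> set certificates"
    proof -
      have "(e, e') \<in> set (map (\<lambda>(s, t, e). (s, t)) certificates) \<Longrightarrow> \<exists>k. (e, e', k) \<in> set certificates" for e e'
        by auto
      then show ?thesis using that certificates_complete 3 by blast
    qed
    then show ?thesis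
    proof cases
      case 1 then show ?thesis using inner_separating_self 3 by blast
    next
      case 2 then show ?thesis using bspec[OF certificates_separating] by blast
    next
      case 3 then show ?thesis using bspec[OF certificates_separating] comm by blast
    qed
  qed
qed

end

locale pup_signs_vec =
  fixes p :: "(real^3)^8"
  assumes p_sym: "\<And>j. p $ (7 - j) = \<rho> (p $ j)"
    and signs: "pup_signs (\<lambda>n. p $ of_nat n)"
begin

sublocale pup_signs "\<lambda>n. p $ of_nat n" by (rule signs)

lemma inj_on_affine_extension: "inj_on (affine_extension p) realization"
proof (rule inj_onI)
  fix x y assume x: "x \<in> realization" and y: "y \<in> realization"
    and eq: "affine_extension p x = affine_extension p y"
  obtain s where s: "s \<in> uniform_triangulation" "{i. x $ i \<noteq> 0} \<subseteq> s"
    using x unfolding realization_def by blast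
  obtain t where t: "t \<in> uniform_triangulation" "{i. y $ i \<noteq> 0} \<subseteq> t"
    using y unfolding realization_def by blast
  obtain e where e: "e \<in> set (hull_list @ inner_list)" "s = of_nat ` verts e"
    using s(1) unfolding uniform_triangulation_eq by blast
  obtain e' where e': "e' \<in> set (hull_list @ inner_list)" "t = of_nat ` verts e'"
    using t(1) unfolding uniform_triangulation_eq by blast
  obtain k where k: "separating k (verts e) (verts e')" using exists_separating[OF e(1) e'(1)] by blast
  obtain a b c where abc: "k = (a,b,c)" by (rule prod_cases3)
  \<comment> \<open>Two points with the same image give an affine relation among the vertices that
    is nonnegative outside the triangle of \<open>y\<close> and nonpositive outside that of
    \<open>x\<close>.\<close>
  define l where "l n = x $ of_nat n - y $ of_nat n" for n
  have reindex: "(\<Sum>n<8. f (of_nat n)) = (\<Sum>i\<in>UNIV. f i)" for f :: "8 \<Rightarrow> 'a::comm_monoid_add"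
    by (rule sum.reindex_bij_betw[OF of_nat_8])
  have small: "verts e \<subseteq> {..<8}" if "e \<in> set (hull_list @ inner_list)" for e
  proof -
    have "\<forall>e\<in>set (hull_list @ inner_list). verts e \<subseteq> {..<8}"
      unfolding hull_list_def inner_list_def verts_def by simp
    then show ?thesis using that by blast
  qed
  have out: "of_nat n \<notin> (of_nat ` verts e :: 8 set)"
    if "n < 8" "n \<notin> verts e" "e \<in> set (hull_list @ inner_list)" for n e
    using that small[OF that(3)] of_nat_8 unfolding bij_betw_def inj_on_def by blast
  have "(\<Sum>n<8. l n) = 0"
    using x y reindex[of "\<lambda>i. x $ i - y $ i"] unfolding l_def realization_def by (simp add: sum_subtractf)
  moreover have "(\<Sum>n<8. l n *\<^sub>R p $ of_nat n) = 0"
    using eq reindex[of "\<lambda>i. (x $ i - y $ i) *\<^sub>R p $ i"]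
    unfolding l_def affine_extension_def by (simp add: sum_subtractf scaleR_left_diff_distrib)
  moreover have "l n \<ge> 0" if "n < 8" "n \<notin> verts e'" for n
  proof -
    have "y $ of_nat n = 0" using out[OF that e'(1)] t(2) e'(2) by blast
    moreover have "x $ of_nat n \<ge> 0" using x unfolding realization_def by blast
    ultimately show ?thesis unfolding l_def by simp
  qed
  moreover have "l n \<le> 0" if "n < 8" "n \<notin> verts e" for n
  proof -
    have "x $ of_nat n = 0" using out[OF that e(1)] s(2) e(2) by blast
    moreover have "y $ of_nat n \<ge> 0" using y unfolding realization_def by blast
    ultimately show ?thesis unfolding l_def by simp
  qed
  ultimately have l: "\<forall>n<8. l n = 0"
    using k unfolding abc by (intro separating_imp_zero) simp_all
  show "x = y"
  proof (rule vec_eq_iff[THEN iffD2], rule allI)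
    fix i :: 8
    have "i \<in> of_nat ` {..<8::nat}" using of_nat_8 unfolding bij_betw_def by simp
    then obtain n where n: "n < 8" "i = of_nat n" by auto
    then have "l n = 0" using l by blast
    then show "x $ i = y $ i" unfolding l_def n(2) by simp
  qed
qed

lemma hull_triangles_eq: "hull_triangles p = {{1,2,7}, {1,2,4}, {2,4,5}, {2,3,5}, {3,5,6}, {0,5,6}}"
proof -
  let ?P = "\<lambda>n. p $ of_nat n"
  let ?F = "frontier (convex hull range (($) p))"
  have img: "(\<lambda>j. p $ j) ` of_nat ` verts (a,b,c) = {?P a, ?P b, ?P c}" for a b c
    unfolding verts_def by simp
  have all: "Q (p $ i)" if "\<And>n. n \<in> {0,1,2,3,4,5,6,7} \<Longrightarrow> Q (?P n)" for Q i
  proof -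
    have "i \<in> of_nat ` {..<8::nat}" using of_nat_8 unfolding bij_betw_def by simp
    then obtain n where "n < 8" "i = of_nat n" by auto
    moreover have "{..<8} = {0,1,2,3,4,5,6,7::nat}" by auto
    ultimately show ?thesis using that[of n] by blast
  qed
  have hull: "convex hull ((\<lambda>j. p $ j) ` of_nat ` verts e) \<subseteq> ?F" if e: "e \<in> set hull_list" for e
  proof -
    have "verts e \<in> verts ` set oriented_hull_list"
      unfolding oriented_hull_verts[symmetric] using e by (rule imageI)
    then obtain k where k: "k \<in> set oriented_hull_list" "verts k = verts e" by (metis imageE)
    obtain a b c where abc: "k = (a,b,c)" by (rule prod_cases3)
    have *: "a < 8 \<and> b < 8 \<and> c < 8 \<and> a \<noteq> b \<and> a \<noteq> c \<and> b \<noteq> c \<and>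
       (\<forall>i\<in>{0,1,2,3,4,5,6,7}. i = a \<or> i = b \<or> i = c \<or> D a b c i < 0)"
      using bspec[OF oriented_hull_one_side k(1)] unfolding abc prod.case .
    have le: "orient (?P a) (?P b) (?P c) (p $ i) \<le> 0" for i
    proof (rule all[of "\<lambda>x. orient (?P a) (?P b) (?P c) x \<le> 0"])
      fix n :: nat assume "n \<in> {0,1,2,3,4,5,6,7}"
      then consider "n = a" | "n = b" | "n = c" | "D a b c n < 0" using * by blast
      then show "orient (?P a) (?P b) (?P c) (?P n) \<le> 0"
        by cases (simp_all add: orient_refl D_def)
    qed
    have "\<exists>d\<in>{0,1,2,3,4,5,6,7}. d \<noteq> a \<and> d \<noteq> b \<and> d \<noteq> c"
    proof (rule ccontr)
      assume "\<not> ?thesis"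
      then have "{0,1,2,3,4,5,6,7} \<subseteq> {a,b,c}" by blast
      then have "card {0,1,2,3,4,5,6,7::nat} \<le> card {a,b,c}" by (intro card_mono) auto
      moreover have "card {a,b,c} \<le> 3" by (simp add: card_insert_if)
      ultimately show False by simp
    qed
    then obtain d where "D a b c d < 0" using * by blast
    then have "convex hull {?P a, ?P b, ?P c} \<subseteq> ?F"
      by (intro convex_hull_face_frontier[of _ _ _ _ "?P d"]) (use le in \<open>auto simp: D_def\<close>)
    moreover have "(\<lambda>j. p $ j) ` of_nat ` verts e = {?P a, ?P b, ?P c}"
      using img[of a b c] k(2) unfolding abc by simp
    ultimately show ?thesis by simp
  qed
  have inner: "\<not> convex hull ((\<lambda>j. p $ j) ` of_nat ` verts e) \<subseteq> ?F" if e: "e \<in> set inner_list" for e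
  proof -
    obtain a b c where abc: "e = (a,b,c)" by (rule prod_cases3)
    have "(\<exists>i\<in>{0,1,2,3,4,5,6,7}. D a b c i > 0) \<and> (\<exists>i\<in>{0,1,2,3,4,5,6,7}. D a b c i < 0)"
      using bspec[OF inner_two_sides e] unfolding abc prod.case .
    then obtain u v where "D a b c u > 0" "D a b c v < 0" by blast
    then show ?thesis unfolding abc img D_def
      by (intro convex_hull_not_face[of _ _ _ _ "?P u" "?P v"]) auto
  qed
  have "hull_triangles p = (\<lambda>e. of_nat ` verts e) ` set hull_list"
    unfolding hull_triangles_def convex_hull_torus uniform_triangulation_eq set_append
    using hull inner by blast
  also have "\<dots> = {{1,2,7}, {1,2,4}, {2,4,5}, {2,3,5}, {3,5,6}, {0,5,6}}"
    unfolding hull_list_def verts_def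
    by (simp only: list.set image_insert image_empty prod.case of_nat_0 of_nat_1 of_nat_numeral)
  finally show ?thesis .
qed

lemma pup_tentI:
  assumes "\<And>v. cone_angle p v = 2 * pi"
  shows "pup_tent p"
  unfolding pup_tent_def paper_torus_def
  using assms inj_on_affine_extension \<rho>_torus p_sym hull_triangles_eq by blast

end

unbundle no cross3_syntax

subsection \<open>Equations for flat tents\<close>

definition tent :: "real^3 \<Rightarrow> real^3 \<Rightarrow> real^3 \<Rightarrow> real^3 \<Rightarrow> (real^3)^8" where
  "tent q\<^sub>0 q\<^sub>1 q\<^sub>2 q\<^sub>3 = (\<chi> i. if i = 0 then q\<^sub>0 else if i = 1 then q\<^sub>1 else if i = 2 then q\<^sub>2 else if i = 3 then q\<^sub>3
     else if i = 4 then \<rho> q\<^sub>3 else if i = 5 then \<rho> q\<^sub>2 else if i = 6 then \<rho> q\<^sub>1 else \<rho> q\<^sub>0)"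

lemma tent_nth:
  "tent q\<^sub>0 q\<^sub>1 q\<^sub>2 q\<^sub>3 $ 0 = q\<^sub>0" "tent q\<^sub>0 q\<^sub>1 q\<^sub>2 q\<^sub>3 $ 1 = q\<^sub>1" "tent q\<^sub>0 q\<^sub>1 q\<^sub>2 q\<^sub>3 $ 2 = q\<^sub>2"
  "tent q\<^sub>0 q\<^sub>1 q\<^sub>2 q\<^sub>3 $ 3 = q\<^sub>3" "tent q\<^sub>0 q\<^sub>1 q\<^sub>2 q\<^sub>3 $ 4 = \<rho> q\<^sub>3" "tent q\<^sub>0 q\<^sub>1 q\<^sub>2 q\<^sub>3 $ 5 = \<rho> q\<^sub>2"
  "tent q\<^sub>0 q\<^sub>1 q\<^sub>2 q\<^sub>3 $ 6 = \<rho> q\<^sub>1" "tent q\<^sub>0 q\<^sub>1 q\<^sub>2 q\<^sub>3 $ 7 = \<rho> q\<^sub>0"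
  by (simp_all add: tent_def)

text \<open>The determinants of \<open>positive_quadruples\<close>, then of
  \<open>negative_quadruples\<close>, for vertices \<open>(c, b, h)\<close>,
  \<open>(- a, m - y, d)\<close>, \<open>(0, - y, - d)\<close>, \<open>(x, n - y, 0)\<close> and
  their images under \<open>\<rho>\<close>. The one of \<open>(0, 1, 6, 7)\<close> is kept factored:
  it asks for the sign of \<open>c*(y - m) - b*a\<close>, a delicate quantity in both
  families.\<close>

locale tent_signs =
  fixes c b h a m y d x n :: real
  assumes "2*c*h*m + 2*c*m*d - 4*c*y*d + 2*b*h*a + 2*b*a*d > 0"
    and "2*c*m*d - 2*c*y*d + 2*b*a*d + 2*h*a*y - 2*h*a*n - 2*h*m*x + 2*h*y*x - 2*a*y*d + 2*a*d*n + 2*m*d*x - 2*y*d*x > 0"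
    and "4*c*m*d - 4*c*y*d + 4*b*a*d + 2*h*a*y - 2*a*y*d > 0"
    and "- 2*c*h*n + 2*c*y*d - 2*c*d*n + 2*b*h*x + 2*b*d*x > 0"
    and "2*c*y*d + 2*h*y*x + 2*y*d*x > 0"
    and "- 4*c*y*d + 2*h*a*y + 2*a*y*d > 0"
    and "c*m*d - 4*c*y*d + 2*c*d*n + b*a*d - 2*b*d*x + 2*h*a*y - h*a*n - h*m*x + a*y*d - a*d*n - m*d*x + 2*y*d*x > 0"
    and "c*m*d - 2*c*d*n + b*a*d + 2*b*d*x + h*a*n + h*m*x - a*y*d + a*d*n + m*d*x - 2*y*d*x > 0"
    and "- 2*a*y*d + 4*y*d*x > 0"
    and "6*a*y*d - 4*a*d*n - 4*m*d*x + 4*y*d*x > 0"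
    and "4*a*y*d - 4*a*d*n - 4*m*d*x + 4*y*d*x > 0"
    and "c*m*d - 2*c*d*n + b*a*d + 2*b*d*x - h*a*n - h*m*x + a*y*d - a*d*n - m*d*x + 2*y*d*x < 0"
    and "c*m*d - 4*c*y*d + 2*c*d*n + b*a*d - 2*b*d*x - 2*h*a*y + h*a*n + h*m*x - a*y*d + a*d*n + m*d*x - 2*y*d*x < 0"
    and "- 2*c*y*d + 2*c*d*n - 2*b*d*x - 2*h*a*y + 2*h*a*n + 2*h*m*x - 2*h*y*x < 0"
    and "2*c*m*d - 2*c*y*d + 2*b*a*d - 2*h*a*y + 2*h*a*n + 2*h*m*x - 2*h*y*x + 2*a*y*d - 2*a*d*n - 2*m*d*x + 2*y*d*x < 0"
    and "2*c*h*m - 4*c*h*y + 2*c*m*d + 2*b*h*a + 2*b*a*d < 0"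
    and "- 4*(h - d)*(c*(y - m) - b*a) < 0"
    and "2*c*y*d - 2*c*d*n + 2*b*d*x - 2*h*y*x < 0"
    and "2*c*y*d - 2*h*y*x - 2*y*d*x < 0"
    and "- c*m*d + 2*c*y*d - 2*c*d*n - b*a*d + 2*b*d*x + h*a*n + h*m*x - 2*h*y*x - a*y*d + a*d*n + m*d*x < 0"
    and "- 4*c*h*y + 2*c*h*n - 2*c*y*d + 2*c*d*n - 2*b*h*x - 2*b*d*x < 0"
    and "- 4*c*h*y - 4*c*y*d < 0"
    and "- 2*a*y*d + 2*a*d*n + 2*m*d*x - 4*y*d*x < 0"
    and "- 2*a*y*d - 4*y*d*x < 0"
    and "- 4*y*d*x < 0"
begin

lemma pup_signs_vec_tent:
  "pup_signs_vec (tent (vector [c, b, h]) (vector [- a, m - y, d]) (vector [0, - y, - d]) (vector [x, n - y, 0]))"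
  (is "pup_signs_vec ?p")
proof
  have rho: "\<rho> (vector [r,s,u]) = vector [-r,-s,u]" for r s u
    by (simp add: \<rho>_def vector_3)
  have inv: "\<rho> (\<rho> q) = q" for q
    by (simp add: \<rho>_def vec_eq_iff forall_3 vector_3)
  have "\<forall>j. ?p $ (7 - j) = \<rho> (?p $ j)"
    unfolding all_8 by (simp add: tent_nth inv)
  then show sym: "?p $ (7 - j) = \<rho> (?p $ j)" for j by blast
  note nth = tent_nth[of "vector [c, b, h]" "vector [- a, m - y, d]" "vector [0, - y, - d]" "vector [x, n - y, 0]", unfolded rho minus_minus minus_zero]
  have o0127: "orient (?p $ 0) (?p $ 1) (?p $ 2) (?p $ 7) = 2*c*h*m + 2*c*m*d - 4*c*y*d + 2*b*h*a + 2*b*a*d"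
    by (simp add: nth orient_coords vector_3 algebra_simps)
  have o0146: "orient (?p $ 0) (?p $ 1) (?p $ 4) (?p $ 6) = 2*c*m*d - 2*c*y*d + 2*b*a*d + 2*h*a*y - 2*h*a*n - 2*h*m*x + 2*h*y*x - 2*a*y*d + 2*a*d*n + 2*m*d*x - 2*y*d*x"
    by (simp add: nth orient_coords vector_3 algebra_simps)
  have o0156: "orient (?p $ 0) (?p $ 1) (?p $ 5) (?p $ 6) = 4*c*m*d - 4*c*y*d + 4*b*a*d + 2*h*a*y - 2*a*y*d"
    by (simp add: nth orient_coords vector_3 algebra_simps)
  have o0237: "orient (?p $ 0) (?p $ 2) (?p $ 3) (?p $ 7) = - 2*c*h*n + 2*c*y*d - 2*c*d*n + 2*b*h*x + 2*b*d*x"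
    by (simp add: nth orient_coords vector_3 algebra_simps)
  have o0245: "orient (?p $ 0) (?p $ 2) (?p $ 4) (?p $ 5) = 2*c*y*d + 2*h*y*x + 2*y*d*x"
    by (simp add: nth orient_coords vector_3 algebra_simps)
  have o0256: "orient (?p $ 0) (?p $ 2) (?p $ 5) (?p $ 6) = - 4*c*y*d + 2*h*a*y + 2*a*y*d"
    by (simp add: nth orient_coords vector_3 algebra_simps)
  have o0356: "orient (?p $ 0) (?p $ 3) (?p $ 5) (?p $ 6) = c*m*d - 4*c*y*d + 2*c*d*n + b*a*d - 2*b*d*x + 2*h*a*y - h*a*n - h*m*x + a*y*d - a*d*n - m*d*x + 2*y*d*x"
    by (simp add: nth orient_coords vector_3 algebra_simps)
  have o0456: "orient (?p $ 0) (?p $ 4) (?p $ 5) (?p $ 6) = c*m*d - 2*c*d*n + b*a*d + 2*b*d*x + h*a*n + h*m*x - a*y*d + a*d*n + m*d*x - 2*y*d*x"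
    by (simp add: nth orient_coords vector_3 algebra_simps)
  have o1245: "orient (?p $ 1) (?p $ 2) (?p $ 4) (?p $ 5) = - 2*a*y*d + 4*y*d*x"
    by (simp add: nth orient_coords vector_3 algebra_simps)
  have o1246: "orient (?p $ 1) (?p $ 2) (?p $ 4) (?p $ 6) = 6*a*y*d - 4*a*d*n - 4*m*d*x + 4*y*d*x"
    by (simp add: nth orient_coords vector_3 algebra_simps)
  have o1346: "orient (?p $ 1) (?p $ 3) (?p $ 4) (?p $ 6) = 4*a*y*d - 4*a*d*n - 4*m*d*x + 4*y*d*x"
    by (simp add: nth orient_coords vector_3 algebra_simps)
  have o0123: "orient (?p $ 0) (?p $ 1) (?p $ 2) (?p $ 3) = c*m*d - 2*c*d*n + b*a*d + 2*b*d*x - h*a*n - h*m*x + a*y*d - a*d*n - m*d*x + 2*y*d*x"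
    by (simp add: nth orient_coords vector_3 algebra_simps)
  have o0124: "orient (?p $ 0) (?p $ 1) (?p $ 2) (?p $ 4) = c*m*d - 4*c*y*d + 2*c*d*n + b*a*d - 2*b*d*x - 2*h*a*y + h*a*n + h*m*x - a*y*d + a*d*n + m*d*x - 2*y*d*x"
    by (simp add: nth orient_coords vector_3 algebra_simps)
  have o0134: "orient (?p $ 0) (?p $ 1) (?p $ 3) (?p $ 4) = - 2*c*y*d + 2*c*d*n - 2*b*d*x - 2*h*a*y + 2*h*a*n + 2*h*m*x - 2*h*y*x"
    by (simp add: nth orient_coords vector_3 algebra_simps)
  have o0136: "orient (?p $ 0) (?p $ 1) (?p $ 3) (?p $ 6) = 2*c*m*d - 2*c*y*d + 2*b*a*d - 2*h*a*y + 2*h*a*n + 2*h*m*x - 2*h*y*x + 2*a*y*d - 2*a*d*n - 2*m*d*x + 2*y*d*x"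
    by (simp add: nth orient_coords vector_3 algebra_simps)
  have o0157: "orient (?p $ 0) (?p $ 1) (?p $ 5) (?p $ 7) = 2*c*h*m - 4*c*h*y + 2*c*m*d + 2*b*h*a + 2*b*a*d"
    by (simp add: nth orient_coords vector_3 algebra_simps)
  have o0167: "orient (?p $ 0) (?p $ 1) (?p $ 6) (?p $ 7) = - 4*(h - d)*(c*(y - m) - b*a)"
    by (simp add: nth orient_coords vector_3 algebra_simps)
  have o0234: "orient (?p $ 0) (?p $ 2) (?p $ 3) (?p $ 4) = 2*c*y*d - 2*c*d*n + 2*b*d*x - 2*h*y*x"
    by (simp add: nth orient_coords vector_3 algebra_simps)
  have o0235: "orient (?p $ 0) (?p $ 2) (?p $ 3) (?p $ 5) = 2*c*y*d - 2*h*y*x - 2*y*d*x"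
    by (simp add: nth orient_coords vector_3 algebra_simps)
  have o0236: "orient (?p $ 0) (?p $ 2) (?p $ 3) (?p $ 6) = - c*m*d + 2*c*y*d - 2*c*d*n - b*a*d + 2*b*d*x + h*a*n + h*m*x - 2*h*y*x - a*y*d + a*d*n + m*d*x"
    by (simp add: nth orient_coords vector_3 algebra_simps)
  have o0247: "orient (?p $ 0) (?p $ 2) (?p $ 4) (?p $ 7) = - 4*c*h*y + 2*c*h*n - 2*c*y*d + 2*c*d*n - 2*b*h*x - 2*b*d*x"
    by (simp add: nth orient_coords vector_3 algebra_simps)
  have o0257: "orient (?p $ 0) (?p $ 2) (?p $ 5) (?p $ 7) = - 4*c*h*y - 4*c*y*d"
    by (simp add: nth orient_coords vector_3 algebra_simps)
  have o1234: "orient (?p $ 1) (?p $ 2) (?p $ 3) (?p $ 4) = - 2*a*y*d + 2*a*d*n + 2*m*d*x - 4*y*d*x"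
    by (simp add: nth orient_coords vector_3 algebra_simps)
  have o1235: "orient (?p $ 1) (?p $ 2) (?p $ 3) (?p $ 5) = - 2*a*y*d - 4*y*d*x"
    by (simp add: nth orient_coords vector_3 algebra_simps)
  have o2345: "orient (?p $ 2) (?p $ 3) (?p $ 4) (?p $ 5) = - 4*y*d*x"
    by (simp add: nth orient_coords vector_3 algebra_simps)
  note orients = o0127 o0146 o0156 o0237 o0245 o0256 o0356 o0456 o1245 o1246 o1346 o0123 o0124 o0134 o0136 o0157 o0167 o0234 o0235 o0236 o0247 o0257 o1234 o1235 o2345
  show "?p $ of_nat (7 - i) = \<rho> (?p $ of_nat i)" if "i \<le> 7" for i
    using sym[of "of_nat i"] that by (simp add: of_nat_diff)
  show "orient (?p $ of_nat i) (?p $ of_nat j) (?p $ of_nat k) (?p $ of_nat l) > 0"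
    if "(i, j, k, l) \<in> set positive_quadruples" for i j k l
  proof -
    have "\<forall>(i, j, k, l) \<in> set positive_quadruples.
        orient (?p $ of_nat i) (?p $ of_nat j) (?p $ of_nat k) (?p $ of_nat l) > 0"
      using tent_signs_axioms unfolding tent_signs_def
      by (simp only: positive_quadruples_def list.set ball_simps split orients of_nat_0 of_nat_1 of_nat_numeral simp_thms)
    then show ?thesis using that by blast
  qed
  show "orient (?p $ of_nat i) (?p $ of_nat j) (?p $ of_nat k) (?p $ of_nat l) < 0"
    if "(i, j, k, l) \<in> set negative_quadruples" for i j k l
  proof -
    have "\<forall>(i, j, k, l) \<in> set negative_quadruples.
        orient (?p $ of_nat i) (?p $ of_nat j) (?p $ of_nat k) (?p $ of_nat l) < 0"
      using tent_signs_axioms unfolding tent_signs_def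
      by (simp only: negative_quadruples_def list.set ball_simps split orients of_nat_0 of_nat_1 of_nat_numeral simp_thms)
    then show ?thesis using that by blast
  qed
qed

end

text \<open>In the development, with half periods \<open>(f\<^sub>1, f\<^sub>2)\<close> and \<open>(0, \<eta>)\<close>, the vertices \<open>p\<^sub>0\<close>, \<open>p\<^sub>1\<close>,
  \<open>p\<^sub>2\<close>, \<open>p\<^sub>3\<close> are at \<open>(z, B)\<close>, \<open>(x\<^sub>1 + t + f\<^sub>1, \<eta> + f\<^sub>2 - y + K)\<close>, \<open>(0, - y)\<close>, \<open>(x\<^sub>3 + g - f\<^sub>1, n - y - f\<^sub>2)\<close>
  up to half periods, and rotation by \<open>\<pi>\<close> exchanges \<open>p\<^sub>j\<close> and \<open>p\<^sub>7\<^sub>-\<^sub>j\<close>. Modulo each other, the equations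
  below are the equalities of the edge lengths.\<close>

locale pup_equations =
  fixes \<eta> L d y b B z c g n x\<^sub>1 x\<^sub>3 t \<tau> K f\<^sub>1 f\<^sub>2 :: real
  assumes L: "L^2 = \<eta>^2 - 2*\<eta>*y"
    and zB: "z^2 + B^2 = c^2 + b^2"
    and B: "(\<eta> - y)*B = - (y*b)"
    and g: "d^2 = 2*g*x\<^sub>3 + g^2"
    and n: "(\<eta> + b - B)*n = z*g - L*d + (z - c)*x\<^sub>3"
    and K: "(\<eta> + B - b)*K = - 2*L*d - (b - y)*\<tau> - z*t - (z - c)*x\<^sub>1"
    and f2: "d^2 + L^2 + 2*\<eta>*f\<^sub>2 + 2*\<eta>*K = 0"
    and f1: "(L - 2*d)^2 = f\<^sub>1^2 + f\<^sub>2^2 - 2*(z*f\<^sub>1 + B*f\<^sub>2)"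
    and x3: "(x\<^sub>3 + g)*f\<^sub>1 + (n - y)*f\<^sub>2 = (f\<^sub>1^2 + f\<^sub>2^2 + d^2)/2"
    and t: "4*d^2 - 2*K*\<tau> + \<tau>^2 = 2*x\<^sub>1*t + t^2"
    and \<tau>: "g*x\<^sub>1 + t*x\<^sub>3 + g*t + 2*d^2 = (2*y - n)*\<tau>"
    and x1: "(x\<^sub>1 + x\<^sub>3 + g + t)*f\<^sub>1 = y*\<tau> - d^2 + f\<^sub>2*(2*y - n - K)"
begin
text \<open>The 24 edges form 14 orbits under the exchange of \<open>j\<close> and
  \<open>7 - j\<close>. The orbit of \<open>{0, 7}\<close> is the equation \<open>zB\<close>, that
  of \<open>{2, 5}\<close> has length \<open>2*y\<close> by construction, and the other twelve
  follow here. For \<open>{3, 4}\<close> and \<open>{1, 6}\<close> (\<open>len11\<close>) half of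
  the edge is compared.\<close>

lemma len01: "(x\<^sub>1+t+2*f\<^sub>1-z)^2 + (\<eta>+2*f\<^sub>2-y+K-B)^2 = (c-x\<^sub>1)^2 + (b-(K-y-\<tau>))^2 + (L-2*d)^2"
  using L zB B g n K f2 f1 x3 t \<tau> x1 by (simp add: power2_eq_square algebra_simps)
lemma len12: "(x\<^sub>1+t)^2 + K^2 = x\<^sub>1^2 + (K-\<tau>)^2 + (2*d)^2"
  using L zB B g n K f2 f1 x3 t \<tau> x1 by (simp add: power2_eq_square algebra_simps)
lemma len23: "(x\<^sub>3+g)^2 + n^2 = x\<^sub>3^2 + n^2 + d^2"
  using L zB B g n K f2 f1 x3 t \<tau> x1 by (simp add: power2_eq_square algebra_simps)
lemma len34: "(x\<^sub>3+g-f\<^sub>1)^2 + (n-y-f\<^sub>2)^2 = x\<^sub>3^2 + (n-y)^2"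
  using L zB B g n K f2 f1 x3 t \<tau> x1 by (simp add: power2_eq_square algebra_simps)
lemma len02: "z^2 + (-y-B+\<eta>)^2 = c^2 + (b+y)^2 + L^2"
  using L zB B g n K f2 f1 x3 t \<tau> x1 by (simp add: power2_eq_square algebra_simps)
lemma len05: "z^2 + (\<eta>-y+B)^2 = c^2 + (b-y)^2 + L^2"
  using L zB B g n K f2 f1 x3 t \<tau> x1 by (simp add: power2_eq_square algebra_simps)
lemma len13: "(x\<^sub>3+g-2*f\<^sub>1-x\<^sub>1-t)^2 + (n-2*f\<^sub>2-K)^2 = (x\<^sub>1-x\<^sub>3)^2 + (K-\<tau>-n)^2 + d^2"
  using L zB B g n K f2 f1 x3 t \<tau> x1 by (simp add: power2_eq_square algebra_simps)
lemma len24: "(x\<^sub>3+g)^2 + (2*y-n)^2 = x\<^sub>3^2 + (2*y-n)^2 + d^2"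
  using L zB B g n K f2 f1 x3 t \<tau> x1 by (simp add: power2_eq_square algebra_simps)
lemma len06: "(z+x\<^sub>1+t)^2 + (B+\<eta>-y+K)^2 = (c+x\<^sub>1)^2 + (b+K-y-\<tau>)^2 + (L-2*d)^2"
  using L zB B g n K f2 f1 x3 t \<tau> x1 by (simp add: power2_eq_square algebra_simps)
lemma len03: "(x\<^sub>3+g-z)^2 + (n-y-B+\<eta>)^2 = (c-x\<^sub>3)^2 + (b+y-n)^2 + (L-d)^2"
  using L zB B g n K f2 f1 x3 t \<tau> x1 by (simp add: power2_eq_square algebra_simps)
lemma len14: "(x\<^sub>1+t+x\<^sub>3+g)^2 + (n-2*y+K)^2 = (x\<^sub>1+x\<^sub>3)^2 + (K-\<tau>-2*y+n)^2 + d^2"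
  using L zB B g n K f2 f1 x3 t \<tau> x1 by (simp add: power2_eq_square algebra_simps)
lemma len11: "(x\<^sub>1+t+f\<^sub>1)^2 + (\<eta>+f\<^sub>2-y+K)^2 = x\<^sub>1^2 + (K-y-\<tau>)^2"
  using L zB B g n K f2 f1 x3 t \<tau> x1 by (simp add: power2_eq_square algebra_simps)

text \<open>The inequalities say, up to positive factors, that the developed triangles
  \<open>{a, a + 1, a + 3}\<close> are positively oriented, for \<open>a\<close> from 0 to 7.
  Rotation by \<open>pi\<close> carries them to the triangles
  \<open>{a, a + 2, a + 3}\<close>.\<close>

lemma cone_angle_tent:
  assumes "(x\<^sub>1+t+2*f\<^sub>1-z)*(n-y-B+\<eta>) - (\<eta>+2*f\<^sub>2-y+K-B)*(x\<^sub>3+g-z) > 0"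
    and "- (x\<^sub>1+t)*(2*y-n-K) - K*(x\<^sub>1+t+x\<^sub>3+g) > 0"
    and "y*(x\<^sub>3+g) > 0"
    and "(x\<^sub>3+g-f\<^sub>1)*(2*y-n-K) + (n-y-f\<^sub>2)*(x\<^sub>1+t+x\<^sub>3+g) < 0"
    and "(x\<^sub>3+g)*(n-y-B+\<eta>) - n*(x\<^sub>3+g-z) > 0"
    and "- (x\<^sub>1+t)*(\<eta>-y+B) + K*z > 0"
    and "(x\<^sub>1+t+2*f\<^sub>1-z)*(\<eta>+f\<^sub>2-y+K) - (\<eta>+2*f\<^sub>2-y+K-B)*(x\<^sub>1+t+f\<^sub>1) > 0"
    and "z*(\<eta>-y) > 0"
  shows "cone_angle (tent (vector [c, b, L - d]) (vector [x\<^sub>1, K - y - \<tau>, d]) (vector [0, - y, - d])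
    (vector [x\<^sub>3, n - y, 0])) v = 2 * pi" (is "cone_angle ?p v = _")
proof -
  \<comment> \<open>The two digits are the initial and final vertex of the developed edge. The edges
    34, 70, 25, 61 are invariant under the rotation, so their vectors are twice the position of an
    endpoint relative to the centre.\<close>
  define e01 e12 e23 e34 e70 where "e01 = Complex (x\<^sub>1+t+2*f\<^sub>1-z) (\<eta>+2*f\<^sub>2-y+K-B)"
    and "e12 = Complex (-(x\<^sub>1+t)) (-K)" and "e23 = Complex (x\<^sub>3+g) n"
    and "e34 = Complex (-2*(x\<^sub>3+g-f\<^sub>1)) (-2*(n-y-f\<^sub>2))" and "e70 = Complex (2*z) (2*B)"
  define e02 e13 e24 e60 where "e02 = Complex (-z) (-y-B+\<eta>)"
    and "e13 = Complex (x\<^sub>3+g-2*f\<^sub>1-x\<^sub>1-t) (n-2*f\<^sub>2-K)" and "e24 = Complex (-(x\<^sub>3+g)) (2*y-n)"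
    and "e60 = Complex (z+x\<^sub>1+t) (B+\<eta>-y+K)"
  define e03 e14 e25 e50 e61 where "e03 = Complex (x\<^sub>3+g-z) (n-y-B+\<eta>)"
    and "e14 = Complex (-(x\<^sub>1+t+x\<^sub>3+g)) (2*y-n-K)" and "e25 = Complex 0 (2*y)"
    and "e50 = Complex z (\<eta>-y+B)" and "e61 = Complex (2*(x\<^sub>1+t+f\<^sub>1)) (2*(\<eta>+f\<^sub>2-y+K))"
  note e = e01_def e12_def e23_def e34_def e70_def e02_def e13_def e24_def e60_def
    e03_def e14_def e25_def e50_def e61_def
  \<comment> \<open>Rotating an edge by \<open>pi\<close> and reversing its direction cancel, so for
    instance the edge from 4 to 5 has the vector of the edge from 2 to 3.\<close>
  define A :: "8 \<Rightarrow> complex" where "A a = (if a = 0 then e01 else if a = 1 then e12 else if a = 2 then e23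
    else if a = 3 then e34 else if a = 4 then e23 else if a = 5 then e12 else if a = 6 then e01 else e70)" for a
  define B' :: "8 \<Rightarrow> complex" where "B' a = (if a = 0 then e02 else if a = 1 then e13 else if a = 2 then e24
    else if a = 3 then e24 else if a = 4 then e13 else if a = 5 then e02 else if a = 6 then e60 else e60)" for a
  define C :: "8 \<Rightarrow> complex" where "C a = (if a = 0 then e03 else if a = 1 then e14 else if a = 2 then e25
    else if a = 3 then e14 else if a = 4 then e03 else if a = 5 then e50 else if a = 6 then e61 else e50)" for a
  have A_simps: "A 0 = e01" "A 1 = e12" "A 2 = e23" "A 3 = e34" "A 4 = e23" "A 5 = e12" "A 6 = e01" "A 7 = e70"
    by (simp_all add: A_def)
  have B_simps: "B' 0 = e02" "B' 1 = e13" "B' 2 = e24" "B' 3 = e24" "B' 4 = e13" "B' 5 = e02" "B' 6 = e60" "B' 7 = e60"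
    by (simp_all add: B'_def)
  have C_simps: "C 0 = e03" "C 1 = e14" "C 2 = e25" "C 3 = e14" "C 4 = e03" "C 5 = e50" "C 6 = e61" "C 7 = e50"
    by (simp_all add: C_def)
  note simps = A_simps B_simps C_simps
  have d3: "dist (vector [r,s,u] :: real^3) (vector [r',s',u']) = sqrt ((r-r')^2 + (s-s')^2 + (u-u')^2)" for r s u r' s' u'
    by (simp add: dist_vec_def L2_set_def sum_3 vector_3 dist_real_def)
  have rho: "\<rho> (vector [r,s,u]) = vector [-r,-s,u]" for r s u
    by (simp add: \<rho>_def vector_3)
  note len = len01 len12 len23 len34 len02 len05 len13 len24 len06 len03 len14 len11 zB
  have "\<forall>a. C a = A a + B' (a + 1)"
    unfolding all_8 by (simp add: simps numeral_mod_8 e complex_eq_iff)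
  moreover have "\<forall>a. C a = B' a + A (a + 2)"
    unfolding all_8 by (simp add: simps numeral_mod_8 e complex_eq_iff)
  moreover have "\<forall>a. norm (A a) = dist (?p $ a) (?p $ (a + 1))"
    unfolding all_8 apply (simp add: simps numeral_mod_8 tent_nth rho d3 e complex_norm)
    apply (intro conjI)
    using len by (simp_all add: power2_eq_square algebra_simps)
  moreover have "\<forall>a. norm (B' a) = dist (?p $ a) (?p $ (a + 2))"
    unfolding all_8 apply (simp add: simps numeral_mod_8 tent_nth rho d3 e complex_norm)
    apply (intro conjI)
    using len by (simp_all add: power2_eq_square algebra_simps)
  moreover have "\<forall>a. norm (C a) = dist (?p $ a) (?p $ (a + 3))"
    unfolding all_8 apply (simp add: simps numeral_mod_8 tent_nth rho d3 e complex_norm)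
    apply (intro conjI)
    using len by (simp_all add: power2_eq_square algebra_simps)
  moreover have "\<forall>a. Im (cnj (A a) * C a) > 0"
    unfolding all_8 apply (simp add: simps numeral_mod_8)
    unfolding e using assms by (simp add: algebra_simps)
  moreover have "\<forall>a. Im (cnj (C a) * B' a) > 0"
    unfolding all_8 apply (simp add: simps numeral_mod_8)
    unfolding e using assms by (simp add: algebra_simps)
  ultimately show ?thesis
    by (intro cone_angle_development[where A = A and B = B' and C = C]) auto
qed

end

subsection \<open>Solving a system that becomes constant in the limit\<close>

definition lips :: "'u::euclidean_space \<Rightarrow> (real \<times> 'u \<Rightarrow> 'b::real_normed_vector) \<Rightarrow> real \<Rightarrow> real \<Rightarrow> bool" where
  "lips u0 F \<kappa> r \<longleftrightarrow> r > 0 \<and> continuous_on ({0..r} \<times> cball u0 r) F \<and>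
     (\<forall>e\<in>{0..r}. \<forall>u\<in>cball u0 r. \<forall>v\<in>cball u0 r. dist (F (e, u)) (F (e, v)) \<le> \<kappa> * dist u v)"

text \<open>\<open>flat u0 c F\<close>: near \<open>(0, u0)\<close> the function \<open>F\<close> is continuous, has value \<open>c\<close>, and is Lipschitz in
  its second argument with arbitrarily small constant; \<open>tame u0 c F\<close> asks only for some constant.
  A map with flat components and value \<open>u0\<close> is a contraction for small values of the first argument.\<close>

definition flat :: "'u::euclidean_space \<Rightarrow> real \<Rightarrow> (real \<times> 'u \<Rightarrow> real) \<Rightarrow> bool" where
  "flat u0 c F \<longleftrightarrow> F (0, u0) = c \<and> (\<forall>\<kappa>>0. \<exists>r. lips u0 F \<kappa> r)"

definition tame :: "'u::euclidean_space \<Rightarrow> real \<Rightarrow> (real \<times> 'u \<Rightarrow> real) \<Rightarrow> bool" where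
  "tame u0 c F \<longleftrightarrow> F (0, u0) = c \<and> (\<exists>\<kappa>>0. \<exists>r. lips u0 F \<kappa> r)"

section \<open>Calculus of flat and tame functions\<close>

lemma lips_shrink: "lips u0 F \<kappa> r \<Longrightarrow> \<kappa> \<le> \<kappa>' \<Longrightarrow> 0 < r' \<Longrightarrow> r' \<le> r \<Longrightarrow> lips u0 F \<kappa>' r'"
proof -
  assume *: "lips u0 F \<kappa> r" "\<kappa> \<le> \<kappa>'" "0 < r'" "r' \<le> r"
  then have sub: "{0..r'} \<times> cball u0 r' \<subseteq> {0..r} \<times> cball u0 r" by auto
  have "dist (F (e, u)) (F (e, v)) \<le> \<kappa>' * dist u v" if "e \<in> {0..r'}" "u \<in> cball u0 r'" "v \<in> cball u0 r'" for e u v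
  proof -
    have "dist (F (e, u)) (F (e, v)) \<le> \<kappa> * dist u v" using * that by (auto simp: lips_def)
    also have "\<dots> \<le> \<kappa>' * dist u v" using *(2) by (intro mult_right_mono) auto
    finally show ?thesis .
  qed
  then show ?thesis using * continuous_on_subset[OF _ sub] by (auto simp: lips_def)
qed

lemma lips_near:
  assumes "lips u0 F \<kappa> r" "\<eta> > 0"
  obtains r' where "lips u0 F \<kappa> r'" "r' \<le> r" "\<And>x. x \<in> {0..r'} \<times> cball u0 r' \<Longrightarrow> dist (F x) (F (0, u0)) < \<eta>"
proof -
  let ?N = "{0..r} \<times> cball u0 r"
  have c: "continuous_on ?N F" and r: "r > 0" using assms(1) by (auto simp: lips_def)
  have "(0, u0) \<in> ?N" using r by auto
  then obtain d where d: "d > 0" "\<And>x. x \<in> ?N \<Longrightarrow> dist x (0, u0) < d \<Longrightarrow> dist (F x) (F (0, u0)) < \<eta>"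
    using c assms(2) unfolding continuous_on_iff by blast
  define r' where "r' = min r (d / 4)"
  have r': "r' > 0" "r' \<le> r" using d r by (auto simp: r'_def)
  have "dist (F x) (F (0, u0)) < \<eta>" if x: "x \<in> {0..r'} \<times> cball u0 r'" for x
  proof (rule d(2))
    show "x \<in> ?N" using x r' by auto
    obtain e u where eu: "x = (e, u)" by fastforce
    have "dist x (0, u0) \<le> dist e 0 + dist u u0"
      unfolding eu dist_Pair_Pair by (rule sqrt_sum_squares_le_sum) auto
    also have "\<dots> \<le> r' + r'" using x unfolding eu by (intro add_mono) (auto simp: dist_commute)
    also have "\<dots> < d" using d(1) by (auto simp: r'_def min_def)
    finally show "dist x (0, u0) < d" .
  qed
  then show ?thesis using that[of r'] r' lips_shrink[OF assms(1) order_refl r'] by blast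
qed

lemma flat_imp_tame: "flat u0 c F \<Longrightarrow> tame u0 c F"
  unfolding flat_def tame_def by (meson zero_less_one)

lemma flat_param:
  assumes "continuous_on {0..r} \<phi>" "r > 0" "\<phi> 0 = c"
  shows "flat u0 c (\<lambda>x. \<phi> (fst x))"
proof -
  have "continuous_on ({0..r} \<times> cball u0 r) (\<lambda>x. \<phi> (fst x))"
    by (rule continuous_on_compose2[OF assms(1)]) (auto intro: continuous_intros)
  then have "lips u0 (\<lambda>x. \<phi> (fst x)) \<kappa> r" if "\<kappa> > 0" for \<kappa>
    using assms that by (auto simp: lips_def)
  then show ?thesis using assms unfolding flat_def by auto
qed

lemma flat_const: "flat u0 c (\<lambda>x. c)"
  using flat_param[of 1 "\<lambda>_. c" c u0] by simp

lemma tame_coordinate: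
  assumes "\<And>u v. dist (\<pi> u) (\<pi> v) \<le> dist u v"
  shows "tame u0 (\<pi> u0) (\<lambda>x. \<pi> (snd x))"
proof -
  have "continuous_on UNIV \<pi>"
    unfolding continuous_on_iff using assms by (meson le_less_trans)
  then have "continuous_on ({0..1} \<times> cball u0 1) (\<lambda>x. \<pi> (snd x))"
    by (rule continuous_on_compose2) (auto intro: continuous_intros)
  then have "lips u0 (\<lambda>x. \<pi> (snd x)) 1 1" using assms by (auto simp: lips_def)
  then show ?thesis unfolding tame_def by (auto intro!: exI[of _ 1])
qed

lemma lips_add: "lips u0 F a r \<Longrightarrow> lips u0 G b r \<Longrightarrow> lips u0 (\<lambda>x. F x + G x) (a + b) r" for F G :: "_ \<Rightarrow> real"
  unfolding lips_def
proof (intro conjI ballI; (elim conjE)?)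
  fix e u v assume *: "\<forall>e\<in>{0..r}. \<forall>u\<in>cball u0 r. \<forall>v\<in>cball u0 r. dist (F (e, u)) (F (e, v)) \<le> a * dist u v"
    "\<forall>e\<in>{0..r}. \<forall>u\<in>cball u0 r. \<forall>v\<in>cball u0 r. dist (G (e, u)) (G (e, v)) \<le> b * dist u v"
    "e \<in> {0..r}" "u \<in> cball u0 r" "v \<in> cball u0 r"
  have "dist (F (e, u)) (F (e, v)) \<le> a * dist u v" "dist (G (e, u)) (G (e, v)) \<le> b * dist u v" using * by auto
  then show "dist (F (e, u) + G (e, u)) (F (e, v) + G (e, v)) \<le> (a + b) * dist u v"
    unfolding dist_real_def distrib_right by linarith
qed (auto intro: continuous_intros)

lemma lips_mult:
  fixes F G :: "real \<times> 'u::euclidean_space \<Rightarrow> real"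
  assumes "lips u0 F a r" "lips u0 G b r" "\<And>x. x \<in> {0..r} \<times> cball u0 r \<Longrightarrow> \<bar>F x\<bar> \<le> M"
    "\<And>x. x \<in> {0..r} \<times> cball u0 r \<Longrightarrow> \<bar>G x\<bar> \<le> N" "a \<ge> 0" "b \<ge> 0"
  shows "lips u0 (\<lambda>x. F x * G x) (M * b + N * a) r"
proof -
  have "dist (F (e, u) * G (e, u)) (F (e, v) * G (e, v)) \<le> (M * b + N * a) * dist u v"
    if *: "e \<in> {0..r}" "u \<in> cball u0 r" "v \<in> cball u0 r" for e u v
  proof -
    have F: "dist (F (e, u)) (F (e, v)) \<le> a * dist u v" and G: "dist (G (e, u)) (G (e, v)) \<le> b * dist u v"
      using * assms by (auto simp: lips_def)
    have M: "\<bar>F (e, u)\<bar> \<le> M" and N: "\<bar>G (e, v)\<bar> \<le> N" using * assms by auto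
    have "F (e, u) * G (e, u) - F (e, v) * G (e, v) = F (e, u) * (G (e, u) - G (e, v)) + G (e, v) * (F (e, u) - F (e, v))"
      by (simp add: algebra_simps)
    then have "dist (F (e, u) * G (e, u)) (F (e, v) * G (e, v))
        \<le> \<bar>F (e, u)\<bar> * dist (G (e, u)) (G (e, v)) + \<bar>G (e, v)\<bar> * dist (F (e, u)) (F (e, v))"
      unfolding dist_real_def by (metis abs_mult abs_triangle_ineq)
    also have "\<dots> \<le> M * (b * dist u v) + N * (a * dist u v)"
      using F G M N assms(5,6) by (intro add_mono mult_mono) (auto intro: order_trans[OF abs_ge_zero])
    finally show ?thesis by (simp add: algebra_simps)
  qed
  then show ?thesis using assms by (auto simp: lips_def intro: continuous_intros)
qed

lemma flat_add: assumes "flat u0 c F" "flat u0 d G" shows "flat u0 (c + d) (\<lambda>x. F x + G x)"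
  unfolding flat_def
proof (intro conjI allI impI)
  show "F (0, u0) + G (0, u0) = c + d" using assms by (simp add: flat_def)
  fix \<kappa> :: real assume "\<kappa> > 0"
  then obtain r s where "lips u0 F (\<kappa> / 2) r" "lips u0 G (\<kappa> / 2) s"
    using assms unfolding flat_def by (meson half_gt_zero)
  moreover have "r > 0" "s > 0" using calculation by (auto simp: lips_def)
  ultimately have "lips u0 F (\<kappa> / 2) (min r s)" "lips u0 G (\<kappa> / 2) (min r s)"
    using lips_shrink[of u0 F "\<kappa> / 2" r "\<kappa> / 2" "min r s"] lips_shrink[of u0 G "\<kappa> / 2" s "\<kappa> / 2" "min r s"]
    by simp_all
  from lips_add[OF this] show "\<exists>r. lips u0 (\<lambda>x. F x + G x) \<kappa> r" by auto
qed

lemma lips_common: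
  fixes F G :: "real \<times> 'u::euclidean_space \<Rightarrow> real"
  assumes "lips u0 F a r" "lips u0 G b s" "\<eta> > 0"
  obtains q where "lips u0 F a q" "lips u0 G b q"
    "\<And>x. x \<in> {0..q} \<times> cball u0 q \<Longrightarrow> \<bar>F x\<bar> \<le> \<bar>F (0, u0)\<bar> + \<eta>"
    "\<And>x. x \<in> {0..q} \<times> cball u0 q \<Longrightarrow> \<bar>G x\<bar> \<le> \<bar>G (0, u0)\<bar> + 1"
proof -
  obtain r' where r': "lips u0 F a r'" "\<And>x. x \<in> {0..r'} \<times> cball u0 r' \<Longrightarrow> dist (F x) (F (0, u0)) < \<eta>"
    using lips_near[OF assms(1,3)] by metis
  obtain s' where s': "lips u0 G b s'" "\<And>x. x \<in> {0..s'} \<times> cball u0 s' \<Longrightarrow> dist (G x) (G (0, u0)) < 1"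
    using lips_near[OF assms(2) zero_less_one] by metis
  define q where "q = min r' s'"
  have q: "q > 0" "q \<le> r'" "q \<le> s'" using r' s' by (auto simp: q_def lips_def)
  have sub: "{0..q} \<times> cball u0 q \<subseteq> {0..r'} \<times> cball u0 r'" "{0..q} \<times> cball u0 q \<subseteq> {0..s'} \<times> cball u0 s'"
    using q by auto
  show ?thesis
  proof (rule that[of q])
    show "lips u0 F a q" "lips u0 G b q" using lips_shrink r'(1) s'(1) q by blast+
    show "\<bar>F x\<bar> \<le> \<bar>F (0, u0)\<bar> + \<eta>" if "x \<in> {0..q} \<times> cball u0 q" for x
      using r'(2)[of x] sub(1) that by (auto simp: dist_real_def)
    show "\<bar>G x\<bar> \<le> \<bar>G (0, u0)\<bar> + 1" if "x \<in> {0..q} \<times> cball u0 q" for x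
      using s'(2)[of x] sub(2) that by (auto simp: dist_real_def)
  qed
qed

lemma flat_mult: assumes "flat u0 c F" "flat u0 d G" shows "flat u0 (c * d) (\<lambda>x. F x * G x)"
  unfolding flat_def
proof (intro conjI allI impI)
  show "F (0, u0) * G (0, u0) = c * d" using assms by (simp add: flat_def)
  fix \<kappa> :: real assume \<kappa>: "\<kappa> > 0"
  define k where "k = \<kappa> / (\<bar>c\<bar> + 1 + (\<bar>d\<bar> + 1))"
  have k: "k > 0" unfolding k_def using \<kappa> by (intro divide_pos_pos) linarith+
  then obtain r s where "lips u0 F k r" "lips u0 G k s" using assms unfolding flat_def by meson
  from lips_common[OF this zero_less_one] obtain q where q: "lips u0 F k q" "lips u0 G k q"
    "\<And>x. x \<in> {0..q} \<times> cball u0 q \<Longrightarrow> \<bar>F x\<bar> \<le> \<bar>c\<bar> + 1"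
    "\<And>x. x \<in> {0..q} \<times> cball u0 q \<Longrightarrow> \<bar>G x\<bar> \<le> \<bar>d\<bar> + 1"
    using assms unfolding flat_def by metis
  have "lips u0 (\<lambda>x. F x * G x) ((\<bar>c\<bar> + 1) * k + (\<bar>d\<bar> + 1) * k) q"
    by (rule lips_mult) (use q k in auto)
  moreover have "(\<bar>c\<bar> + 1) * k + (\<bar>d\<bar> + 1) * k = \<kappa>"
  proof -
    have "\<bar>c\<bar> + 1 + (\<bar>d\<bar> + 1) \<noteq> 0" by linarith
    then show ?thesis unfolding k_def distrib_right[symmetric] by simp
  qed
  ultimately show "\<exists>r. lips u0 (\<lambda>x. F x * G x) \<kappa> r" by auto
qed

lemma tame_mult: assumes "tame u0 c F" "tame u0 d G" shows "tame u0 (c * d) (\<lambda>x. F x * G x)"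
proof -
  obtain a b r s where *: "a > 0" "b > 0" "lips u0 F a r" "lips u0 G b s"
    using assms unfolding tame_def by blast
  from lips_common[OF *(3,4) zero_less_one] obtain q where q: "lips u0 F a q" "lips u0 G b q"
    "\<And>x. x \<in> {0..q} \<times> cball u0 q \<Longrightarrow> \<bar>F x\<bar> \<le> \<bar>c\<bar> + 1"
    "\<And>x. x \<in> {0..q} \<times> cball u0 q \<Longrightarrow> \<bar>G x\<bar> \<le> \<bar>d\<bar> + 1"
    using assms unfolding tame_def by metis
  have "lips u0 (\<lambda>x. F x * G x) ((\<bar>c\<bar> + 1) * b + (\<bar>d\<bar> + 1) * a) q"
    by (rule lips_mult) (use q * in auto)
  moreover have "(\<bar>c\<bar> + 1) * b + (\<bar>d\<bar> + 1) * a > 0"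
    using * mult_pos_pos[of "\<bar>c\<bar> + 1" b] mult_pos_pos[of "\<bar>d\<bar> + 1" a] by linarith
  moreover have "F (0, u0) * G (0, u0) = c * d" using assms by (simp add: tame_def)
  ultimately show ?thesis unfolding tame_def by blast
qed

text \<open>The Lipschitz constant of a product is at most the bound of \<open>F\<close> times the
  constant of \<open>G\<close> plus the bound of \<open>G\<close> times the constant of
  \<open>F\<close>. As \<open>F\<close> vanishes at the base point, both terms become small on a
  small neighbourhood. In this way the unknowns, which are only tame, can enter the system: always
  with a coefficient that tends to 0.\<close>

lemma flat_mult_tame: assumes "flat u0 0 F" "tame u0 d G" shows "flat u0 0 (\<lambda>x. F x * G x)"
  unfolding flat_def
proof (intro conjI allI impI)
  show "F (0, u0) * G (0, u0) = 0" using assms by (simp add: flat_def)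
  fix \<kappa> :: real assume \<kappa>: "\<kappa> > 0"
  obtain b s where b: "b > 0" "lips u0 G b s" using assms unfolding tame_def by blast
  define k where "k = \<kappa> / 2 / (\<bar>d\<bar> + 1)"
  define \<eta> where "\<eta> = \<kappa> / 2 / b"
  have k: "k > 0" "\<eta> > 0" unfolding k_def \<eta>_def using \<kappa> b by (auto intro!: divide_pos_pos add_nonneg_pos)
  obtain r where "lips u0 F k r" using assms k unfolding flat_def by meson
  from lips_common[OF this b(2) k(2)] obtain q where q: "lips u0 F k q" "lips u0 G b q"
    "\<And>x. x \<in> {0..q} \<times> cball u0 q \<Longrightarrow> \<bar>F x\<bar> \<le> \<bar>0\<bar> + \<eta>"
    "\<And>x. x \<in> {0..q} \<times> cball u0 q \<Longrightarrow> \<bar>G x\<bar> \<le> \<bar>d\<bar> + 1"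
    using assms unfolding flat_def tame_def by metis
  have "lips u0 (\<lambda>x. F x * G x) (\<eta> * b + (\<bar>d\<bar> + 1) * k) q"
    by (rule lips_mult) (use q k b in auto)
  moreover have "\<eta> * b + (\<bar>d\<bar> + 1) * k = \<kappa>"
  proof -
    have "\<bar>d\<bar> + 1 \<noteq> 0" by linarith
    then have "(\<bar>d\<bar> + 1) * k = \<kappa> / 2" unfolding k_def by (rule nonzero_mult_div_cancel_left[of _ "\<kappa> / 2", simplified times_divide_eq_right[symmetric]])
    moreover have "\<eta> * b = \<kappa> / 2" unfolding \<eta>_def using b by simp
    ultimately show ?thesis by simp
  qed
  ultimately show "\<exists>r. lips u0 (\<lambda>x. F x * G x) \<kappa> r" by auto
qed

lemma lips_compose:
  fixes \<phi> :: "real \<Rightarrow> real"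
  assumes F: "lips u0 F a r" and a: "a > 0" and \<phi>: "\<eta> > 0" "L > 0"
    "\<And>x y. \<bar>x - F (0,u0)\<bar> \<le> \<eta> \<Longrightarrow> \<bar>y - F (0,u0)\<bar> \<le> \<eta> \<Longrightarrow> \<bar>\<phi> x - \<phi> y\<bar> \<le> L * \<bar>x - y\<bar>"
  shows "\<exists>q. lips u0 (\<lambda>x. \<phi> (F x)) (L * a) q"
proof -
  obtain q where q: "lips u0 F a q" "\<And>x. x \<in> {0..q} \<times> cball u0 q \<Longrightarrow> dist (F x) (F (0, u0)) < \<eta>"
    using lips_near[OF F \<phi>(1)] by metis
  have lip: "dist (\<phi> (F x)) (\<phi> (F y)) \<le> L * dist (F x) (F y)"
    if "x \<in> {0..q} \<times> cball u0 q" "y \<in> {0..q} \<times> cball u0 q" for x y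
    using \<phi>(3)[of "F x" "F y"] q(2)[OF that(1)] q(2)[OF that(2)] by (simp add: dist_real_def)
  have cont: "continuous_on ({0..q} \<times> cball u0 q) (\<lambda>x. \<phi> (F x))"
    unfolding continuous_on_iff
  proof (intro ballI allI impI)
    fix x :: "real \<times> 'a" and e :: real assume x: "x \<in> {0..q} \<times> cball u0 q" and e: "e > 0"
    have "continuous_on ({0..q} \<times> cball u0 q) F" using q(1) by (auto simp: lips_def)
    then obtain d where d: "d > 0" "\<And>y. y \<in> {0..q} \<times> cball u0 q \<Longrightarrow> dist y x < d \<Longrightarrow> dist (F y) (F x) < e / L"
      using x e \<phi>(2) unfolding continuous_on_iff by (metis divide_pos_pos)
    have "dist (\<phi> (F y)) (\<phi> (F x)) < e" if "y \<in> {0..q} \<times> cball u0 q" "dist y x < d" for y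
      using lip[OF that(1) x] d(2)[OF that] \<phi>(2) by (simp add: field_simps)
    then show "\<exists>d>0. \<forall>y\<in>{0..q} \<times> cball u0 q. dist y x < d \<longrightarrow> dist (\<phi> (F y)) (\<phi> (F x)) < e"
      using d(1) by blast
  qed
  have "dist (\<phi> (F (e,u))) (\<phi> (F (e,v))) \<le> L * a * dist u v"
    if *: "e \<in> {0..q}" "u \<in> cball u0 q" "v \<in> cball u0 q" for e u v
  proof -
    have "dist (\<phi> (F (e,u))) (\<phi> (F (e,v))) \<le> L * dist (F (e,u)) (F (e,v))" using lip * by auto
    also have "\<dots> \<le> L * (a * dist u v)" using q(1) * \<phi>(2) by (intro mult_left_mono) (auto simp: lips_def)
    finally show ?thesis by (simp add: mult.assoc)
  qed
  then have "lips u0 (\<lambda>x. \<phi> (F x)) (L * a) q" using q(1) cont by (auto simp: lips_def)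
  then show ?thesis by blast
qed

lemma flat_compose:
  fixes \<phi> :: "real \<Rightarrow> real"
  assumes F: "flat u0 c F" and \<phi>: "\<eta> > 0" "L > 0"
    "\<And>x y. \<bar>x - c\<bar> \<le> \<eta> \<Longrightarrow> \<bar>y - c\<bar> \<le> \<eta> \<Longrightarrow> \<bar>\<phi> x - \<phi> y\<bar> \<le> L * \<bar>x - y\<bar>"
  shows "flat u0 (\<phi> c) (\<lambda>x. \<phi> (F x))"
  unfolding flat_def
proof (intro conjI allI impI)
  show "\<phi> (F (0, u0)) = \<phi> c" using F by (simp add: flat_def)
  fix \<kappa> :: real assume \<kappa>: "\<kappa> > 0"
  then have "\<kappa> / L > 0" using \<phi> by simp
  then obtain r where "lips u0 F (\<kappa> / L) r" using F unfolding flat_def by meson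
  from lips_compose[OF this \<open>\<kappa> / L > 0\<close> \<phi>(1,2)] \<phi> F show "\<exists>r. lips u0 (\<lambda>x. \<phi> (F x)) \<kappa> r"
    by (auto simp: flat_def)
qed

lemma inverse_lipschitz_near:
  fixes c x y :: real
  assumes "c \<noteq> 0" "\<bar>x - c\<bar> \<le> \<bar>c\<bar> / 2" "\<bar>y - c\<bar> \<le> \<bar>c\<bar> / 2"
  shows "\<bar>inverse x - inverse y\<bar> \<le> 4 / c\<^sup>2 * \<bar>x - y\<bar>"
proof -
  have xy: "\<bar>x\<bar> \<ge> \<bar>c\<bar> / 2" "\<bar>y\<bar> \<ge> \<bar>c\<bar> / 2" using assms by linarith+
  then have n: "x \<noteq> 0" "y \<noteq> 0" using assms(1) by auto
  have "\<bar>x\<bar> * \<bar>y\<bar> \<ge> (\<bar>c\<bar> / 2) * (\<bar>c\<bar> / 2)" using xy by (intro mult_mono) auto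
  then have c: "\<bar>x * y\<bar> \<ge> c\<^sup>2 / 4" by (simp add: abs_mult power2_eq_square)
  have "\<bar>inverse x - inverse y\<bar> = \<bar>x - y\<bar> / \<bar>x * y\<bar>"
  proof -
    have "inverse x - inverse y = (y - x) / (x * y)" using n by (simp add: field_simps)
    then show ?thesis by (simp add: abs_divide abs_minus_commute)
  qed
  also have "\<dots> \<le> \<bar>x - y\<bar> / (c\<^sup>2 / 4)" using c assms(1) n by (intro divide_left_mono) (auto intro!: mult_pos_pos)
  finally show ?thesis by (simp add: mult.commute)
qed

lemma flat_inverse: "flat u0 c F \<Longrightarrow> c \<noteq> 0 \<Longrightarrow> flat u0 (inverse c) (\<lambda>x. inverse (F x))"
  by (rule flat_compose[of u0 c F "\<bar>c\<bar> / 2" "4 / c\<^sup>2"]; (rule inverse_lipschitz_near)?; simp)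

lemma flat_sqrt: assumes "flat u0 c F" "c > 0" shows "flat u0 (sqrt c) (\<lambda>x. sqrt (F x))"
proof (rule flat_compose[OF assms(1), of "c / 2" "1 / sqrt (c / 2)"])
  fix x y assume "\<bar>x - c\<bar> \<le> c / 2" "\<bar>y - c\<bar> \<le> c / 2"
  then have xy: "x \<ge> c / 2" "y \<ge> c / 2" by linarith+
  then have p: "x > 0" "y > 0" "sqrt (c / 2) > 0" "sqrt x \<ge> sqrt (c / 2)" "sqrt y > 0" using assms(2) by auto
  have "(sqrt x - sqrt y) * (sqrt x + sqrt y) = x - y" using p by (simp add: algebra_simps)
  then have "\<bar>x - y\<bar> = \<bar>sqrt x - sqrt y\<bar> * (sqrt x + sqrt y)"
    using p abs_mult[of "sqrt x - sqrt y" "sqrt x + sqrt y"] by simp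
  moreover have "\<bar>sqrt x - sqrt y\<bar> * sqrt (c / 2) \<le> \<bar>sqrt x - sqrt y\<bar> * (sqrt x + sqrt y)"
    using p by (intro mult_left_mono) linarith+
  ultimately have "\<bar>sqrt x - sqrt y\<bar> * sqrt (c / 2) \<le> \<bar>x - y\<bar>" by simp
  then show "\<bar>sqrt x - sqrt y\<bar> \<le> 1 / sqrt (c / 2) * \<bar>x - y\<bar>" using p by (simp add: field_simps)
qed (use assms in auto)

lemma flat_uminus: "flat u0 c F \<Longrightarrow> flat u0 (- c) (\<lambda>x. - F x)"
  using flat_mult[OF flat_const[of u0 "-1"], of c F] by simp

lemma flat_diff: "flat u0 c F \<Longrightarrow> flat u0 d G \<Longrightarrow> flat u0 (c - d) (\<lambda>x. F x - G x)"
  using flat_add[of u0 c F "- d" "\<lambda>x. - G x"] flat_uminus[of u0 d G] by simp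

lemma flat_divide: "flat u0 c F \<Longrightarrow> flat u0 d G \<Longrightarrow> d \<noteq> 0 \<Longrightarrow> flat u0 (c / d) (\<lambda>x. F x / G x)"
  unfolding divide_inverse by (intro flat_mult flat_inverse)

lemma flat_power: "flat u0 c F \<Longrightarrow> flat u0 (c ^ n) (\<lambda>x. F x ^ n)"
  by (induction n) (auto intro: flat_mult flat_const)

lemma tame_power: "tame u0 c F \<Longrightarrow> tame u0 (c ^ n) (\<lambda>x. F x ^ n)"
  by (induction n) (auto intro: tame_mult flat_imp_tame[OF flat_const])

lemma lips_Pair:
  assumes "lips u0 F a r" "lips u0 G b s"
  shows "\<exists>q. lips u0 (\<lambda>x. (F x, G x)) (a + b) q"
proof -
  define q where "q = min r s"
  have q: "q > 0" "q \<le> r" "q \<le> s" using assms by (auto simp: q_def lips_def)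
  have F: "lips u0 F a q" and G: "lips u0 G b q" using lips_shrink[OF _ order_refl q(1)] assms q by auto
  have "dist (F (e,u), G (e,u)) (F (e,v), G (e,v)) \<le> (a + b) * dist u v"
    if *: "e \<in> {0..q}" "u \<in> cball u0 q" "v \<in> cball u0 q" for e u v
  proof -
    have "dist (F (e,u), G (e,u)) (F (e,v), G (e,v)) \<le> dist (F (e,u)) (F (e,v)) + dist (G (e,u)) (G (e,v))"
      unfolding dist_Pair_Pair by (rule sqrt_sum_squares_le_sum) auto
    also have "\<dots> \<le> a * dist u v + b * dist u v" using F G * by (intro add_mono) (auto simp: lips_def)
    finally show ?thesis by (simp add: algebra_simps)
  qed
  then have "lips u0 (\<lambda>x. (F x, G x)) (a + b) q"
    using F G by (auto simp: lips_def intro: continuous_on_Pair)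
  then show ?thesis by blast
qed

text \<open>Banach's fixed point theorem with a parameter. Continuity of the solution at
  \<open>e0\<close> comes from the contraction estimate: the distance from \<open>g e\<close> to
  \<open>g e0\<close> is at most twice that from \<open>\<Phi> (e, g e0)\<close> to
  \<open>g e0\<close>, and the latter is small by continuity of \<open>\<Phi>\<close>.\<close>

lemma contraction_solution:
  fixes \<Phi> :: "real \<times> 'u::euclidean_space \<Rightarrow> 'u"
  assumes L: "lips u0 \<Phi> (1/2) r" and \<Phi>0: "\<Phi> (0, u0) = u0"
  obtains q g where "q > 0" "continuous_on {0..q} g" "g 0 = u0" "\<And>e. e \<in> {0..q} \<Longrightarrow> \<Phi> (e, g e) = g e"
proof -
  have r: "r > 0" and cont: "continuous_on ({0..r} \<times> cball u0 r) \<Phi>"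
    and lip: "\<And>e u v. e \<in> {0..r} \<Longrightarrow> u \<in> cball u0 r \<Longrightarrow> v \<in> cball u0 r \<Longrightarrow> dist (\<Phi> (e, u)) (\<Phi> (e, v)) \<le> 1/2 * dist u v"
    using L by (auto simp: lips_def)
  obtain q where q: "lips u0 \<Phi> (1/2) q" "q \<le> r" "\<And>x. x \<in> {0..q} \<times> cball u0 q \<Longrightarrow> dist (\<Phi> x) u0 < r / 2"
    using lips_near[OF L, of "r / 2"] r \<Phi>0 by (metis half_gt_zero)
  have q0: "q > 0" using q(1) by (auto simp: lips_def)
  have "\<exists>!u. u \<in> cball u0 r \<and> \<Phi> (e, u) = u" if e: "e \<in> {0..q}" for e
  proof -
    have e': "e \<in> {0..r}" using e q(2) by auto
    have "\<exists>!u\<in>cball u0 r. (\<lambda>u. \<Phi> (e, u)) u = u"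
    proof (rule Banach_fix[where c = "1/2"])
      show "complete (cball u0 r)" by (simp add: complete_eq_closed)
      show "cball u0 r \<noteq> {}" using r by auto
      show "(\<lambda>u. \<Phi> (e, u)) ` cball u0 r \<subseteq> cball u0 r"
      proof
        fix w assume "w \<in> (\<lambda>u. \<Phi> (e, u)) ` cball u0 r"
        then obtain u where u: "u \<in> cball u0 r" "w = \<Phi> (e, u)" by blast
        have "dist (\<Phi> (e, u)) (\<Phi> (e, u0)) \<le> 1/2 * dist u u0" using lip[OF e' u(1)] r by auto
        moreover have "dist (\<Phi> (e, u0)) u0 < r / 2" using q(3)[of "(e, u0)"] e q0 by auto
        moreover have "dist u u0 \<le> r" using u(1) by (simp add: dist_commute)
        ultimately have "dist w u0 \<le> r" unfolding u(2)
          using dist_triangle[of "\<Phi> (e, u)" u0 "\<Phi> (e, u0)"] by linarith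
        then show "w \<in> cball u0 r" by (simp add: dist_commute)
      qed
    qed (use lip[OF e'] in auto)
    then show ?thesis by blast
  qed
  then obtain g where g: "\<And>e. e \<in> {0..q} \<Longrightarrow> g e \<in> cball u0 r \<and> \<Phi> (e, g e) = g e"
    and uniq: "\<And>e u. e \<in> {0..q} \<Longrightarrow> u \<in> cball u0 r \<Longrightarrow> \<Phi> (e, u) = u \<Longrightarrow> u = g e"
    by metis
  show ?thesis
  proof (rule that[OF q0, of g])
    show "g 0 = u0" using uniq[of 0 u0] q0 r \<Phi>0 by auto
    show "\<Phi> (e, g e) = g e" if "e \<in> {0..q}" for e using g that by blast
    show "continuous_on {0..q} g"
      unfolding continuous_on_iff
    proof (intro ballI allI impI)
      fix e0 \<eta> :: real assume e0: "e0 \<in> {0..q}" and \<eta>: "\<eta> > 0"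
      have m: "(e0, g e0) \<in> {0..r} \<times> cball u0 r" using e0 g q(2) by auto
      obtain d where d: "d > 0"
        "\<And>y. y \<in> {0..r} \<times> cball u0 r \<Longrightarrow> dist y (e0, g e0) < d \<Longrightarrow> dist (\<Phi> y) (\<Phi> (e0, g e0)) < \<eta> / 2"
        using cont m \<eta> unfolding continuous_on_iff by (metis half_gt_zero)
      have "dist (g e) (g e0) < \<eta>" if e: "e \<in> {0..q}" "dist e e0 < d" for e
      proof -
        have e': "e \<in> {0..r}" using e q(2) by auto
        have "dist (e, g e0) (e0, g e0) < d" using e(2) by (simp add: dist_Pair_Pair)
        then have "dist (\<Phi> (e, g e0)) (g e0) < \<eta> / 2" using d(2)[of "(e, g e0)"] e' g e0 m by auto
        moreover have "dist (\<Phi> (e, g e)) (\<Phi> (e, g e0)) \<le> 1/2 * dist (g e) (g e0)"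
          using lip[OF e'] g e(1) e0 by blast
        moreover have "dist (g e) (g e0) \<le> dist (\<Phi> (e, g e)) (\<Phi> (e, g e0)) + dist (\<Phi> (e, g e0)) (g e0)"
          using dist_triangle[of "g e" "g e0" "\<Phi> (e, g e0)"] g e(1) by auto
        ultimately show ?thesis by linarith
      qed
      then show "\<exists>d>0. \<forall>e\<in>{0..q}. dist e e0 < d \<longrightarrow> dist (g e) (g e0) < \<eta>" using d(1) by blast
    qed
  qed
qed

lemma flat_system_solution:
  fixes c1 c2 c3 c4 c5 :: real and F1 F2 F3 F4 F5 :: "real \<times> (real \<times> real \<times> real \<times> real \<times> real) \<Rightarrow> real"
  defines "u0 \<equiv> (c1, c2, c3, c4, c5)"
  assumes "flat u0 c1 F1" "flat u0 c2 F2" "flat u0 c3 F3" "flat u0 c4 F4" "flat u0 c5 F5"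
  obtains q g1 g2 g3 g4 g5 where "q > 0"
    "continuous_on {0..q} g1" "continuous_on {0..q} g2" "continuous_on {0..q} g3"
    "continuous_on {0..q} g4" "continuous_on {0..q} g5"
    "g1 0 = c1" "g2 0 = c2" "g3 0 = c3" "g4 0 = c4" "g5 0 = c5"
    "\<And>e. e \<in> {0..q} \<Longrightarrow> F1 (e, (g1 e, g2 e, g3 e, g4 e, g5 e)) = g1 e"
    "\<And>e. e \<in> {0..q} \<Longrightarrow> F2 (e, (g1 e, g2 e, g3 e, g4 e, g5 e)) = g2 e"
    "\<And>e. e \<in> {0..q} \<Longrightarrow> F3 (e, (g1 e, g2 e, g3 e, g4 e, g5 e)) = g3 e"
    "\<And>e. e \<in> {0..q} \<Longrightarrow> F4 (e, (g1 e, g2 e, g3 e, g4 e, g5 e)) = g4 e"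
    "\<And>e. e \<in> {0..q} \<Longrightarrow> F5 (e, (g1 e, g2 e, g3 e, g4 e, g5 e)) = g5 e"
proof -
  \<comment> \<open>Five components with constant \<open>1/10\<close> give the tuple the contraction
    constant \<open>1/2\<close>.\<close>
  have t: "(1/10::real) > 0" by simp
  obtain r1 r2 r3 r4 r5 where r: "lips u0 F1 (1/10) r1" "lips u0 F2 (1/10) r2" "lips u0 F3 (1/10) r3"
    "lips u0 F4 (1/10) r4" "lips u0 F5 (1/10) r5"
    using assms t unfolding flat_def by meson
  let ?\<Phi> = "\<lambda>x. (F1 x, F2 x, F3 x, F4 x, F5 x)"
  obtain s4 where "lips u0 (\<lambda>x. (F4 x, F5 x)) (1/10 + 1/10) s4" using lips_Pair[OF r(4,5)] by blast
  then obtain s3 where "lips u0 (\<lambda>x. (F3 x, F4 x, F5 x)) (1/10 + (1/10 + 1/10)) s3" using lips_Pair[OF r(3)] by blast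
  then obtain s2 where "lips u0 (\<lambda>x. (F2 x, F3 x, F4 x, F5 x)) (1/10 + (1/10 + (1/10 + 1/10))) s2" using lips_Pair[OF r(2)] by blast
  then obtain s1 where "lips u0 ?\<Phi> (1/10 + (1/10 + (1/10 + (1/10 + 1/10)))) s1" using lips_Pair[OF r(1)] by blast
  then have L: "lips u0 ?\<Phi> (1/2) s1" by simp
  have "?\<Phi> (0, u0) = u0" using assms unfolding flat_def u0_def by simp
  from contraction_solution[OF L this] obtain q g where q: "q > 0" "continuous_on {0..q} g" "g 0 = u0"
    "\<And>e. e \<in> {0..q} \<Longrightarrow> ?\<Phi> (e, g e) = g e" by metis
  define g1 g2 g3 g4 g5 where "g1 = (\<lambda>e. fst (g e))" and "g2 = (\<lambda>e. fst (snd (g e)))"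
    and "g3 = (\<lambda>e. fst (snd (snd (g e))))" and "g4 = (\<lambda>e. fst (snd (snd (snd (g e)))))"
    and "g5 = (\<lambda>e. snd (snd (snd (snd (g e)))))"
  note gd = g1_def g2_def g3_def g4_def g5_def
  have ge: "g e = (g1 e, g2 e, g3 e, g4 e, g5 e)" for e unfolding gd by simp
  show ?thesis
  proof (rule that[of q g1 g2 g3 g4 g5])
    show "continuous_on {0..q} g1" "continuous_on {0..q} g2" "continuous_on {0..q} g3"
      "continuous_on {0..q} g4" "continuous_on {0..q} g5"
      unfolding gd by (intro continuous_intros q(2))+
    show "g1 0 = c1" "g2 0 = c2" "g3 0 = c3" "g4 0 = c4" "g5 0 = c5" using q(3) ge[of 0] unfolding u0_def by auto
    fix e assume "e \<in> {0..q}"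
    then have "?\<Phi> (e, (g1 e, g2 e, g3 e, g4 e, g5 e)) = (g1 e, g2 e, g3 e, g4 e, g5 e)" using q(4) ge by metis
    then show "F1 (e, (g1 e, g2 e, g3 e, g4 e, g5 e)) = g1 e" "F2 (e, (g1 e, g2 e, g3 e, g4 e, g5 e)) = g2 e"
      "F3 (e, (g1 e, g2 e, g3 e, g4 e, g5 e)) = g3 e" "F4 (e, (g1 e, g2 e, g3 e, g4 e, g5 e)) = g4 e"
      "F5 (e, (g1 e, g2 e, g3 e, g4 e, g5 e)) = g5 e" by simp_all
  qed (rule q(1))
qed

subsection \<open>Families of flat tents\<close>

lemma flat_along:
  assumes "flat u c F" "continuous_on {0..q} g" "g 0 = u" "q > 0"
  obtains s where "0 < s" "s \<le> q" "continuous_on {0..s} (\<lambda>e. F (e, g e))"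
proof -
  obtain r where r: "r > 0" "continuous_on ({0..r} \<times> cball u r) F"
    using assms(1) unfolding flat_def lips_def by (meson zero_less_one)
  have "0 \<in> {0..q}" using assms(4) by simp
  then obtain \<delta> where \<delta>: "\<delta> > 0" "\<And>e. e \<in> {0..q} \<Longrightarrow> dist e 0 < \<delta> \<Longrightarrow> dist (g e) (g 0) < r"
    using assms(2) r(1) unfolding continuous_on_iff by metis
  define s where "s = min (min q r) (\<delta>/2)"
  have s: "0 < s" "s \<le> q" "s \<le> r" "s < \<delta>" using assms(4) r(1) \<delta>(1) by (auto simp: s_def)
  have "continuous_on {0..s} (\<lambda>e. F (e, g e))"
  proof (rule continuous_on_compose2[OF r(2)])
    show "continuous_on {0..s} (\<lambda>e. (e, g e))"
      by (intro continuous_intros continuous_on_subset[OF assms(2)]) (use s in auto)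
    show "(\<lambda>e. (e, g e)) ` {0..s} \<subseteq> {0..r} \<times> cball u r"
    proof clarify
      fix e assume e: "e \<in> {0..s}"
      then have "dist (g e) (g 0) < r" using s by (intro \<delta>(2)) (auto simp: dist_real_def)
      then show "e \<in> {0..r} \<and> g e \<in> cball u r" using e s assms(3) by (auto simp: dist_commute)
    qed
  qed
  then show ?thesis using s that by blast
qed

lemma positive_near_0:
  fixes f :: "real \<Rightarrow> real"
  assumes "continuous_on {0..q} f" "f 0 > 0" "q > 0"
  obtains s where "0 < s" "s \<le> q" "\<And>e. e \<in> {0..s} \<Longrightarrow> f e > 0"
proof -
  have "0 \<in> {0..q}" using assms(3) by simp
  then obtain \<delta> where \<delta>: "\<delta> > 0" "\<And>e. e \<in> {0..q} \<Longrightarrow> dist e 0 < \<delta> \<Longrightarrow> dist (f e) (f 0) < f 0"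
    using assms(1,2) unfolding continuous_on_iff by metis
  have "f e > 0" if "e \<in> {0..min q (\<delta>/2)}" for e
    using \<delta>(2)[of e] \<delta>(1) that assms(2,3) by (auto simp: dist_real_def)
  then show ?thesis using \<delta>(1) assms(3) by (intro that[of "min q (\<delta>/2)"]) auto
qed

text \<open>The unknowns are \<open>T = t/g\<close>, \<open>\<sigma> = \<tau>(2y - n)/d\<^sup>2\<close>, \<open>G = g/d\<^sup>2\<close>, \<open>Kh = K/\<kappa>\<close>, \<open>nh = n/\<kappa>\<close>. The functions
  \<open>p\<^sub>i\<close>, \<open>q\<^sub>i\<close>, \<open>\<kappa>y\<close>, \<open>dy\<close>, \<open>dd\<close> are the coefficients of the rescaled equations, which are quotients
  that have to extend continuously to \<open>0\<close>.\<close>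

locale tent_family =
  fixes \<eta> X r\<^sub>0 :: real and L y z B c b d \<kappa> p\<^sub>1 p\<^sub>2 p\<^sub>3 q\<^sub>1 q\<^sub>2 q\<^sub>3 q\<^sub>4 \<kappa>y dy dd :: "real \<Rightarrow> real"
  assumes pos: "\<eta> > 0" "X > 0" "r\<^sub>0 > 0"
    and cont: "continuous_on {0..r\<^sub>0} L" "continuous_on {0..r\<^sub>0} y" "continuous_on {0..r\<^sub>0} z"
      "continuous_on {0..r\<^sub>0} B" "continuous_on {0..r\<^sub>0} c" "continuous_on {0..r\<^sub>0} b"
      "continuous_on {0..r\<^sub>0} d" "continuous_on {0..r\<^sub>0} \<kappa>"
      "continuous_on {0..r\<^sub>0} p\<^sub>1" "continuous_on {0..r\<^sub>0} p\<^sub>2" "continuous_on {0..r\<^sub>0} p\<^sub>3"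
      "continuous_on {0..r\<^sub>0} q\<^sub>1" "continuous_on {0..r\<^sub>0} q\<^sub>2" "continuous_on {0..r\<^sub>0} q\<^sub>3" "continuous_on {0..r\<^sub>0} q\<^sub>4"
      "continuous_on {0..r\<^sub>0} \<kappa>y" "continuous_on {0..r\<^sub>0} dy" "continuous_on {0..r\<^sub>0} dd"
    and zero: "d 0 = 0" "\<kappa> 0 = 0" "p\<^sub>1 0 = 0" "q\<^sub>2 0 = 0" "q\<^sub>3 0 = 0" "\<kappa>y 0 = 0" "dy 0 = 0" "dd 0 = 0"
    and f1_pos: "(z 0)\<^sup>2 + (L 0)\<^sup>2 - ((L 0)\<^sup>2/(2*\<eta>))\<^sup>2 - B 0 * (L 0)\<^sup>2/\<eta> > 0"
      "z 0 + sqrt ((z 0)\<^sup>2 + (L 0)\<^sup>2 - ((L 0)\<^sup>2/(2*\<eta>))\<^sup>2 - B 0 * (L 0)\<^sup>2/\<eta>) > 0"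
    and y_L: "y 0 * L 0 = 0"
    and X: "2 * X * (z 0 + sqrt ((z 0)\<^sup>2 + (L 0)\<^sup>2 - ((L 0)\<^sup>2/(2*\<eta>))\<^sup>2 - B 0 * (L 0)\<^sup>2/\<eta>)) =
       (z 0 + sqrt ((z 0)\<^sup>2 + (L 0)\<^sup>2 - ((L 0)\<^sup>2/(2*\<eta>))\<^sup>2 - B 0 * (L 0)\<^sup>2/\<eta>))\<^sup>2 + ((L 0)\<^sup>2/(2*\<eta>))\<^sup>2"
    and params_pos: "\<And>e. 0 < e \<Longrightarrow> e \<le> r\<^sub>0 \<Longrightarrow> L e > 0 \<and> y e > 0 \<and> z e > 0 \<and> d e > 0 \<and> \<kappa> e > 0 \<and> c e > 0 \<and> b e > 0
      \<and> \<eta> > y e \<and> \<eta> - y e + B e > 0 \<and> \<eta> + b e - B e > 0 \<and> \<eta> + B e - b e > 0"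
    and eqs: "\<And>e. 0 < e \<Longrightarrow> e \<le> r\<^sub>0 \<Longrightarrow> (L e)\<^sup>2 = \<eta>\<^sup>2 - 2*\<eta>*y e \<and> (z e)\<^sup>2 + (B e)\<^sup>2 = (c e)\<^sup>2 + (b e)\<^sup>2 \<and> (\<eta> - y e)*B e = - (y e*b e)"
    and quot: "\<And>e. 0 < e \<Longrightarrow> e \<le> r\<^sub>0 \<Longrightarrow>
       p\<^sub>1 e = z e * (d e)\<^sup>2 / (\<kappa> e * (\<eta> + b e - B e)) \<and> p\<^sub>2 e = L e * d e / (\<kappa> e * (\<eta> + b e - B e)) \<and>
       p\<^sub>3 e = (z e - c e) / (\<kappa> e * (\<eta> + b e - B e)) \<and>
       q\<^sub>1 e = 2 * L e * d e / (\<kappa> e * (\<eta> + B e - b e)) \<and> q\<^sub>2 e = (b e - y e) * (d e)\<^sup>2 / (y e * \<kappa> e * (\<eta> + B e - b e)) \<and>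
       q\<^sub>3 e = z e * (d e)\<^sup>2 / (\<kappa> e * (\<eta> + B e - b e)) \<and> q\<^sub>4 e = (z e - c e) / (\<kappa> e * (\<eta> + B e - b e)) \<and>
       \<kappa>y e = \<kappa> e / y e \<and> dy e = d e / y e \<and> dd e = (d e)\<^sup>2 / (y e * \<kappa> e)"
begin

definition "K\<^sub>0 = - q\<^sub>1 0 + q\<^sub>4 0 * X"
definition "n\<^sub>0 = p\<^sub>3 0 * X - p\<^sub>2 0"
text \<open>With \<open>x\<^sub>3\<close> tending to \<open>X\<close> and \<open>x\<^sub>1\<close>
  to \<open>- X\<close>, the equations \<open>g\<close>, \<open>t\<close>, \<open>\<tau>\<close>
  divided by \<open>d^2\<close> become \<open>1 = 2*G*X\<close>, \<open>4 = - 2*X*G*T\<close> and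
  \<open>\<sigma> = - G*X + G*T*X + 2\<close> in the limit; this gives the first three values. The
  last two are the limits of the divided equations \<open>K\<close> and \<open>n\<close>.\<close>

definition "u\<^sub>0 = (-4, -1/2, 1/(2*X), K\<^sub>0, n\<^sub>0)"
definition "\<phi>\<^sub>2 = - (L 0)\<^sup>2/(2*\<eta>)"
definition "\<phi>\<^sub>1 = z 0 + sqrt ((z 0)\<^sup>2 + (L 0)\<^sup>2 - \<phi>\<^sub>2\<^sup>2 + 2 * B 0 * \<phi>\<^sub>2)"

text \<open>The values \<open>\<phi>\<^sub>1\<close>, \<open>\<phi>\<^sub>2\<close> are the limits
  of \<open>f\<^sub>1\<close>, \<open>f\<^sub>2\<close>. The third fact lets the right side of
  equation \<open>x1\<close> tend to 0, so that \<open>x\<^sub>1\<close> and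
  \<open>x\<^sub>3\<close> have opposite limits; it also removes the middle term of equation
  \<open>x3\<close>, whose limit is the formula for \<open>X\<close>.\<close>

lemma phi: "(z 0)\<^sup>2 + (L 0)\<^sup>2 - \<phi>\<^sub>2\<^sup>2 + 2 * B 0 * \<phi>\<^sub>2 > 0" "\<phi>\<^sub>1 > 0" "y 0 * \<phi>\<^sub>2 = 0"
  "X = (\<phi>\<^sub>1\<^sup>2 + \<phi>\<^sub>2\<^sup>2)/2/\<phi>\<^sub>1"
proof -
  have e: "(z 0)\<^sup>2 + (L 0)\<^sup>2 - \<phi>\<^sub>2\<^sup>2 + 2 * B 0 * \<phi>\<^sub>2 = (z 0)\<^sup>2 + (L 0)\<^sup>2 - ((L 0)\<^sup>2/(2*\<eta>))\<^sup>2 - B 0 * (L 0)\<^sup>2/\<eta>"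
    unfolding \<phi>\<^sub>2_def using pos(1) by (simp add: field_simps power2_eq_square)
  show "(z 0)\<^sup>2 + (L 0)\<^sup>2 - \<phi>\<^sub>2\<^sup>2 + 2 * B 0 * \<phi>\<^sub>2 > 0" using f1_pos(1) e by simp
  show 1: "\<phi>\<^sub>1 > 0" using f1_pos(2) unfolding \<phi>\<^sub>1_def e by simp
  show "y 0 * \<phi>\<^sub>2 = 0" using y_L unfolding \<phi>\<^sub>2_def by (auto simp: power2_eq_square)
  have "2 * X * \<phi>\<^sub>1 = \<phi>\<^sub>1\<^sup>2 + \<phi>\<^sub>2\<^sup>2" using X unfolding \<phi>\<^sub>1_def e unfolding \<phi>\<^sub>2_def by simp
  then show "X = (\<phi>\<^sub>1\<^sup>2 + \<phi>\<^sub>2\<^sup>2)/2/\<phi>\<^sub>1" using 1 by (simp add: field_simps)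
qed

definition "hT x = fst (snd x)" for x :: "real \<times> (real \<times> real \<times> real \<times> real \<times> real)"
definition "h\<sigma> x = fst (snd (snd x))" for x :: "real \<times> (real \<times> real \<times> real \<times> real \<times> real)"
definition "hg x = fst (snd (snd (snd x)))" for x :: "real \<times> (real \<times> real \<times> real \<times> real \<times> real)"
definition "hK x = fst (snd (snd (snd (snd x))))" for x :: "real \<times> (real \<times> real \<times> real \<times> real \<times> real)"
definition "hn x = snd (snd (snd (snd (snd x))))" for x :: "real \<times> (real \<times> real \<times> real \<times> real \<times> real)"

text \<open>Elimination: the equations \<open>f2\<close>, \<open>f1\<close>, \<open>x3\<close>,
  \<open>x1\<close>, in this order, express these variables explicitly by the five unknowns, with
  the larger root for \<open>f\<^sub>1\<close>. The functions named \<open>v\<close> are the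
  eliminated or unscaled variables; those named \<open>u\<close> are the right sides of the fixed
  point equations made from \<open>g\<close>, \<open>n\<close>, \<open>K\<close>, \<open>t\<close>,
  \<open>\<tau>\<close>.\<close>

definition "vg x = (d (fst x))\<^sup>2 * hg x" for x
definition "vK x = \<kappa> (fst x) * hK x" for x
definition "vn x = \<kappa> (fst x) * hn x" for x
definition "vY x = 2 - \<kappa>y (fst x) * hn x" for x
definition "vt x = d (fst x) * (d (fst x) * (hg x * hT x))" for x
definition "vf2 x = - ((L (fst x))\<^sup>2 + (d (fst x))\<^sup>2)/(2*\<eta>) - vK x" for x
definition "vf1 x = z (fst x) + sqrt ((z (fst x))\<^sup>2 + (L (fst x) - 2 * d (fst x))\<^sup>2 - (vf2 x)\<^sup>2 + 2 * (B (fst x) * vf2 x))" for x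
definition "vx3 x = (((vf1 x)\<^sup>2 + (vf2 x)\<^sup>2 + (d (fst x))\<^sup>2)/2 - (vn x - y (fst x)) * vf2 x)/vf1 x - vg x" for x
definition "vN x = d (fst x) * (d (fst x) * h\<sigma> x)/vY x - (d (fst x))\<^sup>2 + vf2 x * (y (fst x) * vY x - vK x)" for x
definition "vx1 x = vN x/vf1 x - vx3 x - vg x - vt x" for x
definition "vr x = d (fst x) * (d (fst x) * (hT x * (hg x)\<^sup>2))/2" for x
definition "ug x = 1/(vx3 x + sqrt ((vx3 x)\<^sup>2 + (d (fst x))\<^sup>2))" for x
definition "un x = p\<^sub>1 (fst x) * hg x - p\<^sub>2 (fst x) + p\<^sub>3 (fst x) * vx3 x" for x
definition "uK x = - q\<^sub>1 (fst x) - q\<^sub>2 (fst x) * h\<sigma> x / vY x - q\<^sub>3 (fst x) * (hT x * hg x) - q\<^sub>4 (fst x) * vx1 x" for x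
text \<open>Equation \<open>t\<close> divided by \<open>d^2\<close>, with \<open>T\<close> added on
  both sides. The summand \<open>1/2\<close> arises in this way: since \<open>ug * vx1\<close> tends
  to \<open>- 1/2\<close>, the coefficient of the tame \<open>hT\<close> vanishes at the base
  point.\<close>

definition "uT x = - 4 + 2 * ((ug x * vx1 x + 1/2 + vr x) * hT x) + 2 * (\<kappa>y (fst x) * (h\<sigma> x * hK x))/vY x - (dy (fst x) * h\<sigma> x / vY x)\<^sup>2" for x
text \<open>Equation \<open>\<tau>\<close> divided by \<open>d^2\<close>, where equation
  \<open>g\<close> turns \<open>G*x\<^sub>3\<close> into \<open>(1 - d^2*G^2)/2\<close>. The flat
  expressions \<open>uT\<close> and \<open>ug\<close> stand for the merely tame unknowns
  \<open>T\<close> and \<open>G\<close>, with which they agree at a fixed point.\<close>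

definition "u\<sigma> x = 2 + uT x/2 + ug x * vx1 x + vr x" for x

lemma flat_params:
  "flat u\<^sub>0 (L 0) (\<lambda>x. L (fst x))" "flat u\<^sub>0 (y 0) (\<lambda>x. y (fst x))" "flat u\<^sub>0 (z 0) (\<lambda>x. z (fst x))"
  "flat u\<^sub>0 (B 0) (\<lambda>x. B (fst x))" "flat u\<^sub>0 0 (\<lambda>x. d (fst x))" "flat u\<^sub>0 0 (\<lambda>x. \<kappa> (fst x))"
  "flat u\<^sub>0 0 (\<lambda>x. p\<^sub>1 (fst x))" "flat u\<^sub>0 (p\<^sub>2 0) (\<lambda>x. p\<^sub>2 (fst x))" "flat u\<^sub>0 (p\<^sub>3 0) (\<lambda>x. p\<^sub>3 (fst x))"
  "flat u\<^sub>0 (q\<^sub>1 0) (\<lambda>x. q\<^sub>1 (fst x))" "flat u\<^sub>0 0 (\<lambda>x. q\<^sub>2 (fst x))" "flat u\<^sub>0 0 (\<lambda>x. q\<^sub>3 (fst x))"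
  "flat u\<^sub>0 (q\<^sub>4 0) (\<lambda>x. q\<^sub>4 (fst x))" "flat u\<^sub>0 0 (\<lambda>x. \<kappa>y (fst x))" "flat u\<^sub>0 0 (\<lambda>x. dy (fst x))"
  by (fact flat_param[OF cont(1) pos(3) refl]
      flat_param[OF cont(2) pos(3) refl]
      flat_param[OF cont(3) pos(3) refl]
      flat_param[OF cont(4) pos(3) refl]
      flat_param[OF cont(7) pos(3) zero(1)]
      flat_param[OF cont(8) pos(3) zero(2)]
      flat_param[OF cont(9) pos(3) zero(3)]
      flat_param[OF cont(10) pos(3) refl]
      flat_param[OF cont(11) pos(3) refl]
      flat_param[OF cont(12) pos(3) refl]
      flat_param[OF cont(13) pos(3) zero(4)]
      flat_param[OF cont(14) pos(3) zero(5)]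
      flat_param[OF cont(15) pos(3) refl]
      flat_param[OF cont(16) pos(3) zero(6)]
      flat_param[OF cont(17) pos(3) zero(7)])+

lemma tame_eqI: "tame u v F \<Longrightarrow> v = w \<Longrightarrow> (\<And>x. F x = G x) \<Longrightarrow> tame u w G"
  by (subst (asm) ext[of F G]) simp_all

lemma tame_coordinates:
  "tame u\<^sub>0 (-4) hT" "tame u\<^sub>0 (-1/2) h\<sigma>" "tame u\<^sub>0 (1/(2*X)) hg" "tame u\<^sub>0 K\<^sub>0 hK" "tame u\<^sub>0 n\<^sub>0 hn"
proof -
  note le = order_trans[OF dist_fst_le] order_trans[OF dist_snd_le] order_refl
  show "tame u\<^sub>0 (-4) hT"
    by (rule tame_eqI[OF tame_coordinate[of "fst" u\<^sub>0]]) ((rule le)+, simp_all add: hT_def u\<^sub>0_def)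
  show "tame u\<^sub>0 (-1/2) h\<sigma>"
    by (rule tame_eqI[OF tame_coordinate[of "\<lambda>u. fst (snd u)" u\<^sub>0]]) ((rule le)+, simp_all add: h\<sigma>_def u\<^sub>0_def)
  show "tame u\<^sub>0 (1/(2*X)) hg"
    by (rule tame_eqI[OF tame_coordinate[of "\<lambda>u. fst (snd (snd u))" u\<^sub>0]]) ((rule le)+, simp_all add: hg_def u\<^sub>0_def)
  show "tame u\<^sub>0 (K\<^sub>0) hK"
    by (rule tame_eqI[OF tame_coordinate[of "\<lambda>u. fst (snd (snd (snd u)))" u\<^sub>0]]) ((rule le)+, simp_all add: hK_def u\<^sub>0_def)
  show "tame u\<^sub>0 (n\<^sub>0) hn"
    by (rule tame_eqI[OF tame_coordinate[of "\<lambda>u. snd (snd (snd (snd u)))" u\<^sub>0]]) ((rule le)+, simp_all add: hn_def u\<^sub>0_def)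
qed

lemmas tame_products = tame_mult[OF tame_coordinates(3) tame_coordinates(1)] tame_mult[OF tame_coordinates(1) tame_coordinates(3)]
  tame_mult[OF tame_coordinates(1) tame_power[OF tame_coordinates(3), of 2]] tame_mult[OF tame_coordinates(2,4)]

lemma flat_value: "flat u v F \<Longrightarrow> v = w \<Longrightarrow> flat u w F" by simp

lemma flat_vg: "flat u\<^sub>0 0 vg"
  unfolding vg_def[abs_def]
  by (rule flat_mult_tame[OF flat_value[OF flat_power] tame_coordinates(3)], rule flat_params) simp
lemma flat_vK: "flat u\<^sub>0 0 vK" unfolding vK_def[abs_def] by (rule flat_mult_tame flat_params tame_coordinates)+
lemma flat_vn: "flat u\<^sub>0 0 vn" unfolding vn_def[abs_def] by (rule flat_mult_tame flat_params tame_coordinates)+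
lemma flat_vY: "flat u\<^sub>0 2 vY" unfolding vY_def[abs_def]
  by (rule flat_value[OF flat_diff[OF flat_const flat_mult_tame[OF _ tame_coordinates(5)]]], rule flat_params) simp
lemma flat_dh: "flat u\<^sub>0 0 (\<lambda>x. d (fst x) * h\<sigma> x)" "flat u\<^sub>0 0 (\<lambda>x. dy (fst x) * h\<sigma> x)" "flat u\<^sub>0 0 (\<lambda>x. q\<^sub>2 (fst x) * h\<sigma> x)"
  "flat u\<^sub>0 0 (\<lambda>x. d (fst x) * (hg x * hT x))" "flat u\<^sub>0 0 (\<lambda>x. d (fst x) * (hT x * (hg x)\<^sup>2))"
  "flat u\<^sub>0 0 (\<lambda>x. \<kappa>y (fst x) * (h\<sigma> x * hK x))" "flat u\<^sub>0 0 (\<lambda>x. q\<^sub>3 (fst x) * (hT x * hg x))"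
  "flat u\<^sub>0 0 (\<lambda>x. p\<^sub>1 (fst x) * hg x)"
  by (rule flat_mult_tame; (rule flat_params tame_coordinates tame_products))+
lemma flat_vt: "flat u\<^sub>0 0 vt" unfolding vt_def[abs_def]
  by (rule flat_value[OF flat_mult], rule flat_params, rule flat_dh) simp
lemma flat_vr: "flat u\<^sub>0 0 vr" unfolding vr_def[abs_def]
  by (rule flat_value[OF flat_divide[OF flat_mult flat_const]], rule flat_params, rule flat_dh) simp_all
lemma flat_vf2: "flat u\<^sub>0 \<phi>\<^sub>2 vf2" unfolding vf2_def[abs_def]
  by (insert pos, rule flat_value, (rule flat_diff flat_divide flat_uminus flat_add flat_power flat_params flat_const flat_vK | simp add: \<phi>\<^sub>2_def)+)
lemma flat_vf1: "flat u\<^sub>0 \<phi>\<^sub>1 vf1" unfolding vf1_def[abs_def]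
  by (insert phi, rule flat_value, (rule flat_add flat_sqrt flat_diff flat_mult flat_power flat_params flat_const flat_vf2 | simp add: \<phi>\<^sub>1_def)+)
lemma flat_vx3: "flat u\<^sub>0 X vx3" unfolding vx3_def[abs_def]
  by (insert phi(2), rule flat_value, (rule flat_diff flat_divide flat_add flat_mult flat_power flat_params flat_const flat_vf2 flat_vf1 flat_vn flat_vg | (simp; fail))+) (use phi(3,4) in auto)
lemma flat_vN: "flat u\<^sub>0 0 vN" unfolding vN_def[abs_def]
  by (insert phi(2), rule flat_value, (rule flat_add flat_diff flat_divide flat_dh flat_mult flat_power flat_params flat_const flat_vf2 flat_vY flat_vK | (simp; fail))+) (use phi(3,4) in auto)
lemma flat_vx1: "flat u\<^sub>0 (- X) vx1" unfolding vx1_def[abs_def]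
  by (insert phi, rule flat_value, (rule flat_add flat_diff flat_divide flat_vN flat_vf1 flat_vx3 flat_vg flat_vt | simp)+)
lemma flat_ug: "flat u\<^sub>0 (1/(2*X)) ug" unfolding ug_def[abs_def]
  by (insert pos(2), rule flat_value, (rule flat_divide flat_const flat_add flat_sqrt flat_power flat_vx3 flat_params | simp)+)
lemma flat_un: "flat u\<^sub>0 n\<^sub>0 un" unfolding un_def[abs_def]
  by (rule flat_value, (rule flat_add flat_diff flat_dh flat_params flat_mult flat_vx3 | simp add: n\<^sub>0_def)+)
lemma flat_uK: "flat u\<^sub>0 K\<^sub>0 uK" unfolding uK_def[abs_def]
  by (rule flat_value, (rule flat_diff flat_divide flat_uminus flat_dh flat_params flat_vY flat_mult flat_vx1 | simp add: K\<^sub>0_def)+)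
lemma flat_uT: "flat u\<^sub>0 (- 4) uT"
proof -
  have \<nu>: "flat u\<^sub>0 0 (\<lambda>x. ug x * vx1 x + 1/2 + vr x)"
    by (insert pos(2), rule flat_value, (rule flat_add flat_mult flat_ug flat_vx1 flat_const flat_vr | simp)+)
  show ?thesis unfolding uT_def[abs_def]
    by (rule flat_value, (rule flat_diff flat_add flat_divide flat_mult_tame[OF \<nu> tame_coordinates(1)] flat_dh flat_power flat_const flat_mult flat_vY | simp)+)
qed
lemma flat_u\<sigma>: "flat u\<^sub>0 (- 1/2) u\<sigma>" unfolding u\<sigma>_def[abs_def]
  by (insert pos(2), rule flat_value, (rule flat_add flat_divide flat_mult flat_uT flat_ug flat_vx1 flat_vr flat_const | simp)+)

end

text \<open>The equations are asserted for positive \<open>e\<close> only, as the coefficients are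
  quotients there; at 0 they are replaced by the limit values.\<close>

locale tent_solution = tent_family +
  fixes q :: real and T \<sigma> G Kh nh f\<^sub>1 f\<^sub>2 x\<^sub>1 x\<^sub>3 :: "real \<Rightarrow> real"
  assumes q: "0 < q" "q \<le> r\<^sub>0"
    and cont_sol: "continuous_on {0..q} T" "continuous_on {0..q} \<sigma>" "continuous_on {0..q} G" "continuous_on {0..q} Kh"
    "continuous_on {0..q} nh" "continuous_on {0..q} f\<^sub>1" "continuous_on {0..q} f\<^sub>2"
    "continuous_on {0..q} x\<^sub>1" "continuous_on {0..q} x\<^sub>3"
    and init: "Kh 0 = K\<^sub>0" "nh 0 = n\<^sub>0" "f\<^sub>1 0 = \<phi>\<^sub>1" "f\<^sub>2 0 = \<phi>\<^sub>2" "x\<^sub>1 0 = - X" "x\<^sub>3 0 = X"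
    and sol_pos: "\<And>e. e \<in> {0..q} \<Longrightarrow> f\<^sub>1 e > 0 \<and> x\<^sub>3 e > 0 \<and> G e > 0 \<and> 2 - \<kappa>y e * nh e > 0"
    and f2_eq: "\<And>e. 0 < e \<Longrightarrow> e \<le> q \<Longrightarrow> f\<^sub>2 e = - ((L e)\<^sup>2 + (d e)\<^sup>2)/(2*\<eta>) - \<kappa> e * Kh e"
    and equations: "\<And>e. 0 < e \<Longrightarrow> e \<le> q \<Longrightarrow> pup_equations \<eta> (L e) (d e) (y e) (b e) (B e) (z e) (c e) ((d e)\<^sup>2 * G e)
       (\<kappa> e * nh e) (x\<^sub>1 e) (x\<^sub>3 e) ((d e)\<^sup>2 * (G e * T e)) ((d e)\<^sup>2 * \<sigma> e / (y e * (2 - \<kappa>y e * nh e)))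
       (\<kappa> e * Kh e) (f\<^sub>1 e) (f\<^sub>2 e)"

text \<open>The fixed point of the five flat functions is multiplied back to the original equations.
  The interval is shrunk until the radicand of \<open>f\<^sub>1\<close> and all denominators are
  positive, which makes the rescaling reversible.\<close>

lemma (in tent_family) solution:
  obtains q T \<sigma> G Kh nh f\<^sub>1 f\<^sub>2 x\<^sub>1 x\<^sub>3 where
    "tent_solution \<eta> X r\<^sub>0 L y z B c b d \<kappa> p\<^sub>1 p\<^sub>2 p\<^sub>3 q\<^sub>1 q\<^sub>2 q\<^sub>3 q\<^sub>4 \<kappa>y dy dd q T \<sigma> G Kh nh f\<^sub>1 f\<^sub>2 x\<^sub>1 x\<^sub>3"
proof -
  obtain q g1 g2 g3 g4 g5 where q: "q > 0"
    "continuous_on {0..q} g1" "continuous_on {0..q} g2" "continuous_on {0..q} g3"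
    "continuous_on {0..q} g4" "continuous_on {0..q} g5"
    "g1 0 = -4" "g2 0 = -1/2" "g3 0 = 1/(2*X)" "g4 0 = K\<^sub>0" "g5 0 = n\<^sub>0"
    "\<And>e. e \<in> {0..q} \<Longrightarrow> uT (e, (g1 e, g2 e, g3 e, g4 e, g5 e)) = g1 e"
    "\<And>e. e \<in> {0..q} \<Longrightarrow> u\<sigma> (e, (g1 e, g2 e, g3 e, g4 e, g5 e)) = g2 e"
    "\<And>e. e \<in> {0..q} \<Longrightarrow> ug (e, (g1 e, g2 e, g3 e, g4 e, g5 e)) = g3 e"
    "\<And>e. e \<in> {0..q} \<Longrightarrow> uK (e, (g1 e, g2 e, g3 e, g4 e, g5 e)) = g4 e"
    "\<And>e. e \<in> {0..q} \<Longrightarrow> un (e, (g1 e, g2 e, g3 e, g4 e, g5 e)) = g5 e"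
    by (rule flat_system_solution[OF flat_uT[unfolded u\<^sub>0_def] flat_u\<sigma>[unfolded u\<^sub>0_def]
        flat_ug[unfolded u\<^sub>0_def] flat_uK[unfolded u\<^sub>0_def] flat_un[unfolded u\<^sub>0_def]]) blast
  define g where "g = (\<lambda>e. (g1 e, g2 e, g3 e, g4 e, g5 e))"
  define E where "E = (\<lambda>e. (e, g e))"
  have g: "continuous_on {0..q} g" "g 0 = u\<^sub>0"
    unfolding g_def u\<^sub>0_def using q by (auto intro!: continuous_intros)
  have comps: "fst (E e) = e" "hT (E e) = g1 e" "h\<sigma> (E e) = g2 e" "hg (E e) = g3 e" "hK (E e) = g4 e" "hn (E e) = g5 e" for e
    by (simp_all add: E_def g_def hT_def h\<sigma>_def hg_def hK_def hn_def)
  \<comment> \<open>The radicand in \<open>vf1\<close>; its positivity is what allows squaring the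
    root to recover equation \<open>f1\<close>.\<close>
  define R where "R x = (z (fst x))\<^sup>2 + (L (fst x) - 2 * d (fst x))\<^sup>2 - (vf2 x)\<^sup>2 + 2 * (B (fst x) * vf2 x)" for x
  have R: "flat u\<^sub>0 ((z 0)\<^sup>2 + (L 0)\<^sup>2 - \<phi>\<^sub>2\<^sup>2 + 2 * B 0 * \<phi>\<^sub>2) R"
    unfolding R_def[abs_def] by (rule flat_value, (rule flat_add flat_diff flat_mult flat_power flat_params flat_const flat_vf2 | simp)+)
  have along: "\<exists>s>0. s \<le> q \<and> continuous_on {0..s} (\<lambda>e. F (E e))" if "flat u\<^sub>0 v F" for F v
    using flat_along[OF that g q(1)] unfolding E_def by metis
  have along_pos: "\<exists>s>0. s \<le> q \<and> (\<forall>e\<in>{0..s}. F (E e) > 0)" if F: "flat u\<^sub>0 v F" and "v > 0" for F v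
  proof -
    obtain s where s: "s > 0" "s \<le> q" "continuous_on {0..s} (\<lambda>e. F (E e))" using along[OF F] by blast
    have "F (E 0) > 0" using that g(2) unfolding E_def flat_def by simp
    then show ?thesis using positive_near_0[OF s(3) _ s(1)] s(2) by (metis order_trans)
  qed
  obtain s1 where s1: "s1 > 0" "s1 \<le> q" "continuous_on {0..s1} (\<lambda>e. vf1 (E e))" using along[OF flat_vf1] by blast
  obtain s2 where s2: "s2 > 0" "s2 \<le> q" "continuous_on {0..s2} (\<lambda>e. vf2 (E e))" using along[OF flat_vf2] by blast
  obtain s3 where s3: "s3 > 0" "s3 \<le> q" "continuous_on {0..s3} (\<lambda>e. vx1 (E e))" using along[OF flat_vx1] by blast
  obtain s4 where s4: "s4 > 0" "s4 \<le> q" "continuous_on {0..s4} (\<lambda>e. vx3 (E e))" using along[OF flat_vx3] by blast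
  obtain s5 where s5: "s5 > 0" "s5 \<le> q" "\<And>e. e\<in>{0..s5} \<Longrightarrow> R (E e) > 0" using along_pos[OF R] phi(1) by blast
  obtain s6 where s6: "s6 > 0" "s6 \<le> q" "\<And>e. e\<in>{0..s6} \<Longrightarrow> vx3 (E e) > 0" using along_pos[OF flat_vx3 pos(2)] by blast
  obtain s7 where s7: "s7 > 0" "s7 \<le> q" "\<And>e. e\<in>{0..s7} \<Longrightarrow> vY (E e) > 0" using along_pos[OF flat_vY] by auto
  obtain s8 where s8: "s8 > 0" "s8 \<le> q" "\<And>e. e\<in>{0..s8} \<Longrightarrow> vf1 (E e) > 0" using along_pos[OF flat_vf1 phi(2)] by blast
  define s where "s = min (min (min (min r\<^sub>0 s1) (min s2 s3)) (min (min s4 s5) (min s6 s7))) s8"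
  have s: "s > 0" "s \<le> r\<^sub>0" "s \<le> s1" "s \<le> s2" "s \<le> s3" "s \<le> s4" "s \<le> s5" "s \<le> s6" "s \<le> s7" "s \<le> s8"
    using pos(3) s1(1) s2(1) s3(1) s4(1) s5(1) s6(1) s7(1) s8(1) unfolding s_def by (simp_all add: min_le_iff_disj)
  have sq: "s \<le> q" using s(3) s1(2) by simp
  have E0: "E 0 = (0, u\<^sub>0)" using g(2) by (simp add: E_def)
  show ?thesis
  proof (rule that[of s g1 g2 g3 g4 g5 "\<lambda>e. vf1 (E e)" "\<lambda>e. vf2 (E e)" "\<lambda>e. vx1 (E e)" "\<lambda>e. vx3 (E e)"],
      rule tent_solution.intro[OF tent_family_axioms], rule tent_solution_axioms.intro)
    show "s > 0" "s \<le> r\<^sub>0" by (fact s)+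
    show "continuous_on {0..s} g1" "continuous_on {0..s} g2" "continuous_on {0..s} g3"
      "continuous_on {0..s} g4" "continuous_on {0..s} g5"
      using sq by (auto intro: continuous_on_subset[OF q(2)] continuous_on_subset[OF q(3)] continuous_on_subset[OF q(4)]
        continuous_on_subset[OF q(5)] continuous_on_subset[OF q(6)])
    show "continuous_on {0..s} (\<lambda>e. vf1 (E e))" using s(3) by (auto intro: continuous_on_subset[OF s1(3)])
    show "continuous_on {0..s} (\<lambda>e. vf2 (E e))" using s(4) by (auto intro: continuous_on_subset[OF s2(3)])
    show "continuous_on {0..s} (\<lambda>e. vx1 (E e))" using s(5) by (auto intro: continuous_on_subset[OF s3(3)])
    show "continuous_on {0..s} (\<lambda>e. vx3 (E e))" using s(6) by (auto intro: continuous_on_subset[OF s4(3)])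
    show "g4 0 = K\<^sub>0" "g5 0 = n\<^sub>0" by (fact q)+
    show "vf1 (E 0) = \<phi>\<^sub>1" "vf2 (E 0) = \<phi>\<^sub>2" "vx1 (E 0) = - X" "vx3 (E 0) = X"
      using flat_vf1 flat_vf2 flat_vx1 flat_vx3 unfolding E0 flat_def by blast+
    have fixg: "g3 e = 1 / (vx3 (E e) + sqrt ((vx3 (E e))\<^sup>2 + (d e)\<^sup>2))" if "e \<in> {0..s}" for e
      using q(14)[of e] that sq ug_def[of "E e"] unfolding comps by (simp add: E_def g_def)
    show posn: "vf1 (E e) > 0 \<and> vx3 (E e) > 0 \<and> g3 e > 0 \<and> 2 - \<kappa>y e * g5 e > 0" if e: "e \<in> {0..s}" for e
    proof -
      have "vx3 (E e) > 0" using e s s6(3)[of e] by auto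
      then have "g3 e > 0" using fixg[OF e] by (simp add: add_pos_nonneg)
      then show ?thesis using e s s6(3)[of e] s7(3)[of e] s8(3)[of e] vY_def[of "E e"] unfolding comps by auto
    qed
    fix e assume e: "0 < e" "e \<le> s"
    show f2: "vf2 (E e) = - ((L e)\<^sup>2 + (d e)\<^sup>2)/(2*\<eta>) - \<kappa> e * g4 e"
      using vf2_def[of "E e"] vK_def[of "E e"] unfolding comps by simp
    have e': "e \<in> {0..s}" "e \<in> {0..q}" "e \<le> r\<^sub>0" using e sq s(2) by auto
    have P: "vf1 (E e) > 0" "vx3 (E e) > 0" "g3 e > 0" "2 - \<kappa>y e * g5 e > 0" using posn[OF e'(1)] by auto
    have pp: "L e > 0" "y e > 0" "z e > 0" "d e > 0" "\<kappa> e > 0" "\<eta> + b e - B e > 0" "\<eta> + B e - b e > 0"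
      using params_pos[OF e(1) e'(3)] by auto
    note eq = eqs[OF e(1) e'(3)]
    note qu = quot[OF e(1) e'(3)]
    define x1 x3 f1 f2 where "x1 = vx1 (E e)" and "x3 = vx3 (E e)" and "f1 = vf1 (E e)" and "f2 = vf2 (E e)"
    have Kh: "g4 e = - q\<^sub>1 e - q\<^sub>2 e * g2 e / (2 - \<kappa>y e * g5 e) - q\<^sub>3 e * (g1 e * g3 e) - q\<^sub>4 e * x1"
      using q(15)[OF e'(2)] uK_def[of "E e"] vY_def[of "E e"] unfolding comps x1_def by (simp add: E_def g_def)
    have nh: "g5 e = p\<^sub>1 e * g3 e - p\<^sub>2 e + p\<^sub>3 e * x3"
      using q(16)[OF e'(2)] un_def[of "E e"] unfolding comps x3_def by (simp add: E_def g_def)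
    have Teq: "g1 e = - 4 + 2 * ((g3 e * x1 + 1/2 + vr (E e)) * g1 e) + 2 * (\<kappa>y e * (g2 e * g4 e))/(2 - \<kappa>y e * g5 e) - (dy e * g2 e / (2 - \<kappa>y e * g5 e))\<^sup>2"
      using q(12,14)[OF e'(2)] uT_def[of "E e"] vY_def[of "E e"] unfolding comps x1_def by (simp add: E_def g_def)
    have \<sigma>eq: "g2 e = 2 + g1 e/2 + g3 e * x1 + vr (E e)"
      using q(12,13,14)[OF e'(2)] u\<sigma>_def[of "E e"] unfolding comps x1_def by (simp add: E_def g_def)
    have vr: "vr (E e) = (d e)\<^sup>2 * (g1 e * (g3 e)\<^sup>2)/2"
      using vr_def[of "E e"] unfolding comps by (simp add: power2_eq_square)
    have f1: "f1 = z e + sqrt (R (E e))" unfolding f1_def R_def vf1_def comps by simp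
    have R: "R (E e) = (z e)\<^sup>2 + (L e - 2 * d e)\<^sup>2 - f2\<^sup>2 + 2 * (B e * f2)" unfolding f2_def R_def comps by simp
    have R0: "R (E e) > 0" using s5(3)[of e] e s by simp
    have x3: "x3 = ((f1\<^sup>2 + f2\<^sup>2 + (d e)\<^sup>2)/2 - (\<kappa> e * g5 e - y e) * f2)/f1 - (d e)\<^sup>2 * g3 e"
      using vx3_def[of "E e"] vn_def[of "E e"] vg_def[of "E e"] unfolding comps x3_def f1_def f2_def by simp
    define N where "N = (d e)\<^sup>2 * g2 e/(2 - \<kappa>y e * g5 e) - (d e)\<^sup>2 + f2 * (y e * (2 - \<kappa>y e * g5 e) - \<kappa> e * g4 e)"
    have N: "vN (E e) = N" unfolding N_def vN_def vY_def vK_def comps f2_def by (simp add: power2_eq_square)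
    have x1: "x1 = N/f1 - x3 - (d e)\<^sup>2 * g3 e - (d e)\<^sup>2 * (g3 e * g1 e)"
      unfolding x1_def vx1_def N x3_def f1_def vg_def vt_def comps by (simp add: power2_eq_square)
    have ky: "\<kappa> e = \<kappa>y e * y e" "d e = dy e * y e" using qu pp by auto
    \<comment> \<open>The fixed point form \<open>1/(x3 + S)\<close> is the rationalized positive
      root \<open>S - x3\<close> of the quadratic equation for \<open>g\<close>, divided by
      \<open>d^2\<close>.\<close>
    have gg: "(d e)\<^sup>2 = 2*((d e)\<^sup>2 * g3 e)*x3 + ((d e)\<^sup>2 * g3 e)\<^sup>2"
    proof -
      define S where "S = sqrt (x3\<^sup>2 + (d e)\<^sup>2)"
      have S2: "S * S = x3\<^sup>2 + (d e)\<^sup>2" unfolding S_def by simp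
      have S: "x3 + S > 0" using P(2) by (simp add: S_def x3_def add_pos_nonneg)
      have "g3 e = 1/(x3 + S)" using fixg[OF e'(1)] by (simp add: S_def x3_def)
      moreover have "(d e)\<^sup>2 = (S - x3) * (S + x3)" using S2 by (simp add: algebra_simps power2_eq_square)
      ultimately have w: "(d e)\<^sup>2 * g3 e = S - x3" using S by (simp add: add.commute)
      show ?thesis unfolding w using S2 by (simp add: algebra_simps power2_eq_square)
    qed
    then have gg': "1 = 2 * g3 e * x3 + (d e)\<^sup>2 * (g3 e)\<^sup>2"
    proof -
      have "(d e)\<^sup>2 * 1 = (d e)\<^sup>2 * (2 * g3 e * x3 + (d e)\<^sup>2 * (g3 e)\<^sup>2)" using gg by algebra
      then show ?thesis using pp(4) by (metis mult_left_cancel zero_less_power less_irrefl)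
    qed
    define Y where "Y = 2 - \<kappa>y e * g5 e"
    have Y: "Y > 0" using P(4) by (simp add: Y_def)
    have yY: "2 * y e - \<kappa> e * g5 e = y e * Y" using ky by (simp add: Y_def algebra_simps)
    define \<tau> where "\<tau> = (d e)\<^sup>2 * g2 e / (y e * Y)"
    have \<tau>: "y e * \<tau> = (d e)\<^sup>2 * g2 e / Y" "y e * Y * \<tau> = (d e)\<^sup>2 * g2 e" using pp Y by (simp_all add: \<tau>_def)
    show "pup_equations \<eta> (L e) (d e) (y e) (b e) (B e) (z e) (c e) ((d e)\<^sup>2 * g3 e)
       (\<kappa> e * g5 e) (vx1 (E e)) (vx3 (E e)) ((d e)\<^sup>2 * (g3 e * g1 e)) ((d e)\<^sup>2 * g2 e / (y e * (2 - \<kappa>y e * g5 e)))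
       (\<kappa> e * g4 e) (vf1 (E e)) (vf2 (E e))"
      unfolding x1_def[symmetric] x3_def[symmetric] f1_def[symmetric] f2_def[symmetric] Y_def[symmetric] \<tau>_def[symmetric]
    proof
      show "(L e)\<^sup>2 = \<eta>\<^sup>2 - 2 * \<eta> * y e" "(z e)\<^sup>2 + (B e)\<^sup>2 = (c e)\<^sup>2 + (b e)\<^sup>2" "(\<eta> - y e) * B e = - (y e * b e)"
        using eq by auto
      show "(d e)\<^sup>2 = 2 * ((d e)\<^sup>2 * g3 e) * x3 + ((d e)\<^sup>2 * g3 e)\<^sup>2" by (fact gg)
      show "(\<eta> + b e - B e) * (\<kappa> e * g5 e) = z e * ((d e)\<^sup>2 * g3 e) - L e * d e + (z e - c e) * x3"
      proof -
        let ?D = "\<kappa> e * (\<eta> + b e - B e)"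
        have D: "?D > 0" using pp by simp
        have "?D * p\<^sub>1 e = z e * (d e)\<^sup>2" "?D * p\<^sub>2 e = L e * d e" "?D * p\<^sub>3 e = z e - c e"
          using qu D by auto
        moreover have "(\<eta> + b e - B e) * (\<kappa> e * g5 e) = (?D * p\<^sub>1 e) * g3 e - ?D * p\<^sub>2 e + (?D * p\<^sub>3 e) * x3"
          unfolding nh by (simp add: algebra_simps)
        ultimately show ?thesis by simp
      qed
      show "(\<eta> + B e - b e) * (\<kappa> e * g4 e) = - 2 * L e * d e - (b e - y e) * \<tau> - z e * ((d e)\<^sup>2 * (g3 e * g1 e)) - (z e - c e) * x1"
      proof -
        let ?D = "\<kappa> e * (\<eta> + B e - b e)"
        have D: "?D > 0" using pp by simp
        have dq: "?D * q\<^sub>1 e = 2 * L e * d e" "?D * q\<^sub>2 e = (b e - y e) * (d e)\<^sup>2 / y e"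
          "?D * q\<^sub>3 e = z e * (d e)\<^sup>2" "?D * q\<^sub>4 e = z e - c e"
          using qu D pp by auto
        have "(\<eta> + B e - b e) * (\<kappa> e * g4 e) = - (?D * q\<^sub>1 e) - (?D * q\<^sub>2 e) * g2 e / Y - (?D * q\<^sub>3 e) * (g1 e * g3 e) - (?D * q\<^sub>4 e) * x1"
          using Y unfolding Kh Y_def[symmetric] by (simp add: algebra_simps)
        moreover have "(b e - y e) * \<tau> = (b e - y e) * (d e)\<^sup>2 / y e * g2 e / Y" by (simp add: \<tau>_def)
        ultimately show ?thesis unfolding dq by (simp add: algebra_simps)
      qed
      show "(d e)\<^sup>2 + (L e)\<^sup>2 + 2 * \<eta> * f2 + 2 * \<eta> * (\<kappa> e * g4 e) = 0"
        using f2 pos(1) unfolding f2_def[symmetric] by (simp add: field_simps)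
      show "(L e - 2 * d e)\<^sup>2 = f1\<^sup>2 + f2\<^sup>2 - 2 * (z e * f1 + B e * f2)"
      proof -
        have "(f1 - z e)\<^sup>2 = R (E e)" using f1 R0 by simp
        then show ?thesis unfolding R by (simp add: algebra_simps power2_eq_square)
      qed
      show "(x3 + (d e)\<^sup>2 * g3 e) * f1 + (\<kappa> e * g5 e - y e) * f2 = (f1\<^sup>2 + f2\<^sup>2 + (d e)\<^sup>2) / 2"
        using x3 P(1) unfolding f1_def[symmetric] by (simp add: field_simps)
      show "(x1 + x3 + (d e)\<^sup>2 * g3 e + (d e)\<^sup>2 * (g3 e * g1 e)) * f1 = y e * \<tau> - (d e)\<^sup>2 + f2 * (2 * y e - \<kappa> e * g5 e - \<kappa> e * g4 e)"
        using x1 P(1) \<tau>(1) unfolding yY f1_def[symmetric] N_def Y_def[symmetric] by simp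
      show "(d e)\<^sup>2 * g3 e * x1 + (d e)\<^sup>2 * (g3 e * g1 e) * x3 + (d e)\<^sup>2 * g3 e * ((d e)\<^sup>2 * (g3 e * g1 e)) + 2 * (d e)\<^sup>2 = (2 * y e - \<kappa> e * g5 e) * \<tau>"
      proof -
        have "g2 e = g3 e * x1 + g1 e * (g3 e * x3) + (d e)\<^sup>2 * (g3 e)\<^sup>2 * g1 e + 2"
          using \<sigma>eq vr gg' by algebra
        then have "(d e)\<^sup>2 * g2 e = (d e)\<^sup>2 * (g3 e * x1 + g1 e * (g3 e * x3) + (d e)\<^sup>2 * (g3 e)\<^sup>2 * g1 e + 2)" by simp
        then show ?thesis unfolding yY \<tau>(2) by (simp add: algebra_simps power2_eq_square)
      qed
      show "4 * (d e)\<^sup>2 - 2 * (\<kappa> e * g4 e) * \<tau> + \<tau>\<^sup>2 = 2 * x1 * ((d e)\<^sup>2 * (g3 e * g1 e)) + ((d e)\<^sup>2 * (g3 e * g1 e))\<^sup>2"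
      proof -
        have a: "2 * (\<kappa> e * g4 e) * \<tau> = (d e)\<^sup>2 * (2 * (\<kappa>y e * (g2 e * g4 e))/Y)"
          using pp Y unfolding \<tau>_def by (subst ky(1)) (simp add: field_simps)
        have b: "\<tau>\<^sup>2 = (d e)\<^sup>2 * (dy e * g2 e / Y)\<^sup>2"
        proof -
          have "\<tau> = d e * (dy e * g2 e / Y)" using pp Y unfolding \<tau>_def by (subst ky(2)) (simp add: ky(2)[symmetric] field_simps power2_eq_square)
          then show ?thesis by (simp only: power_mult_distrib)
        qed
        have "4 - 2 * (\<kappa>y e * (g2 e * g4 e))/Y + (dy e * g2 e / Y)\<^sup>2 = 2 * x1 * (g3 e * g1 e) + (d e)\<^sup>2 * (g3 e * g1 e)\<^sup>2"
          using Teq unfolding vr Y_def[symmetric] by (simp add: algebra_simps power2_eq_square)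
        then have "(d e)\<^sup>2 * (4 - 2 * (\<kappa>y e * (g2 e * g4 e))/Y + (dy e * g2 e / Y)\<^sup>2) = (d e)\<^sup>2 * (2 * x1 * (g3 e * g1 e) + (d e)\<^sup>2 * (g3 e * g1 e)\<^sup>2)" by simp
        then show ?thesis unfolding a b by (simp add: algebra_simps power2_eq_square)
      qed
    qed
  qed
qed

subsection \<open>Signs of the determinants\<close>

text \<open>\<open>lead\<close> followed by four digits is the determinant of the corresponding vertices divided by
  its dominant monomial, one of \<open>h r\<^sub>2 y\<close>, \<open>h y\<close>, \<open>h \<beta> y\<close>, \<open>r\<^sub>3 r\<^sub>2 h y\<close>, after the substitution \<open>b = \<beta> y\<close>,
  \<open>m = m r\<^sub>2 y\<close>, \<open>n = n r\<^sub>2 y\<close>, \<open>d = r\<^sub>3 r\<^sub>2 h\<close>, \<open>c r\<^sub>2 = r\<^sub>4 \<beta>\<close>.\<close>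

definition "lead0123 a x c \<beta> m n r\<^sub>2 r\<^sub>3 r\<^sub>4 = (c*m*r\<^sub>2*r\<^sub>3 - 2*c*r\<^sub>3*r\<^sub>2*n + \<beta>*a*r\<^sub>3 + 2*\<beta>*r\<^sub>3*x - a*n - m*x + a*r\<^sub>3 - a*r\<^sub>3*r\<^sub>2*n - m*r\<^sub>2*r\<^sub>3*x + 2*r\<^sub>3*x :: real)"
definition "lead0456 a x c \<beta> m n r\<^sub>2 r\<^sub>3 r\<^sub>4 = (c*m*r\<^sub>2*r\<^sub>3 - 2*c*r\<^sub>3*r\<^sub>2*n + \<beta>*a*r\<^sub>3 + 2*\<beta>*r\<^sub>3*x + a*n + m*x - a*r\<^sub>3 + a*r\<^sub>3*r\<^sub>2*n + m*r\<^sub>2*r\<^sub>3*x - 2*r\<^sub>3*x :: real)"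
definition "lead0124 a x c \<beta> m n r\<^sub>2 r\<^sub>3 r\<^sub>4 = (c*m*r\<^sub>2*r\<^sub>2*r\<^sub>3 - 4*c*r\<^sub>3*r\<^sub>2 + 2*c*r\<^sub>3*r\<^sub>2*r\<^sub>2*n + \<beta>*a*r\<^sub>3*r\<^sub>2 - 2*\<beta>*r\<^sub>3*r\<^sub>2*x - 2*a + a*n*r\<^sub>2 + m*r\<^sub>2*x - a*r\<^sub>3*r\<^sub>2 + a*r\<^sub>3*r\<^sub>2*r\<^sub>2*n + m*r\<^sub>2*r\<^sub>2*r\<^sub>3*x - 2*r\<^sub>3*r\<^sub>2*x :: real)"
definition "lead0134 a x c \<beta> m n r\<^sub>2 r\<^sub>3 r\<^sub>4 = (- 2*c*r\<^sub>3*r\<^sub>2 + 2*c*r\<^sub>3*r\<^sub>2*r\<^sub>2*n - 2*\<beta>*r\<^sub>3*r\<^sub>2*x - 2*a + 2*a*n*r\<^sub>2 + 2*m*r\<^sub>2*x - 2*x :: real)"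
definition "lead0136 a x c \<beta> m n r\<^sub>2 r\<^sub>3 r\<^sub>4 = (2*c*m*r\<^sub>2*r\<^sub>2*r\<^sub>3 - 2*c*r\<^sub>3*r\<^sub>2 + 2*\<beta>*a*r\<^sub>3*r\<^sub>2 - 2*a + 2*a*n*r\<^sub>2 + 2*m*r\<^sub>2*x - 2*x + 2*a*r\<^sub>3*r\<^sub>2 - 2*a*r\<^sub>3*r\<^sub>2*r\<^sub>2*n - 2*m*r\<^sub>2*r\<^sub>2*r\<^sub>3*x + 2*r\<^sub>3*r\<^sub>2*x :: real)"
definition "lead0146 a x c \<beta> m n r\<^sub>2 r\<^sub>3 r\<^sub>4 = (2*c*m*r\<^sub>2*r\<^sub>2*r\<^sub>3 - 2*c*r\<^sub>3*r\<^sub>2 + 2*\<beta>*a*r\<^sub>3*r\<^sub>2 + 2*a - 2*a*n*r\<^sub>2 - 2*m*r\<^sub>2*x + 2*x - 2*a*r\<^sub>3*r\<^sub>2 + 2*a*r\<^sub>3*r\<^sub>2*r\<^sub>2*n + 2*m*r\<^sub>2*r\<^sub>2*r\<^sub>3*x - 2*r\<^sub>3*r\<^sub>2*x :: real)"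
definition "lead0156 a x c \<beta> m n r\<^sub>2 r\<^sub>3 r\<^sub>4 = (4*c*m*r\<^sub>2*r\<^sub>2*r\<^sub>3 - 4*c*r\<^sub>3*r\<^sub>2 + 4*\<beta>*a*r\<^sub>3*r\<^sub>2 + 2*a - 2*a*r\<^sub>3*r\<^sub>2 :: real)"
definition "lead0234 a x c \<beta> m n r\<^sub>2 r\<^sub>3 r\<^sub>4 = (2*c*r\<^sub>3*r\<^sub>2 - 2*c*r\<^sub>3*r\<^sub>2*r\<^sub>2*n + 2*\<beta>*r\<^sub>3*r\<^sub>2*x - 2*x :: real)"
definition "lead0235 a x c \<beta> m n r\<^sub>2 r\<^sub>3 r\<^sub>4 = (2*c*r\<^sub>3*r\<^sub>2 - 2*x - 2*r\<^sub>3*r\<^sub>2*x :: real)"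
definition "lead0236 a x c \<beta> m n r\<^sub>2 r\<^sub>3 r\<^sub>4 = (- c*m*r\<^sub>2*r\<^sub>2*r\<^sub>3 + 2*c*r\<^sub>3*r\<^sub>2 - 2*c*r\<^sub>3*r\<^sub>2*r\<^sub>2*n - \<beta>*a*r\<^sub>3*r\<^sub>2 + 2*\<beta>*r\<^sub>3*r\<^sub>2*x + a*n*r\<^sub>2 + m*r\<^sub>2*x - 2*x - a*r\<^sub>3*r\<^sub>2 + a*r\<^sub>3*r\<^sub>2*r\<^sub>2*n + m*r\<^sub>2*r\<^sub>2*r\<^sub>3*x :: real)"
definition "lead0245 a x c \<beta> m n r\<^sub>2 r\<^sub>3 r\<^sub>4 = (2*c*r\<^sub>3*r\<^sub>2 + 2*x + 2*r\<^sub>3*r\<^sub>2*x :: real)"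
definition "lead0256 a x c \<beta> m n r\<^sub>2 r\<^sub>3 r\<^sub>4 = (- 4*c*r\<^sub>3*r\<^sub>2 + 2*a + 2*a*r\<^sub>3*r\<^sub>2 :: real)"
definition "lead0356 a x c \<beta> m n r\<^sub>2 r\<^sub>3 r\<^sub>4 = (c*m*r\<^sub>2*r\<^sub>2*r\<^sub>3 - 4*c*r\<^sub>3*r\<^sub>2 + 2*c*r\<^sub>3*r\<^sub>2*r\<^sub>2*n + \<beta>*a*r\<^sub>3*r\<^sub>2 - 2*\<beta>*r\<^sub>3*r\<^sub>2*x + 2*a - a*n*r\<^sub>2 - m*r\<^sub>2*x + a*r\<^sub>3*r\<^sub>2 - a*r\<^sub>3*r\<^sub>2*r\<^sub>2*n - m*r\<^sub>2*r\<^sub>2*r\<^sub>3*x + 2*r\<^sub>3*r\<^sub>2*x :: real)"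
definition "lead0127 a x c \<beta> m n r\<^sub>2 r\<^sub>3 r\<^sub>4 = (2*m*r\<^sub>4 + 2*m*r\<^sub>2*r\<^sub>3*r\<^sub>4 - 4*r\<^sub>3*r\<^sub>4 + 2*a + 2*a*r\<^sub>3*r\<^sub>2 :: real)"
definition "lead0237 a x c \<beta> m n r\<^sub>2 r\<^sub>3 r\<^sub>4 = (- 2*n*r\<^sub>4 + 2*r\<^sub>3*r\<^sub>4 - 2*r\<^sub>3*r\<^sub>2*n*r\<^sub>4 + 2*x + 2*r\<^sub>3*r\<^sub>2*x :: real)"
definition "lead1234 a x c \<beta> m n r\<^sub>2 r\<^sub>3 r\<^sub>4 = (- 2*a + 2*a*r\<^sub>2*n + 2*m*r\<^sub>2*x - 4*x :: real)"
definition "lead1246 a x c \<beta> m n r\<^sub>2 r\<^sub>3 r\<^sub>4 = (6*a - 4*a*r\<^sub>2*n - 4*m*r\<^sub>2*x + 4*x :: real)"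
definition "lead1346 a x c \<beta> m n r\<^sub>2 r\<^sub>3 r\<^sub>4 = (4*a - 4*a*r\<^sub>2*n - 4*m*r\<^sub>2*x + 4*x :: real)"
definition "lead1245 a x c \<beta> m n r\<^sub>2 r\<^sub>3 r\<^sub>4 = (- 2*a + 4*x :: real)"

text \<open>Nineteen determinants are a positive monomial times their \<open>lead\<close> form. The
  other six have a sign for direct reasons: \<open>d < h\<close>, \<open>n < y\<close> after the
  substitution, and the hypothesis on \<open>c*(y - m) - b*a\<close>.\<close>

lemma tent_signs_lead:
  fixes a x c \<beta> m n r\<^sub>2 r\<^sub>3 r\<^sub>4 h y :: real
  assumes pos: "h > 0" "y > 0" "c > 0" "\<beta> > 0" "r\<^sub>2 > 0" "r\<^sub>3 > 0" "a > 0" "x > 0"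
    and r4: "c*r\<^sub>2 = r\<^sub>4*\<beta>" and small: "r\<^sub>3*r\<^sub>2 < 1" "n*r\<^sub>2 < 1"
    and E: "c*(y - m*r\<^sub>2*y) - \<beta>*y*a > 0"
    and "lead0123 a x c \<beta> m n r\<^sub>2 r\<^sub>3 r\<^sub>4 < 0"
    and "lead0456 a x c \<beta> m n r\<^sub>2 r\<^sub>3 r\<^sub>4 > 0"
    and "lead0124 a x c \<beta> m n r\<^sub>2 r\<^sub>3 r\<^sub>4 < 0"
    and "lead0134 a x c \<beta> m n r\<^sub>2 r\<^sub>3 r\<^sub>4 < 0"
    and "lead0136 a x c \<beta> m n r\<^sub>2 r\<^sub>3 r\<^sub>4 < 0"
    and "lead0146 a x c \<beta> m n r\<^sub>2 r\<^sub>3 r\<^sub>4 > 0"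
    and "lead0156 a x c \<beta> m n r\<^sub>2 r\<^sub>3 r\<^sub>4 > 0"
    and "lead0234 a x c \<beta> m n r\<^sub>2 r\<^sub>3 r\<^sub>4 < 0"
    and "lead0235 a x c \<beta> m n r\<^sub>2 r\<^sub>3 r\<^sub>4 < 0"
    and "lead0236 a x c \<beta> m n r\<^sub>2 r\<^sub>3 r\<^sub>4 < 0"
    and "lead0245 a x c \<beta> m n r\<^sub>2 r\<^sub>3 r\<^sub>4 > 0"
    and "lead0256 a x c \<beta> m n r\<^sub>2 r\<^sub>3 r\<^sub>4 > 0"
    and "lead0356 a x c \<beta> m n r\<^sub>2 r\<^sub>3 r\<^sub>4 > 0"
    and "lead0127 a x c \<beta> m n r\<^sub>2 r\<^sub>3 r\<^sub>4 > 0"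
    and "lead0237 a x c \<beta> m n r\<^sub>2 r\<^sub>3 r\<^sub>4 > 0"
    and "lead1234 a x c \<beta> m n r\<^sub>2 r\<^sub>3 r\<^sub>4 < 0"
    and "lead1246 a x c \<beta> m n r\<^sub>2 r\<^sub>3 r\<^sub>4 > 0"
    and "lead1346 a x c \<beta> m n r\<^sub>2 r\<^sub>3 r\<^sub>4 > 0"
    and "lead1245 a x c \<beta> m n r\<^sub>2 r\<^sub>3 r\<^sub>4 > 0"
  shows "tent_signs c (\<beta>*y) h a (m*r\<^sub>2*y) y (r\<^sub>3*r\<^sub>2*h) x (n*r\<^sub>2*y)"
proof -
  have N: "h*r\<^sub>2*y > 0" "h*y > 0" "h*\<beta>*y > 0" "r\<^sub>3*r\<^sub>2*h*y > 0" using pos by simp_all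
  have mp: "v > 0 \<Longrightarrow> w > 0 \<Longrightarrow> u = v * w \<Longrightarrow> u > 0" and mn: "v > 0 \<Longrightarrow> w < 0 \<Longrightarrow> u = v * w \<Longrightarrow> u < 0" for u v w :: real
    by (simp_all add: mult_pos_neg)
  note lead = assms(13-)
  have D0123: "c*(m*r\<^sub>2*y)*(r\<^sub>3*r\<^sub>2*h) - 2*c*(r\<^sub>3*r\<^sub>2*h)*(n*r\<^sub>2*y) + (\<beta>*y)*a*(r\<^sub>3*r\<^sub>2*h) + 2*(\<beta>*y)*(r\<^sub>3*r\<^sub>2*h)*x - h*a*(n*r\<^sub>2*y) - h*(m*r\<^sub>2*y)*x + a*y*(r\<^sub>3*r\<^sub>2*h) - a*(r\<^sub>3*r\<^sub>2*h)*(n*r\<^sub>2*y) - (m*r\<^sub>2*y)*(r\<^sub>3*r\<^sub>2*h)*x + 2*y*(r\<^sub>3*r\<^sub>2*h)*x < 0"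
    by (rule mn[OF N(1) lead(1)]) ((simp add: lead0123_def algebra_simps))
  have D0456: "c*(m*r\<^sub>2*y)*(r\<^sub>3*r\<^sub>2*h) - 2*c*(r\<^sub>3*r\<^sub>2*h)*(n*r\<^sub>2*y) + (\<beta>*y)*a*(r\<^sub>3*r\<^sub>2*h) + 2*(\<beta>*y)*(r\<^sub>3*r\<^sub>2*h)*x + h*a*(n*r\<^sub>2*y) + h*(m*r\<^sub>2*y)*x - a*y*(r\<^sub>3*r\<^sub>2*h) + a*(r\<^sub>3*r\<^sub>2*h)*(n*r\<^sub>2*y) + (m*r\<^sub>2*y)*(r\<^sub>3*r\<^sub>2*h)*x - 2*y*(r\<^sub>3*r\<^sub>2*h)*x > 0"
    by (rule mp[OF N(1) lead(2)]) ((simp add: lead0456_def algebra_simps))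
  have D0124: "c*(m*r\<^sub>2*y)*(r\<^sub>3*r\<^sub>2*h) - 4*c*y*(r\<^sub>3*r\<^sub>2*h) + 2*c*(r\<^sub>3*r\<^sub>2*h)*(n*r\<^sub>2*y) + (\<beta>*y)*a*(r\<^sub>3*r\<^sub>2*h) - 2*(\<beta>*y)*(r\<^sub>3*r\<^sub>2*h)*x - 2*h*a*y + h*a*(n*r\<^sub>2*y) + h*(m*r\<^sub>2*y)*x - a*y*(r\<^sub>3*r\<^sub>2*h) + a*(r\<^sub>3*r\<^sub>2*h)*(n*r\<^sub>2*y) + (m*r\<^sub>2*y)*(r\<^sub>3*r\<^sub>2*h)*x - 2*y*(r\<^sub>3*r\<^sub>2*h)*x < 0"
    by (rule mn[OF N(2) lead(3)]) ((simp add: lead0124_def algebra_simps))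
  have D0134: "- 2*c*y*(r\<^sub>3*r\<^sub>2*h) + 2*c*(r\<^sub>3*r\<^sub>2*h)*(n*r\<^sub>2*y) - 2*(\<beta>*y)*(r\<^sub>3*r\<^sub>2*h)*x - 2*h*a*y + 2*h*a*(n*r\<^sub>2*y) + 2*h*(m*r\<^sub>2*y)*x - 2*h*y*x < 0"
    by (rule mn[OF N(2) lead(4)]) ((simp add: lead0134_def algebra_simps))
  have D0136: "2*c*(m*r\<^sub>2*y)*(r\<^sub>3*r\<^sub>2*h) - 2*c*y*(r\<^sub>3*r\<^sub>2*h) + 2*(\<beta>*y)*a*(r\<^sub>3*r\<^sub>2*h) - 2*h*a*y + 2*h*a*(n*r\<^sub>2*y) + 2*h*(m*r\<^sub>2*y)*x - 2*h*y*x + 2*a*y*(r\<^sub>3*r\<^sub>2*h) - 2*a*(r\<^sub>3*r\<^sub>2*h)*(n*r\<^sub>2*y) - 2*(m*r\<^sub>2*y)*(r\<^sub>3*r\<^sub>2*h)*x + 2*y*(r\<^sub>3*r\<^sub>2*h)*x < 0"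
    by (rule mn[OF N(2) lead(5)]) ((simp add: lead0136_def algebra_simps))
  have D0146: "2*c*(m*r\<^sub>2*y)*(r\<^sub>3*r\<^sub>2*h) - 2*c*y*(r\<^sub>3*r\<^sub>2*h) + 2*(\<beta>*y)*a*(r\<^sub>3*r\<^sub>2*h) + 2*h*a*y - 2*h*a*(n*r\<^sub>2*y) - 2*h*(m*r\<^sub>2*y)*x + 2*h*y*x - 2*a*y*(r\<^sub>3*r\<^sub>2*h) + 2*a*(r\<^sub>3*r\<^sub>2*h)*(n*r\<^sub>2*y) + 2*(m*r\<^sub>2*y)*(r\<^sub>3*r\<^sub>2*h)*x - 2*y*(r\<^sub>3*r\<^sub>2*h)*x > 0"
    by (rule mp[OF N(2) lead(6)]) ((simp add: lead0146_def algebra_simps))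
  have D0156: "4*c*(m*r\<^sub>2*y)*(r\<^sub>3*r\<^sub>2*h) - 4*c*y*(r\<^sub>3*r\<^sub>2*h) + 4*(\<beta>*y)*a*(r\<^sub>3*r\<^sub>2*h) + 2*h*a*y - 2*a*y*(r\<^sub>3*r\<^sub>2*h) > 0"
    by (rule mp[OF N(2) lead(7)]) ((simp add: lead0156_def algebra_simps))
  have D0234: "2*c*y*(r\<^sub>3*r\<^sub>2*h) - 2*c*(r\<^sub>3*r\<^sub>2*h)*(n*r\<^sub>2*y) + 2*(\<beta>*y)*(r\<^sub>3*r\<^sub>2*h)*x - 2*h*y*x < 0"
    by (rule mn[OF N(2) lead(8)]) ((simp add: lead0234_def algebra_simps))
  have D0235: "2*c*y*(r\<^sub>3*r\<^sub>2*h) - 2*h*y*x - 2*y*(r\<^sub>3*r\<^sub>2*h)*x < 0"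
    by (rule mn[OF N(2) lead(9)]) ((simp add: lead0235_def algebra_simps))
  have D0236: "- c*(m*r\<^sub>2*y)*(r\<^sub>3*r\<^sub>2*h) + 2*c*y*(r\<^sub>3*r\<^sub>2*h) - 2*c*(r\<^sub>3*r\<^sub>2*h)*(n*r\<^sub>2*y) - (\<beta>*y)*a*(r\<^sub>3*r\<^sub>2*h) + 2*(\<beta>*y)*(r\<^sub>3*r\<^sub>2*h)*x + h*a*(n*r\<^sub>2*y) + h*(m*r\<^sub>2*y)*x - 2*h*y*x - a*y*(r\<^sub>3*r\<^sub>2*h) + a*(r\<^sub>3*r\<^sub>2*h)*(n*r\<^sub>2*y) + (m*r\<^sub>2*y)*(r\<^sub>3*r\<^sub>2*h)*x < 0"
    by (rule mn[OF N(2) lead(10)]) ((simp add: lead0236_def algebra_simps))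
  have D0245: "2*c*y*(r\<^sub>3*r\<^sub>2*h) + 2*h*y*x + 2*y*(r\<^sub>3*r\<^sub>2*h)*x > 0"
    by (rule mp[OF N(2) lead(11)]) ((simp add: lead0245_def algebra_simps))
  have D0256: "- 4*c*y*(r\<^sub>3*r\<^sub>2*h) + 2*h*a*y + 2*a*y*(r\<^sub>3*r\<^sub>2*h) > 0"
    by (rule mp[OF N(2) lead(12)]) ((simp add: lead0256_def algebra_simps))
  have D0356: "c*(m*r\<^sub>2*y)*(r\<^sub>3*r\<^sub>2*h) - 4*c*y*(r\<^sub>3*r\<^sub>2*h) + 2*c*(r\<^sub>3*r\<^sub>2*h)*(n*r\<^sub>2*y) + (\<beta>*y)*a*(r\<^sub>3*r\<^sub>2*h) - 2*(\<beta>*y)*(r\<^sub>3*r\<^sub>2*h)*x + 2*h*a*y - h*a*(n*r\<^sub>2*y) - h*(m*r\<^sub>2*y)*x + a*y*(r\<^sub>3*r\<^sub>2*h) - a*(r\<^sub>3*r\<^sub>2*h)*(n*r\<^sub>2*y) - (m*r\<^sub>2*y)*(r\<^sub>3*r\<^sub>2*h)*x + 2*y*(r\<^sub>3*r\<^sub>2*h)*x > 0"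
    by (rule mp[OF N(2) lead(13)]) ((simp add: lead0356_def algebra_simps))
  \<comment> \<open>Here terms with \<open>c\<close> compete with terms with \<open>b\<close>, which
    may tend to 0 faster than \<open>y\<close>; \<open>r4\<close> is the relation that makes the
    former negligible.\<close>
  have D0127: "2*c*h*(m*r\<^sub>2*y) + 2*c*(m*r\<^sub>2*y)*(r\<^sub>3*r\<^sub>2*h) - 4*c*y*(r\<^sub>3*r\<^sub>2*h) + 2*(\<beta>*y)*h*a + 2*(\<beta>*y)*a*(r\<^sub>3*r\<^sub>2*h) > 0"
    by (rule mp[OF N(3) lead(14)]) (insert r4, unfold lead0127_def, algebra)
  have D0237: "- 2*c*h*(n*r\<^sub>2*y) + 2*c*y*(r\<^sub>3*r\<^sub>2*h) - 2*c*(r\<^sub>3*r\<^sub>2*h)*(n*r\<^sub>2*y) + 2*(\<beta>*y)*h*x + 2*(\<beta>*y)*(r\<^sub>3*r\<^sub>2*h)*x > 0"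
    by (rule mp[OF N(3) lead(15)]) (insert r4, unfold lead0237_def, algebra)
  have D1234: "- 2*a*y*(r\<^sub>3*r\<^sub>2*h) + 2*a*(r\<^sub>3*r\<^sub>2*h)*(n*r\<^sub>2*y) + 2*(m*r\<^sub>2*y)*(r\<^sub>3*r\<^sub>2*h)*x - 4*y*(r\<^sub>3*r\<^sub>2*h)*x < 0"
    by (rule mn[OF N(4) lead(16)]) ((simp add: lead1234_def algebra_simps))
  have D1246: "6*a*y*(r\<^sub>3*r\<^sub>2*h) - 4*a*(r\<^sub>3*r\<^sub>2*h)*(n*r\<^sub>2*y) - 4*(m*r\<^sub>2*y)*(r\<^sub>3*r\<^sub>2*h)*x + 4*y*(r\<^sub>3*r\<^sub>2*h)*x > 0"
    by (rule mp[OF N(4) lead(17)]) ((simp add: lead1246_def algebra_simps))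
  have D1346: "4*a*y*(r\<^sub>3*r\<^sub>2*h) - 4*a*(r\<^sub>3*r\<^sub>2*h)*(n*r\<^sub>2*y) - 4*(m*r\<^sub>2*y)*(r\<^sub>3*r\<^sub>2*h)*x + 4*y*(r\<^sub>3*r\<^sub>2*h)*x > 0"
    by (rule mp[OF N(4) lead(18)]) ((simp add: lead1346_def algebra_simps))
  have D1245: "- 2*a*y*(r\<^sub>3*r\<^sub>2*h) + 4*y*(r\<^sub>3*r\<^sub>2*h)*x > 0"
    by (rule mp[OF N(4) lead(19)]) ((simp add: lead1245_def algebra_simps))
  have d: "r\<^sub>3*r\<^sub>2*h < h" using small(1) pos(1) by simp
  have n: "n*r\<^sub>2*y < y" using small(2) pos(2) by simp
  define d' b' m' n' where "d' = r\<^sub>3*r\<^sub>2*h" and "b' = \<beta>*y" and "m' = m*r\<^sub>2*y" and "n' = n*r\<^sub>2*y"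
  have P: "d' > 0" "b' > 0" "d' < h" "n' < y" "c*(y - m') - b'*a > 0" using pos d n E by (simp_all add: d'_def b'_def n'_def m'_def)
  note folds = d'_def[symmetric] b'_def[symmetric] m'_def[symmetric] n'_def[symmetric]
  have D0167: "- 4*(h - d')*(c*(y - m') - b'*a) < 0" using P(3,5) by (simp add: mult_less_0_iff)
  \<comment> \<open>Replacing \<open>b'*a\<close> by the larger \<open>c*(y - m')\<close> leaves
    \<open>- 2*c*y*(h - d')\<close>.\<close>
  have D0157: "2*c*h*m' - 4*c*h*y + 2*c*m'*d' + 2*b'*h*a + 2*b'*a*d' < 0"
  proof -
    have "2*(b'*a)*(h + d') < 2*(c*(y - m'))*(h + d')" using P pos by (intro mult_strict_right_mono mult_strict_left_mono) simp_all
    moreover have "c*y*(h - d') > 0" using P pos by simp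
    ultimately show ?thesis by (simp add: algebra_simps)
  qed
  have D0247: "- 4*c*h*y + 2*c*h*n' - 2*c*y*d' + 2*c*d'*n' - 2*b'*h*x - 2*b'*d'*x < 0"
  proof -
    have "c*(h*(y - n')) > 0" "c*(d'*(y - n')) > 0" "c*h*y > 0" "b'*h*x > 0" "b'*d'*x > 0" using P pos by simp_all
    then show ?thesis by (simp add: algebra_simps)
  qed
  have "c*h*y > 0" "c*y*d' > 0" "a*y*d' > 0" "y*d'*x > 0" using P pos by simp_all
  then have D0257: "- 4*c*h*y - 4*c*y*d' < 0" and D1235: "- 2*a*y*d' - 4*y*d'*x < 0" and D2345: "- 4*y*d'*x < 0"
    by linarith+
  show ?thesis
    unfolding tent_signs_def folds
    using D0123 D0456 D0124 D0134 D0136 D0146 D0156 D0234 D0235 D0236 D0245 D0256 D0356 D0127 D0237 D1234 D1246 D1346 D1245 D0157 D0167 D0247 D0257 D1235 D2345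
    unfolding folds by blast
qed

text \<open>With all \<open>r\<close>'s equal to 0 and \<open>a = x = X\<close>, each
  \<open>lead\<close> form is a nonzero multiple of \<open>X\<close>, except \<open>lead0123\<close>
  and \<open>lead0456\<close>, which become minus and plus
  \<open>X * (n\<^sub>0 + m\<^sub>0)\<close>. These two quadruples are where the signs of
  \<open>m\<^sub>0\<close> and \<open>n\<^sub>0\<close> matter.\<close>

lemma eventually_tent_signs:
  fixes a x c \<beta> m n r\<^sub>2 r\<^sub>3 r\<^sub>4 h y :: "'e \<Rightarrow> real"
  assumes lim: "(a \<longlongrightarrow> X) F" "(x \<longlongrightarrow> X) F" "(c \<longlongrightarrow> c\<^sub>0) F" "(\<beta> \<longlongrightarrow> \<beta>\<^sub>0) F" "(m \<longlongrightarrow> m\<^sub>0) F" "(n \<longlongrightarrow> n\<^sub>0) F"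
      "(r\<^sub>2 \<longlongrightarrow> 0) F" "(r\<^sub>3 \<longlongrightarrow> 0) F" "(r\<^sub>4 \<longlongrightarrow> 0) F"
    and X: "X > 0" "m\<^sub>0 > 0" "n\<^sub>0 \<ge> 0"
    and pos: "\<forall>\<^sub>F e in F. h e > 0 \<and> y e > 0 \<and> c e > 0 \<and> \<beta> e > 0 \<and> r\<^sub>2 e > 0 \<and> r\<^sub>3 e > 0 \<and> c e*r\<^sub>2 e = r\<^sub>4 e*\<beta> e"
    and E: "\<forall>\<^sub>F e in F. c e*(y e - m e*r\<^sub>2 e*y e) - \<beta> e*y e*a e > 0"
  shows "\<forall>\<^sub>F e in F. tent_signs (c e) (\<beta> e*y e) (h e) (a e) (m e*r\<^sub>2 e*y e) (y e) (r\<^sub>3 e*r\<^sub>2 e*h e) (x e) (n e*r\<^sub>2 e*y e)"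
proof -
  have nX: "n\<^sub>0 * X \<ge> 0" "m\<^sub>0 * X > 0" "X * n\<^sub>0 \<ge> 0" "X * m\<^sub>0 > 0" using X by simp_all
  have "((\<lambda>e. lead0123 (a e) (x e) (c e) (\<beta> e) (m e) (n e) (r\<^sub>2 e) (r\<^sub>3 e) (r\<^sub>4 e)) \<longlongrightarrow> lead0123 X X c\<^sub>0 \<beta>\<^sub>0 m\<^sub>0 n\<^sub>0 0 0 0) F" unfolding lead0123_def by (intro tendsto_intros lim)
  moreover have "lead0123 X X c\<^sub>0 \<beta>\<^sub>0 m\<^sub>0 n\<^sub>0 0 0 0 < 0" using X by (simp add: lead0123_def; use nX in linarith)
  ultimately have G0123: "\<forall>\<^sub>F e in F. lead0123 (a e) (x e) (c e) (\<beta> e) (m e) (n e) (r\<^sub>2 e) (r\<^sub>3 e) (r\<^sub>4 e) < 0" by (rule order_tendstoD)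
  have "((\<lambda>e. lead0456 (a e) (x e) (c e) (\<beta> e) (m e) (n e) (r\<^sub>2 e) (r\<^sub>3 e) (r\<^sub>4 e)) \<longlongrightarrow> lead0456 X X c\<^sub>0 \<beta>\<^sub>0 m\<^sub>0 n\<^sub>0 0 0 0) F" unfolding lead0456_def by (intro tendsto_intros lim)
  moreover have "lead0456 X X c\<^sub>0 \<beta>\<^sub>0 m\<^sub>0 n\<^sub>0 0 0 0 > 0" using X by (simp add: lead0456_def; use nX in linarith)
  ultimately have G0456: "\<forall>\<^sub>F e in F. lead0456 (a e) (x e) (c e) (\<beta> e) (m e) (n e) (r\<^sub>2 e) (r\<^sub>3 e) (r\<^sub>4 e) > 0" by (rule order_tendstoD)
  have "((\<lambda>e. lead0124 (a e) (x e) (c e) (\<beta> e) (m e) (n e) (r\<^sub>2 e) (r\<^sub>3 e) (r\<^sub>4 e)) \<longlongrightarrow> lead0124 X X c\<^sub>0 \<beta>\<^sub>0 m\<^sub>0 n\<^sub>0 0 0 0) F" unfolding lead0124_def by (intro tendsto_intros lim)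
  moreover have "lead0124 X X c\<^sub>0 \<beta>\<^sub>0 m\<^sub>0 n\<^sub>0 0 0 0 < 0" using X by (simp add: lead0124_def; use nX in linarith)
  ultimately have G0124: "\<forall>\<^sub>F e in F. lead0124 (a e) (x e) (c e) (\<beta> e) (m e) (n e) (r\<^sub>2 e) (r\<^sub>3 e) (r\<^sub>4 e) < 0" by (rule order_tendstoD)
  have "((\<lambda>e. lead0134 (a e) (x e) (c e) (\<beta> e) (m e) (n e) (r\<^sub>2 e) (r\<^sub>3 e) (r\<^sub>4 e)) \<longlongrightarrow> lead0134 X X c\<^sub>0 \<beta>\<^sub>0 m\<^sub>0 n\<^sub>0 0 0 0) F" unfolding lead0134_def by (intro tendsto_intros lim)
  moreover have "lead0134 X X c\<^sub>0 \<beta>\<^sub>0 m\<^sub>0 n\<^sub>0 0 0 0 < 0" using X by (simp add: lead0134_def; use nX in linarith)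
  ultimately have G0134: "\<forall>\<^sub>F e in F. lead0134 (a e) (x e) (c e) (\<beta> e) (m e) (n e) (r\<^sub>2 e) (r\<^sub>3 e) (r\<^sub>4 e) < 0" by (rule order_tendstoD)
  have "((\<lambda>e. lead0136 (a e) (x e) (c e) (\<beta> e) (m e) (n e) (r\<^sub>2 e) (r\<^sub>3 e) (r\<^sub>4 e)) \<longlongrightarrow> lead0136 X X c\<^sub>0 \<beta>\<^sub>0 m\<^sub>0 n\<^sub>0 0 0 0) F" unfolding lead0136_def by (intro tendsto_intros lim)
  moreover have "lead0136 X X c\<^sub>0 \<beta>\<^sub>0 m\<^sub>0 n\<^sub>0 0 0 0 < 0" using X by (simp add: lead0136_def; use nX in linarith)
  ultimately have G0136: "\<forall>\<^sub>F e in F. lead0136 (a e) (x e) (c e) (\<beta> e) (m e) (n e) (r\<^sub>2 e) (r\<^sub>3 e) (r\<^sub>4 e) < 0" by (rule order_tendstoD)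
  have "((\<lambda>e. lead0146 (a e) (x e) (c e) (\<beta> e) (m e) (n e) (r\<^sub>2 e) (r\<^sub>3 e) (r\<^sub>4 e)) \<longlongrightarrow> lead0146 X X c\<^sub>0 \<beta>\<^sub>0 m\<^sub>0 n\<^sub>0 0 0 0) F" unfolding lead0146_def by (intro tendsto_intros lim)
  moreover have "lead0146 X X c\<^sub>0 \<beta>\<^sub>0 m\<^sub>0 n\<^sub>0 0 0 0 > 0" using X by (simp add: lead0146_def; use nX in linarith)
  ultimately have G0146: "\<forall>\<^sub>F e in F. lead0146 (a e) (x e) (c e) (\<beta> e) (m e) (n e) (r\<^sub>2 e) (r\<^sub>3 e) (r\<^sub>4 e) > 0" by (rule order_tendstoD)
  have "((\<lambda>e. lead0156 (a e) (x e) (c e) (\<beta> e) (m e) (n e) (r\<^sub>2 e) (r\<^sub>3 e) (r\<^sub>4 e)) \<longlongrightarrow> lead0156 X X c\<^sub>0 \<beta>\<^sub>0 m\<^sub>0 n\<^sub>0 0 0 0) F" unfolding lead0156_def by (intro tendsto_intros lim)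
  moreover have "lead0156 X X c\<^sub>0 \<beta>\<^sub>0 m\<^sub>0 n\<^sub>0 0 0 0 > 0" using X by (simp add: lead0156_def; use nX in linarith)
  ultimately have G0156: "\<forall>\<^sub>F e in F. lead0156 (a e) (x e) (c e) (\<beta> e) (m e) (n e) (r\<^sub>2 e) (r\<^sub>3 e) (r\<^sub>4 e) > 0" by (rule order_tendstoD)
  have "((\<lambda>e. lead0234 (a e) (x e) (c e) (\<beta> e) (m e) (n e) (r\<^sub>2 e) (r\<^sub>3 e) (r\<^sub>4 e)) \<longlongrightarrow> lead0234 X X c\<^sub>0 \<beta>\<^sub>0 m\<^sub>0 n\<^sub>0 0 0 0) F" unfolding lead0234_def by (intro tendsto_intros lim)
  moreover have "lead0234 X X c\<^sub>0 \<beta>\<^sub>0 m\<^sub>0 n\<^sub>0 0 0 0 < 0" using X by (simp add: lead0234_def; use nX in linarith)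
  ultimately have G0234: "\<forall>\<^sub>F e in F. lead0234 (a e) (x e) (c e) (\<beta> e) (m e) (n e) (r\<^sub>2 e) (r\<^sub>3 e) (r\<^sub>4 e) < 0" by (rule order_tendstoD)
  have "((\<lambda>e. lead0235 (a e) (x e) (c e) (\<beta> e) (m e) (n e) (r\<^sub>2 e) (r\<^sub>3 e) (r\<^sub>4 e)) \<longlongrightarrow> lead0235 X X c\<^sub>0 \<beta>\<^sub>0 m\<^sub>0 n\<^sub>0 0 0 0) F" unfolding lead0235_def by (intro tendsto_intros lim)
  moreover have "lead0235 X X c\<^sub>0 \<beta>\<^sub>0 m\<^sub>0 n\<^sub>0 0 0 0 < 0" using X by (simp add: lead0235_def; use nX in linarith)
  ultimately have G0235: "\<forall>\<^sub>F e in F. lead0235 (a e) (x e) (c e) (\<beta> e) (m e) (n e) (r\<^sub>2 e) (r\<^sub>3 e) (r\<^sub>4 e) < 0" by (rule order_tendstoD)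
  have "((\<lambda>e. lead0236 (a e) (x e) (c e) (\<beta> e) (m e) (n e) (r\<^sub>2 e) (r\<^sub>3 e) (r\<^sub>4 e)) \<longlongrightarrow> lead0236 X X c\<^sub>0 \<beta>\<^sub>0 m\<^sub>0 n\<^sub>0 0 0 0) F" unfolding lead0236_def by (intro tendsto_intros lim)
  moreover have "lead0236 X X c\<^sub>0 \<beta>\<^sub>0 m\<^sub>0 n\<^sub>0 0 0 0 < 0" using X by (simp add: lead0236_def; use nX in linarith)
  ultimately have G0236: "\<forall>\<^sub>F e in F. lead0236 (a e) (x e) (c e) (\<beta> e) (m e) (n e) (r\<^sub>2 e) (r\<^sub>3 e) (r\<^sub>4 e) < 0" by (rule order_tendstoD)
  have "((\<lambda>e. lead0245 (a e) (x e) (c e) (\<beta> e) (m e) (n e) (r\<^sub>2 e) (r\<^sub>3 e) (r\<^sub>4 e)) \<longlongrightarrow> lead0245 X X c\<^sub>0 \<beta>\<^sub>0 m\<^sub>0 n\<^sub>0 0 0 0) F" unfolding lead0245_def by (intro tendsto_intros lim)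
  moreover have "lead0245 X X c\<^sub>0 \<beta>\<^sub>0 m\<^sub>0 n\<^sub>0 0 0 0 > 0" using X by (simp add: lead0245_def; use nX in linarith)
  ultimately have G0245: "\<forall>\<^sub>F e in F. lead0245 (a e) (x e) (c e) (\<beta> e) (m e) (n e) (r\<^sub>2 e) (r\<^sub>3 e) (r\<^sub>4 e) > 0" by (rule order_tendstoD)
  have "((\<lambda>e. lead0256 (a e) (x e) (c e) (\<beta> e) (m e) (n e) (r\<^sub>2 e) (r\<^sub>3 e) (r\<^sub>4 e)) \<longlongrightarrow> lead0256 X X c\<^sub>0 \<beta>\<^sub>0 m\<^sub>0 n\<^sub>0 0 0 0) F" unfolding lead0256_def by (intro tendsto_intros lim)
  moreover have "lead0256 X X c\<^sub>0 \<beta>\<^sub>0 m\<^sub>0 n\<^sub>0 0 0 0 > 0" using X by (simp add: lead0256_def; use nX in linarith)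
  ultimately have G0256: "\<forall>\<^sub>F e in F. lead0256 (a e) (x e) (c e) (\<beta> e) (m e) (n e) (r\<^sub>2 e) (r\<^sub>3 e) (r\<^sub>4 e) > 0" by (rule order_tendstoD)
  have "((\<lambda>e. lead0356 (a e) (x e) (c e) (\<beta> e) (m e) (n e) (r\<^sub>2 e) (r\<^sub>3 e) (r\<^sub>4 e)) \<longlongrightarrow> lead0356 X X c\<^sub>0 \<beta>\<^sub>0 m\<^sub>0 n\<^sub>0 0 0 0) F" unfolding lead0356_def by (intro tendsto_intros lim)
  moreover have "lead0356 X X c\<^sub>0 \<beta>\<^sub>0 m\<^sub>0 n\<^sub>0 0 0 0 > 0" using X by (simp add: lead0356_def; use nX in linarith)
  ultimately have G0356: "\<forall>\<^sub>F e in F. lead0356 (a e) (x e) (c e) (\<beta> e) (m e) (n e) (r\<^sub>2 e) (r\<^sub>3 e) (r\<^sub>4 e) > 0" by (rule order_tendstoD)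
  have "((\<lambda>e. lead0127 (a e) (x e) (c e) (\<beta> e) (m e) (n e) (r\<^sub>2 e) (r\<^sub>3 e) (r\<^sub>4 e)) \<longlongrightarrow> lead0127 X X c\<^sub>0 \<beta>\<^sub>0 m\<^sub>0 n\<^sub>0 0 0 0) F" unfolding lead0127_def by (intro tendsto_intros lim)
  moreover have "lead0127 X X c\<^sub>0 \<beta>\<^sub>0 m\<^sub>0 n\<^sub>0 0 0 0 > 0" using X by (simp add: lead0127_def; use nX in linarith)
  ultimately have G0127: "\<forall>\<^sub>F e in F. lead0127 (a e) (x e) (c e) (\<beta> e) (m e) (n e) (r\<^sub>2 e) (r\<^sub>3 e) (r\<^sub>4 e) > 0" by (rule order_tendstoD)
  have "((\<lambda>e. lead0237 (a e) (x e) (c e) (\<beta> e) (m e) (n e) (r\<^sub>2 e) (r\<^sub>3 e) (r\<^sub>4 e)) \<longlongrightarrow> lead0237 X X c\<^sub>0 \<beta>\<^sub>0 m\<^sub>0 n\<^sub>0 0 0 0) F" unfolding lead0237_def by (intro tendsto_intros lim)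
  moreover have "lead0237 X X c\<^sub>0 \<beta>\<^sub>0 m\<^sub>0 n\<^sub>0 0 0 0 > 0" using X by (simp add: lead0237_def; use nX in linarith)
  ultimately have G0237: "\<forall>\<^sub>F e in F. lead0237 (a e) (x e) (c e) (\<beta> e) (m e) (n e) (r\<^sub>2 e) (r\<^sub>3 e) (r\<^sub>4 e) > 0" by (rule order_tendstoD)
  have "((\<lambda>e. lead1234 (a e) (x e) (c e) (\<beta> e) (m e) (n e) (r\<^sub>2 e) (r\<^sub>3 e) (r\<^sub>4 e)) \<longlongrightarrow> lead1234 X X c\<^sub>0 \<beta>\<^sub>0 m\<^sub>0 n\<^sub>0 0 0 0) F" unfolding lead1234_def by (intro tendsto_intros lim)
  moreover have "lead1234 X X c\<^sub>0 \<beta>\<^sub>0 m\<^sub>0 n\<^sub>0 0 0 0 < 0" using X by (simp add: lead1234_def; use nX in linarith)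
  ultimately have G1234: "\<forall>\<^sub>F e in F. lead1234 (a e) (x e) (c e) (\<beta> e) (m e) (n e) (r\<^sub>2 e) (r\<^sub>3 e) (r\<^sub>4 e) < 0" by (rule order_tendstoD)
  have "((\<lambda>e. lead1246 (a e) (x e) (c e) (\<beta> e) (m e) (n e) (r\<^sub>2 e) (r\<^sub>3 e) (r\<^sub>4 e)) \<longlongrightarrow> lead1246 X X c\<^sub>0 \<beta>\<^sub>0 m\<^sub>0 n\<^sub>0 0 0 0) F" unfolding lead1246_def by (intro tendsto_intros lim)
  moreover have "lead1246 X X c\<^sub>0 \<beta>\<^sub>0 m\<^sub>0 n\<^sub>0 0 0 0 > 0" using X by (simp add: lead1246_def; use nX in linarith)
  ultimately have G1246: "\<forall>\<^sub>F e in F. lead1246 (a e) (x e) (c e) (\<beta> e) (m e) (n e) (r\<^sub>2 e) (r\<^sub>3 e) (r\<^sub>4 e) > 0" by (rule order_tendstoD)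
  have "((\<lambda>e. lead1346 (a e) (x e) (c e) (\<beta> e) (m e) (n e) (r\<^sub>2 e) (r\<^sub>3 e) (r\<^sub>4 e)) \<longlongrightarrow> lead1346 X X c\<^sub>0 \<beta>\<^sub>0 m\<^sub>0 n\<^sub>0 0 0 0) F" unfolding lead1346_def by (intro tendsto_intros lim)
  moreover have "lead1346 X X c\<^sub>0 \<beta>\<^sub>0 m\<^sub>0 n\<^sub>0 0 0 0 > 0" using X by (simp add: lead1346_def; use nX in linarith)
  ultimately have G1346: "\<forall>\<^sub>F e in F. lead1346 (a e) (x e) (c e) (\<beta> e) (m e) (n e) (r\<^sub>2 e) (r\<^sub>3 e) (r\<^sub>4 e) > 0" by (rule order_tendstoD)
  have "((\<lambda>e. lead1245 (a e) (x e) (c e) (\<beta> e) (m e) (n e) (r\<^sub>2 e) (r\<^sub>3 e) (r\<^sub>4 e)) \<longlongrightarrow> lead1245 X X c\<^sub>0 \<beta>\<^sub>0 m\<^sub>0 n\<^sub>0 0 0 0) F" unfolding lead1245_def by (intro tendsto_intros lim)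
  moreover have "lead1245 X X c\<^sub>0 \<beta>\<^sub>0 m\<^sub>0 n\<^sub>0 0 0 0 > 0" using X by (simp add: lead1245_def; use nX in linarith)
  ultimately have G1245: "\<forall>\<^sub>F e in F. lead1245 (a e) (x e) (c e) (\<beta> e) (m e) (n e) (r\<^sub>2 e) (r\<^sub>3 e) (r\<^sub>4 e) > 0" by (rule order_tendstoD)
  have "((\<lambda>e. r\<^sub>3 e*r\<^sub>2 e) \<longlongrightarrow> 0*0) F" "((\<lambda>e. n e*r\<^sub>2 e) \<longlongrightarrow> n\<^sub>0*0) F" by (intro tendsto_intros lim)+
  then have small: "\<forall>\<^sub>F e in F. r\<^sub>3 e*r\<^sub>2 e < 1" "\<forall>\<^sub>F e in F. n e*r\<^sub>2 e < 1" by (auto intro: order_tendstoD(2))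
  have ax: "\<forall>\<^sub>F e in F. a e > 0" "\<forall>\<^sub>F e in F. x e > 0" by (rule order_tendstoD(1)[OF lim(1) X(1)] order_tendstoD(1)[OF lim(2) X(1)])+
  from pos E small ax G0123 G0456 G0124 G0134 G0136 G0146 G0156 G0234 G0235 G0236 G0245 G0256 G0356 G0127 G0237 G1234 G1246 G1346 G1245
  show ?thesis
    by eventually_elim (rule tent_signs_lead; simp)
qed

section \<open>Vertex tuples of a solution: continuity, signs and cone angles\<close>

lemma continuous_on_ite:
  "continuous_on S f \<Longrightarrow> continuous_on S g \<Longrightarrow> continuous_on S (\<lambda>e. if P then f e else g e)"
  by (cases P) simp_all

lemma continuous_on_vector3:
  assumes "continuous_on S f" "continuous_on S g" "continuous_on S h"
  shows "continuous_on S (\<lambda>e. vector [f e, g e, h e] :: real^3)"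
proof -
  have "(vector [u, v, w] :: real^3) = (\<chi> i. if i = 1 then u else if i = 2 then v else w)" for u v w
    by (simp add: vec_eq_iff forall_3 vector_3)
  then show ?thesis using assms by (auto intro!: continuous_on_vec_lambda continuous_on_ite)
qed

lemma continuous_on_\<rho>: "continuous_on S f \<Longrightarrow> continuous_on S (\<lambda>e. \<rho> (f e))"
  unfolding \<rho>_def by (intro continuous_on_vector3 continuous_intros)

lemma continuous_on_tent:
  assumes "continuous_on S q\<^sub>0" "continuous_on S q\<^sub>1" "continuous_on S q\<^sub>2" "continuous_on S q\<^sub>3"
  shows "continuous_on S (\<lambda>e. tent (q\<^sub>0 e) (q\<^sub>1 e) (q\<^sub>2 e) (q\<^sub>3 e))"
  unfolding tent_def using assms by (intro continuous_on_vec_lambda continuous_on_ite continuous_on_\<rho>)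

context tent_solution
begin

definition "\<tau> e = d e * (dy e * \<sigma> e) / (2 - \<kappa>y e * nh e)"
definition "vertices e = tent (vector [c e, b e, L e - d e]) (vector [x\<^sub>1 e, \<kappa> e * Kh e - y e - \<tau> e, d e])
    (vector [0, - y e, - d e]) (vector [x\<^sub>3 e, \<kappa> e * nh e - y e, 0])"

lemma param_lims:
  "(L \<longlongrightarrow> L 0) (at_right 0)" "(y \<longlongrightarrow> y 0) (at_right 0)" "(z \<longlongrightarrow> z 0) (at_right 0)"
  "(B \<longlongrightarrow> B 0) (at_right 0)" "(c \<longlongrightarrow> c 0) (at_right 0)" "(b \<longlongrightarrow> b 0) (at_right 0)"
  "(d \<longlongrightarrow> 0) (at_right 0)" "(\<kappa> \<longlongrightarrow> 0) (at_right 0)"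
  "(\<kappa>y \<longlongrightarrow> 0) (at_right 0)" "(dy \<longlongrightarrow> 0) (at_right 0)" "(dd \<longlongrightarrow> 0) (at_right 0)"
  using cont[THEN continuous_on_Icc_at_rightD, OF pos(3)] zero by simp_all

lemma solution_lims:
  "(T \<longlongrightarrow> T 0) (at_right 0)" "(\<sigma> \<longlongrightarrow> \<sigma> 0) (at_right 0)" "(G \<longlongrightarrow> G 0) (at_right 0)" "(Kh \<longlongrightarrow> K\<^sub>0) (at_right 0)"
  "(nh \<longlongrightarrow> n\<^sub>0) (at_right 0)" "(f\<^sub>1 \<longlongrightarrow> \<phi>\<^sub>1) (at_right 0)" "(f\<^sub>2 \<longlongrightarrow> \<phi>\<^sub>2) (at_right 0)"
  "(x\<^sub>1 \<longlongrightarrow> - X) (at_right 0)" "(x\<^sub>3 \<longlongrightarrow> X) (at_right 0)"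
  using cont_sol[THEN continuous_on_Icc_at_rightD, OF q(1)] init by simp_all

lemma \<tau>_lim: "(\<tau> \<longlongrightarrow> 0) (at_right 0)"
proof -
  have "((\<lambda>e. d e * (dy e * \<sigma> e) / (2 - \<kappa>y e * nh e)) \<longlongrightarrow> 0 * (0 * \<sigma> 0) / (2 - 0 * n\<^sub>0)) (at_right 0)"
    by (intro tendsto_intros param_lims solution_lims) simp
  then show ?thesis unfolding \<tau>_def[abs_def] by simp
qed

lemma near_0: "\<forall>\<^sub>F e in at_right 0. 0 < e \<and> e \<le> q \<and> e \<le> r\<^sub>0"
proof -
  have "\<forall>\<^sub>F e in at_right 0. e \<in> {0<..<q}" using q(1) by (rule eventually_at_right_real)
  then show ?thesis by eventually_elim (use q in auto)
qed

lemma \<tau>_eq: "\<tau> e = (d e)\<^sup>2 * \<sigma> e / (y e * (2 - \<kappa>y e * nh e))" if "0 < e" "e \<le> q" for e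
proof -
  have "dy e = d e / y e" using quot[of e] that q by auto
  then show ?thesis by (simp add: \<tau>_def power2_eq_square)
qed

lemma continuous_vertices: "continuous_on {0..q} vertices"
proof -
  have "continuous_on {0..q} \<tau>" unfolding \<tau>_def[abs_def]
    by (intro continuous_intros continuous_on_subset[OF cont(7)] continuous_on_subset[OF cont(16)] continuous_on_subset[OF cont(17)] cont_sol)
      (use q sol_pos in \<open>auto simp: less_imp_neq\<close>)
  then show ?thesis unfolding vertices_def[abs_def]
    by (intro continuous_on_tent continuous_on_vector3 continuous_intros continuous_on_subset[OF cont(5)] continuous_on_subset[OF cont(6)]
        continuous_on_subset[OF cont(1)] continuous_on_subset[OF cont(2)] continuous_on_subset[OF cont(7)] continuous_on_subset[OF cont(8)] cont_sol)
      (use q in auto)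
qed

lemma vertices_0: "vertices 0 = tent (vector [c 0, b 0, L 0]) (vector [- X, - y 0, 0]) (vector [0, - y 0, 0]) (vector [X, - y 0, 0])"
  unfolding vertices_def \<tau>_def using zero init by simp

text \<open>The ratios of the sign analysis are \<open>\<kappa>/y\<close>,
  \<open>d*y/((L - d)*\<kappa>)\<close> and \<open>c*\<kappa>/b\<close>. The hypotheses
  \<open>O0\<close>, \<open>O3\<close>, \<open>O4\<close> are orientations of developed triangles at
  the limit, in which they persist for small \<open>e\<close>. By contrast the quantity in
  \<open>E\<close> tends to 0 in both families and the one in \<open>O6\<close> in the rectangle
  family, so these two are demanded for small positive \<open>e\<close> instead.\<close>

lemma eventually_pup_tent:
  assumes K0: "K\<^sub>0 > 0" "n\<^sub>0 \<ge> 0"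
    and r3: "((\<lambda>e. d e * y e / ((L e - d e) * \<kappa> e)) \<longlongrightarrow> 0) (at_right 0)"
    and r4: "((\<lambda>e. c e * \<kappa> e / b e) \<longlongrightarrow> 0) (at_right 0)"
    and \<beta>: "((\<lambda>e. b e / y e) \<longlongrightarrow> \<beta>\<^sub>0) (at_right 0)"
    and h: "\<forall>\<^sub>F e in at_right 0. L e - d e > 0"
    and E: "\<forall>\<^sub>F e in at_right 0. c e * (y e - (\<kappa> e * Kh e - \<tau> e)) + b e * x\<^sub>1 e > 0"
    and O0: "(2*\<phi>\<^sub>1 - X - z 0)*(\<eta> - y 0 - B 0) - (\<eta> + 2*\<phi>\<^sub>2 - y 0 - B 0)*(X - z 0) > 0"
    and O3: "\<phi>\<^sub>1*(X - \<phi>\<^sub>1) + (- y 0 - \<phi>\<^sub>2)*\<phi>\<^sub>2 < 0"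
    and O4: "\<eta> - y 0 - B 0 > 0"
    and O6: "\<forall>\<^sub>F e in at_right 0. (x\<^sub>1 e+(d e)\<^sup>2 * (G e * T e)+2*f\<^sub>1 e-z e)*(\<eta>+f\<^sub>2 e-y e+\<kappa> e * Kh e)
        - (\<eta>+2*f\<^sub>2 e-y e+\<kappa> e * Kh e-B e)*(x\<^sub>1 e+(d e)\<^sup>2 * (G e * T e)+f\<^sub>1 e) > 0"
  shows "\<forall>\<^sub>F e in at_right 0. pup_tent (vertices e)"
proof -
  define g t n K where "g e = (d e)\<^sup>2 * G e" and "t e = (d e)\<^sup>2 * (G e * T e)"
    and "n e = \<kappa> e * nh e" and "K e = \<kappa> e * Kh e" for e
  have "((\<lambda>e. (d e)\<^sup>2 * G e) \<longlongrightarrow> 0\<^sup>2 * G 0) (at_right 0)" "((\<lambda>e. (d e)\<^sup>2 * (G e * T e)) \<longlongrightarrow> 0\<^sup>2 * (G 0 * T 0)) (at_right 0)"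
    "((\<lambda>e. \<kappa> e * nh e) \<longlongrightarrow> 0 * n\<^sub>0) (at_right 0)" "((\<lambda>e. \<kappa> e * Kh e) \<longlongrightarrow> 0 * K\<^sub>0) (at_right 0)"
    by (intro tendsto_intros param_lims solution_lims)+
  then have gtnK: "(g \<longlongrightarrow> 0) (at_right 0)" "(t \<longlongrightarrow> 0) (at_right 0)" "(n \<longlongrightarrow> 0) (at_right 0)" "(K \<longlongrightarrow> 0) (at_right 0)"
    unfolding g_def[abs_def] t_def[abs_def] n_def[abs_def] K_def[abs_def] by simp_all
  note lims = param_lims solution_lims gtnK \<tau>_lim
  \<comment> \<open>This is \<open>(K - \<tau>)/\<kappa>\<close>. As \<open>dd\<close> tends to 0,
    \<open>\<tau>\<close> is negligible against \<open>\<kappa>\<close> and the limit is still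
    \<open>K\<^sub>0\<close>.\<close>
  define m where "m e = Kh e - dd e * \<sigma> e / (2 - \<kappa>y e * nh e)" for e
  have "((\<lambda>e. Kh e - dd e * \<sigma> e / (2 - \<kappa>y e * nh e)) \<longlongrightarrow> K\<^sub>0 - 0 * \<sigma> 0 / (2 - 0 * n\<^sub>0)) (at_right 0)"
    by (intro tendsto_intros lims) simp
  then have m: "(m \<longlongrightarrow> K\<^sub>0) (at_right 0)" unfolding m_def[abs_def] by simp
  have nx1: "((\<lambda>e. - x\<^sub>1 e) \<longlongrightarrow> X) (at_right 0)" using tendsto_minus[OF solution_lims(8)] by simp
  have params: "\<forall>\<^sub>F e in at_right 0. L e > 0 \<and> y e > 0 \<and> z e > 0 \<and> d e > 0 \<and> \<kappa> e > 0 \<and> c e > 0 \<and> b e > 0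
      \<and> \<eta> > y e \<and> \<eta> - y e + B e > 0 \<and> \<kappa>y e = \<kappa> e / y e \<and> dy e = d e / y e \<and> dd e = (d e)\<^sup>2 / (y e * \<kappa> e)
      \<and> f\<^sub>1 e > 0 \<and> x\<^sub>3 e > 0 \<and> G e > 0 \<and> 2 - \<kappa>y e * nh e > 0"
    using near_0
  proof eventually_elim
    case (elim e)
    then have e: "0 < e" "e \<le> r\<^sub>0" "e \<in> {0..q}" by auto
    show ?case using params_pos[OF e(1,2)] quot[OF e(1,2)] sol_pos[OF e(3)] by blast
  qed
  have m_eq: "\<forall>\<^sub>F e in at_right 0. m e * \<kappa>y e * y e = K e - \<tau> e"
    using params near_0
  proof eventually_elim
    case (elim e)
    have "dd e * \<sigma> e / (2 - \<kappa>y e * nh e) * \<kappa> e = (d e)\<^sup>2 * \<sigma> e / (y e * (2 - \<kappa>y e * nh e))"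
      using elim by simp
    then have "dd e * \<sigma> e / (2 - \<kappa>y e * nh e) * \<kappa> e = \<tau> e" using \<tau>_eq[of e] elim(2) by simp
    moreover have "\<kappa>y e * y e = \<kappa> e" using elim(1) by simp
    ultimately show ?case by (simp add: m_def K_def left_diff_distrib mult.assoc mult.commute[of "\<kappa> e"])
  qed
  have signs: "\<forall>\<^sub>F e in at_right 0. tent_signs (c e) (b e / y e * y e) (L e - d e) (- x\<^sub>1 e) (m e * \<kappa>y e * y e) (y e)
      (d e * y e / ((L e - d e) * \<kappa> e) * \<kappa>y e * (L e - d e)) (x\<^sub>3 e) (nh e * \<kappa>y e * y e)"
  proof (rule eventually_tent_signs[OF nx1 lims(20) lims(5) \<beta> m lims(16) lims(9) r3 r4 pos(2) K0])
    show "\<forall>\<^sub>F e in at_right 0. 0 < L e - d e \<and> 0 < y e \<and> 0 < c e \<and> 0 < b e / y e \<and> 0 < \<kappa>y e \<and>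
        0 < d e * y e / ((L e - d e) * \<kappa> e) \<and> c e * \<kappa>y e = c e * \<kappa> e / b e * (b e / y e)"
      using params h
    proof eventually_elim
      case (elim e)
      have "c e * (\<kappa> e / y e) = c e * \<kappa> e / b e * (b e / y e)" using elim by simp
      moreover have "0 < d e * y e / ((L e - d e) * \<kappa> e)" "0 < \<kappa> e / y e" "0 < b e / y e" using elim by simp_all
      ultimately show ?case using elim by metis
    qed
    show "\<forall>\<^sub>F e in at_right 0. 0 < c e * (y e - m e * \<kappa>y e * y e) - b e / y e * y e * - x\<^sub>1 e"
      using params E m_eq by eventually_elim (simp add: K_def)
  qed
  have signs': "\<forall>\<^sub>F e in at_right 0. tent_signs (c e) (b e) (L e - d e) (- x\<^sub>1 e) (K e - \<tau> e) (y e) (d e) (x\<^sub>3 e) (n e)"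
    using signs params m_eq h
  proof eventually_elim
    case (elim e)
    have "d e * y e / ((L e - d e) * \<kappa> e) * \<kappa>y e * (L e - d e) = d e" "nh e * \<kappa>y e * y e = n e" "b e / y e * y e = b e"
      using elim(2,4) by (simp_all add: n_def)
    then show ?case using elim(1,3) by simp
  qed
  have l0: "((\<lambda>e. (x\<^sub>1 e+t e+2*f\<^sub>1 e-z e)*(n e-y e-B e+\<eta>) - (\<eta>+2*f\<^sub>2 e-y e+K e-B e)*(x\<^sub>3 e+g e-z e)) \<longlongrightarrow>
      (-X+0+2*\<phi>\<^sub>1-z 0)*(0-y 0-B 0+\<eta>) - (\<eta>+2*\<phi>\<^sub>2-y 0+0-B 0)*(X+0-z 0)) (at_right 0)"
    by (intro tendsto_intros lims)
  then have e0: "\<forall>\<^sub>F e in at_right 0. (x\<^sub>1 e+t e+2*f\<^sub>1 e-z e)*(n e-y e-B e+\<eta>) - (\<eta>+2*f\<^sub>2 e-y e+K e-B e)*(x\<^sub>3 e+g e-z e) > 0"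
    by (rule order_tendstoD(1)) (use O0 in \<open>simp add: algebra_simps\<close>)
  have "((\<lambda>e. - (x\<^sub>1 e+t e)*(2-\<kappa>y e*nh e-\<kappa>y e*Kh e) - \<kappa>y e*Kh e*(x\<^sub>1 e+t e+x\<^sub>3 e+g e)) \<longlongrightarrow>
      - (-X+0)*(2-0*n\<^sub>0-0*K\<^sub>0) - 0*K\<^sub>0*(-X+0+X+0)) (at_right 0)"
    by (intro tendsto_intros lims)
  then have e1: "\<forall>\<^sub>F e in at_right 0. - (x\<^sub>1 e+t e)*(2-\<kappa>y e*nh e-\<kappa>y e*Kh e) - \<kappa>y e*Kh e*(x\<^sub>1 e+t e+x\<^sub>3 e+g e) > 0"
    by (rule order_tendstoD(1)) (use pos(2) in simp)
  \<comment> \<open>The orientation of the triangle 3, 4, 6 multiplied by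
    \<open>f\<^sub>1/y\<close>. When \<open>y\<close> tends to 0, both \<open>2*y - n - K\<close>
    and \<open>x\<^sub>1 + t + x\<^sub>3 + g\<close> do so too; equation \<open>x1\<close> rewrites
    the latter so that a factor \<open>y\<close> splits off and a nonzero limit remains. The
    preceding expression is divided by \<open>y\<close> for the same reason.\<close>
  have "((\<lambda>e. (2-\<kappa>y e*nh e-\<kappa>y e*Kh e)*(f\<^sub>1 e*(x\<^sub>3 e+g e-f\<^sub>1 e)+(n e-y e-f\<^sub>2 e)*f\<^sub>2 e) + (n e-y e-f\<^sub>2 e)*(\<tau> e-d e*dy e)) \<longlongrightarrow>
      (2-0*n\<^sub>0-0*K\<^sub>0)*(\<phi>\<^sub>1*(X+0-\<phi>\<^sub>1)+(0-y 0-\<phi>\<^sub>2)*\<phi>\<^sub>2) + (0-y 0-\<phi>\<^sub>2)*(0-0*0)) (at_right 0)"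
    by (intro tendsto_intros lims)
  then have e3: "\<forall>\<^sub>F e in at_right 0. (2-\<kappa>y e*nh e-\<kappa>y e*Kh e)*(f\<^sub>1 e*(x\<^sub>3 e+g e-f\<^sub>1 e)+(n e-y e-f\<^sub>2 e)*f\<^sub>2 e) + (n e-y e-f\<^sub>2 e)*(\<tau> e-d e*dy e) < 0"
    by (rule order_tendstoD(2)) (use O3 in simp)
  have "((\<lambda>e. (x\<^sub>3 e+g e)*(n e-y e-B e+\<eta>) - n e*(x\<^sub>3 e+g e-z e)) \<longlongrightarrow> (X+0)*(0-y 0-B 0+\<eta>) - 0*(X+0-z 0)) (at_right 0)"
    by (intro tendsto_intros lims)
  then have e4: "\<forall>\<^sub>F e in at_right 0. (x\<^sub>3 e+g e)*(n e-y e-B e+\<eta>) - n e*(x\<^sub>3 e+g e-z e) > 0"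
    by (rule order_tendstoD(1)) (use mult_pos_pos[OF pos(2) O4] in \<open>simp add: algebra_simps\<close>)
  have "((\<lambda>e. - (x\<^sub>1 e+t e)) \<longlongrightarrow> - (-X+0)) (at_right 0)" by (intro tendsto_intros lims)
  then have e5: "\<forall>\<^sub>F e in at_right 0. - (x\<^sub>1 e+t e) > 0" by (rule order_tendstoD(1)) (use pos(2) in simp)
  have e5': "\<forall>\<^sub>F e in at_right 0. Kh e > 0" by (rule order_tendstoD(1)[OF lims(15) K0(1)])
  from signs' e0 e1 e3 e4 e5 e5' O6 params near_0
  show ?thesis
  proof eventually_elim
    case (elim e)
    interpret pup_equations \<eta> "L e" "d e" "y e" "b e" "B e" "z e" "c e" "g e" "n e" "x\<^sub>1 e" "x\<^sub>3 e" "t e" "\<tau> e" "K e" "f\<^sub>1 e" "f\<^sub>2 e"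
      using equations[of e] \<tau>_eq[of e] elim(10) unfolding g_def t_def n_def K_def by simp
    interpret tent_signs "c e" "b e" "L e - d e" "- x\<^sub>1 e" "K e - \<tau> e" "y e" "d e" "x\<^sub>3 e" "n e" by (rule elim(1))
    have v: "vertices e = tent (vector [c e, b e, L e - d e]) (vector [x\<^sub>1 e, K e - y e - \<tau> e, d e]) (vector [0, - y e, - d e])
        (vector [x\<^sub>3 e, n e - y e, 0])" by (simp add: vertices_def n_def K_def)
    have P: "y e > 0" "z e > 0" "\<kappa> e > 0" "\<eta> > y e" "\<eta> - y e + B e > 0" "f\<^sub>1 e > 0" "x\<^sub>3 e > 0" "G e > 0" "d e > 0" using elim(9) by auto
    have ky: "\<kappa> e = \<kappa>y e * y e" "d e = dy e * y e" using elim(9) by auto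
    have gp: "g e > 0" using P by (simp add: g_def)
    have "cone_angle (vertices e) v = 2 * pi" for v
      unfolding v
    proof (rule cone_angle_tent)
      show "(x\<^sub>1 e+t e+2*f\<^sub>1 e-z e)*(n e-y e-B e+\<eta>) - (\<eta>+2*f\<^sub>2 e-y e+K e-B e)*(x\<^sub>3 e+g e-z e) > 0" by (fact elim(2))
      have "- (x\<^sub>1 e+t e)*(2*y e-n e-K e) - K e*(x\<^sub>1 e+t e+x\<^sub>3 e+g e) =
          y e * (- (x\<^sub>1 e+t e)*(2-\<kappa>y e*nh e-\<kappa>y e*Kh e) - \<kappa>y e*Kh e*(x\<^sub>1 e+t e+x\<^sub>3 e+g e))"
        unfolding n_def K_def ky(1) by (simp add: algebra_simps)
      then show "- (x\<^sub>1 e+t e)*(2*y e-n e-K e) - K e*(x\<^sub>1 e+t e+x\<^sub>3 e+g e) > 0" using elim(3) P(1) by (metis mult_pos_pos)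
      show "y e * (x\<^sub>3 e + g e) > 0" using P gp by simp
      have Y: "2 * y e - n e - K e = y e * (2-\<kappa>y e*nh e-\<kappa>y e*Kh e)" unfolding n_def K_def ky(1) by (simp add: algebra_simps)
      have dd: "(d e)\<^sup>2 = y e * (d e * dy e)" using ky(2) by (metis mult.assoc mult.commute power2_eq_square)
      have "f\<^sub>1 e * ((x\<^sub>3 e+g e-f\<^sub>1 e)*(2*y e-n e-K e) + (n e-y e-f\<^sub>2 e)*(x\<^sub>1 e+t e+x\<^sub>3 e+g e)) =
          f\<^sub>1 e * (x\<^sub>3 e+g e-f\<^sub>1 e)*(2*y e-n e-K e) + (n e-y e-f\<^sub>2 e)*((x\<^sub>1 e+x\<^sub>3 e+g e+t e)*f\<^sub>1 e)"
        by (simp add: algebra_simps)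
      also have "\<dots> = y e * ((2-\<kappa>y e*nh e-\<kappa>y e*Kh e)*(f\<^sub>1 e*(x\<^sub>3 e+g e-f\<^sub>1 e)+(n e-y e-f\<^sub>2 e)*f\<^sub>2 e) + (n e-y e-f\<^sub>2 e)*(\<tau> e-d e*dy e))"
        unfolding x1 Y dd by (simp add: algebra_simps)
      also have "\<dots> < 0" using elim(4) P(1) by (simp add: mult_pos_neg)
      finally show "(x\<^sub>3 e+g e-f\<^sub>1 e)*(2*y e-n e-K e) + (n e-y e-f\<^sub>2 e)*(x\<^sub>1 e+t e+x\<^sub>3 e+g e) < 0"
        using P(6) by (simp add: mult_less_0_iff)
      show "(x\<^sub>3 e+g e)*(n e-y e-B e+\<eta>) - n e*(x\<^sub>3 e+g e-z e) > 0" by (fact elim(5))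
      have "- (x\<^sub>1 e+t e)*(\<eta>-y e+B e) > 0" "K e * z e > 0" using elim(6,7) P by (simp_all add: K_def mult_neg_pos)
      then show "- (x\<^sub>1 e+t e)*(\<eta>-y e+B e) + K e*z e > 0" by linarith
      show "(x\<^sub>1 e+t e+2*f\<^sub>1 e-z e)*(\<eta>+f\<^sub>2 e-y e+K e) - (\<eta>+2*f\<^sub>2 e-y e+K e-B e)*(x\<^sub>1 e+t e+f\<^sub>1 e) > 0"
        using elim(8) unfolding t_def K_def .
      show "z e * (\<eta> - y e) > 0" using P by simp
    qed
    moreover have "pup_signs_vec (vertices e)"
    proof -
      have "K e - \<tau> e - y e = K e - y e - \<tau> e" by simp
      then show ?thesis unfolding v using pup_signs_vec_tent by (simp only: minus_minus)
    qed
    ultimately show ?case by (rule pup_signs_vec.pup_tentI[rotated])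
  qed
qed

end

subsection \<open>Two collapsing families\<close>

lemma (in tent_solution) pup_tent_path:
  assumes "\<forall>\<^sub>F e in at_right 0. pup_tent (vertices e)"
  shows "\<exists>s>0::real. \<exists>p. continuous_on {0..s} p \<and>
    p 0 = tent (vector [c 0, b 0, L 0]) (vector [- X, - y 0, 0]) (vector [0, - y 0, 0]) (vector [X, - y 0, 0]) \<and>
    (\<forall>e\<in>{0<..s}. pup_tent (p e))"
proof -
  obtain s where s: "s > 0" "\<And>e. 0 < e \<Longrightarrow> e < s \<Longrightarrow> pup_tent (vertices e)"
    using assms unfolding eventually_at_right_field by blast
  have "continuous_on {0..min q (s/2)} vertices" by (rule continuous_on_subset[OF continuous_vertices]) auto
  moreover have "\<forall>e\<in>{0<..min q (s/2)}. pup_tent (vertices e)" "min q (s/2) > 0" using s q(1) by auto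
  ultimately show ?thesis using vertices_0 by blast
qed

text \<open>The vertices at 0 span the trapezoid with base from -1 to 1, top from \<open>- C\<close>
  to \<open>C\<close> and height \<open>\<eta>\<close>; the value of \<open>\<eta>\<close> makes the
  diagonals equal to 2. The scales are \<open>y = e\<close> and \<open>\<kappa> = d = e^4\<close>,
  so that \<open>\<kappa>/y\<close> is \<open>e^3\<close> and \<open>d*y/((L - d)*\<kappa>)\<close>
  is about \<open>e/\<eta>\<close>.\<close>

lemma trapezoid_path:
  fixes C :: real
  assumes C: "0 \<le> C" "C < 1"
  shows "\<exists>s>0::real. \<exists>p. continuous_on {0..s} p \<and>
    p 0 = tent (vector [C, 0, sqrt (4 - (1 + C)\<^sup>2)]) (vector [- 1, 0, 0]) (vector [0, 0, 0]) (vector [1, 0, 0]) \<and>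
    (\<forall>e\<in>{0<..s}. pup_tent (p e))"
proof -
  define \<eta> where "\<eta> = sqrt (4 - (1 + C)\<^sup>2)"
  have "(1 + C)\<^sup>2 < 2\<^sup>2" using C by (intro power_strict_mono) auto
  then have \<eta>: "\<eta> > 0" "\<eta>\<^sup>2 = 4 - (1 + C)\<^sup>2" by (simp_all add: \<eta>_def)
  define L where "L e = sqrt (\<eta>\<^sup>2 - 2*\<eta>*e)" for e
  \<comment> \<open>The shift by \<open>e\<close> keeps \<open>c\<close> positive when
    \<open>C = 0\<close>, the case of the equilateral triangle.\<close>
  define c where "c e = C + e" for e
  \<comment> \<open>The difference \<open>z - c\<close> is of order \<open>\<kappa>\<close>. The
    factor 4 makes \<open>K\<^sub>0 = 4 - 2\<close> and \<open>n\<^sub>0 = 4 - 1\<close>, and being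
    a square it leads to the factor 2 in \<open>b\<close>.\<close>
  define z where "z e = c e + 4 * L e * e^4" for e
  \<comment> \<open>Forced by equation \<open>zB\<close>: with \<open>B\<close> as in equation
    \<open>B\<close>, the difference \<open>b^2 - B^2\<close> is \<open>4 * e^4 * S^2 * L^2\<close>,
    which has to equal \<open>z^2 - c^2\<close>.\<close>
  define S where "S e = sqrt ((2 * c e + 4 * L e * e^4) / L e)" for e
  define w where "w e = 2 * \<eta> * e\<^sup>2 * S e" for e
  define b where "b e = (\<eta> - e) * (2 * e\<^sup>2 * S e)" for e
  define B where "B e = - (e * (2 * e\<^sup>2 * S e))" for e
  define d where "d e = e^4" for e :: real
  have bB: "b e - B e = w e" for e by (simp add: b_def B_def w_def algebra_simps)
  have L2: "L e > 0" "(L e)\<^sup>2 = \<eta>\<^sup>2 - 2*\<eta>*e" if "e \<le> \<eta>/4" for e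
  proof -
    have "2*\<eta>*e \<le> 2*\<eta>*(\<eta>/4)" using that \<eta> by (intro mult_left_mono) auto
    also have "\<dots> < \<eta>\<^sup>2" using \<eta>(1) by (simp add: power2_eq_square)
    finally show "L e > 0" "(L e)\<^sup>2 = \<eta>\<^sup>2 - 2*\<eta>*e" by (simp_all add: L_def)
  qed
  have cL: "continuous_on A L" for A unfolding L_def[abs_def] by (intro continuous_intros)
  have cS: "continuous_on {0..\<eta>/4} S" unfolding S_def[abs_def] c_def
    by (intro continuous_intros cL) (use L2(1) in \<open>auto simp: less_imp_neq[symmetric]\<close>)
  have cw: "continuous_on {0..\<eta>/4} (\<lambda>e. \<eta> - w e)" unfolding w_def by (intro continuous_intros cS)
  have cB: "continuous_on {0..\<eta>/4} (\<lambda>e. \<eta> - e + B e)" unfolding B_def by (intro continuous_intros cS)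
  have "\<eta> - w 0 > 0" "\<eta> - 0 + B 0 > 0" using \<eta> by (simp_all add: w_def B_def)
  then obtain r1 r2 where r1: "0 < r1" "r1 \<le> \<eta>/4" "\<And>e. e \<in> {0..r1} \<Longrightarrow> \<eta> - w e > 0"
    and r2: "0 < r2" "r2 \<le> \<eta>/4" "\<And>e. e \<in> {0..r2} \<Longrightarrow> \<eta> - e + B e > 0"
    using positive_near_0[OF cw] positive_near_0[OF cB] \<eta>(1) by (metis divide_pos_pos zero_less_numeral)
  define r where "r = min r1 r2"
  have r: "r > 0" "r \<le> \<eta>/4" "\<And>e. e \<in> {0..r} \<Longrightarrow> \<eta> - w e > 0" "\<And>e. e \<in> {0..r} \<Longrightarrow> \<eta> - e + B e > 0"
    using r1 r2 by (auto simp: r_def)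
  have cS: "continuous_on {0..r} S" by (rule continuous_on_subset[OF cS]) (use r in auto)
  have S0: "S e \<ge> 0" "w e \<ge> 0" "b e \<ge> 0" if "e \<in> {0..r}" for e
  proof -
    show 1: "S e \<ge> 0" using that r(2) L2(1)[of e] C by (simp add: S_def c_def)
    show "w e \<ge> 0" "b e \<ge> 0" using 1 that r(2) \<eta> by (simp_all add: w_def b_def)
  qed
  have S2: "(S e)\<^sup>2 = (2 * c e + 4 * L e * e^4) / L e" "S e > 0" if "e \<in> {0<..r}" for e
    using that r(2) L2(1)[of e] C by (simp_all add: S_def c_def add_pos_pos add_nonneg_pos)
  define p1 p2 p3 where "p1 e = z e * e^4/(\<eta> + w e)" and "p2 e = L e/(\<eta> + w e)" and "p3 e = 4 * L e/(\<eta> + w e)" for e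
  define q1 q2 q3 where "q1 e = 2 * L e/(\<eta> - w e)" and "q2 e = (b e - e) * e^3/(\<eta> - w e)" and "q3 e = z e * e^4/(\<eta> - w e)" for e
  define q4 where "q4 e = 4 * L e/(\<eta> - w e)" for e
  define cube where "cube e = e^3" for e :: real
  note defs = L_def c_def z_def w_def b_def B_def d_def p1_def p2_def p3_def q1_def q2_def q3_def q4_def cube_def
  have L0: "L 0 = \<eta>" using \<eta>(1) by (simp add: L_def)
  \<comment> \<open>The radicand of \<open>\<phi>\<^sub>1\<close> is a perfect square, so that
    \<open>\<phi>\<^sub>1 = (3 + C)/2\<close> and \<open>X = 1\<close> for every
    \<open>C\<close>.\<close>
  have sq: "C\<^sup>2 + \<eta>\<^sup>2 - (\<eta>/2)\<^sup>2 = ((3 - C)/2)\<^sup>2" using \<eta>(2) by (simp add: power2_eq_square field_simps)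
  have sq': "sqrt (C\<^sup>2 + \<eta>\<^sup>2 - (\<eta>/2)\<^sup>2) = (3 - C)/2" unfolding sq using C by simp
  interpret tent_family \<eta> 1 r L "\<lambda>e. e" z B c b d d p1 p2 p3 q1 q2 q3 q4 cube cube cube
  proof
    show "\<eta> > 0" "(1::real) > 0" "r > 0" using \<eta> r by auto
    have nz: "\<eta> + w e \<noteq> 0" "\<eta> - w e \<noteq> 0" if "e \<in> {0..r}" for e
      using r(3)[OF that] S0(2)[OF that] \<eta> by auto
    show cw: "continuous_on {0..r} L" "continuous_on {0..r} (\<lambda>e. e)" "continuous_on {0..r} d" "continuous_on {0..r} cube" "continuous_on {0..r} c"
      unfolding d_def[abs_def] cube_def[abs_def] c_def[abs_def] by (intro continuous_intros cL)+
    show cb: "continuous_on {0..r} B" "continuous_on {0..r} b" unfolding B_def[abs_def] b_def[abs_def] by (intro continuous_intros cS)+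
    have cw': "continuous_on {0..r} w" unfolding w_def[abs_def] by (intro continuous_intros cS)
    show cz: "continuous_on {0..r} z" unfolding z_def[abs_def] by (intro continuous_intros cw)
    show "continuous_on {0..r} p1" "continuous_on {0..r} p2" "continuous_on {0..r} p3"
      "continuous_on {0..r} q1" "continuous_on {0..r} q2" "continuous_on {0..r} q3" "continuous_on {0..r} q4"
      unfolding p1_def[abs_def] p2_def[abs_def] p3_def[abs_def] q1_def[abs_def] q2_def[abs_def] q3_def[abs_def] q4_def[abs_def]
      by (intro continuous_intros cw cw' cz cb; use nz in auto)+
    show "d 0 = 0" "p1 0 = 0" "q2 0 = 0" "q3 0 = 0" "cube 0 = 0"
      by (simp_all add: defs)
    have R: "z 0 = C" "C\<^sup>2 + (L 0)\<^sup>2 - ((L 0)\<^sup>2 / (2 * \<eta>))\<^sup>2 - B 0 * (L 0)\<^sup>2 / \<eta> = C\<^sup>2 + \<eta>\<^sup>2 - (\<eta>/2)\<^sup>2"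
      using \<eta>(1) unfolding L0 by (simp_all add: z_def c_def B_def power2_eq_square)
    show "0 < (z 0)\<^sup>2 + (L 0)\<^sup>2 - ((L 0)\<^sup>2 / (2 * \<eta>))\<^sup>2 - B 0 * (L 0)\<^sup>2 / \<eta>" unfolding R sq using C by simp
    show "0 < z 0 + sqrt ((z 0)\<^sup>2 + (L 0)\<^sup>2 - ((L 0)\<^sup>2 / (2 * \<eta>))\<^sup>2 - B 0 * (L 0)\<^sup>2 / \<eta>)" unfolding R sq' using C by (simp add: field_simps)
    show "2 * 1 * (z 0 + sqrt ((z 0)\<^sup>2 + (L 0)\<^sup>2 - ((L 0)\<^sup>2 / (2 * \<eta>))\<^sup>2 - B 0 * (L 0)\<^sup>2 / \<eta>)) =
      (z 0 + sqrt ((z 0)\<^sup>2 + (L 0)\<^sup>2 - ((L 0)\<^sup>2 / (2 * \<eta>))\<^sup>2 - B 0 * (L 0)\<^sup>2 / \<eta>))\<^sup>2 + ((L 0)\<^sup>2 / (2 * \<eta>))\<^sup>2"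
      unfolding R sq' using \<eta> unfolding L0 by (simp add: power2_eq_square field_simps)
    show "0 * L 0 = 0" by simp
    fix e :: real assume e: "0 < e" "e \<le> r"
    then have e': "e \<in> {0..r}" "e \<in> {0<..r}" "e \<le> \<eta>/4" using r(2) by auto
    have Sp: "S e > 0" using S2(2)[OF e'(2)] .
    have Lp: "L e > 0" using L2(1)[OF e'(3)] .
    have cp: "c e > 0" using e C by (simp add: c_def)
    have zp: "z e > 0" using cp Lp e by (simp add: z_def add_pos_pos)
    have bp: "b e > 0" using Sp e e'(3) \<eta>(1) by (simp add: b_def)
    show "0 < L e \<and> 0 < e \<and> 0 < z e \<and> 0 < d e \<and> 0 < d e \<and> 0 < c e \<and> 0 < b e \<and> e < \<eta> \<and> 0 < \<eta> - e + B e \<and>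
      0 < \<eta> + b e - B e \<and> 0 < \<eta> + B e - b e"
      using Lp e e'(3) cp zp bp \<eta>(1) r(3,4)[OF e'(1)] S0(2)[OF e'(1)] bB[of e]
      by (simp add: d_def)
    have "(b e)\<^sup>2 - (B e)\<^sup>2 = 4 * e^4 * (S e)\<^sup>2 * (L e)\<^sup>2"
      unfolding L2(2)[OF e'(3)] by (simp add: b_def B_def power2_eq_square power4_eq_xxxx algebra_simps)
    also have "\<dots> = 4 * e^4 * L e * (2 * c e + 4 * L e * e^4)" using Lp unfolding S2(1)[OF e'(2)] by (simp add: power2_eq_square)
    also have "\<dots> = (z e)\<^sup>2 - (c e)\<^sup>2" by (simp add: z_def power2_eq_square algebra_simps)
    finally show "(L e)\<^sup>2 = \<eta>\<^sup>2 - 2 * \<eta> * e \<and> (z e)\<^sup>2 + (B e)\<^sup>2 = (c e)\<^sup>2 + (b e)\<^sup>2 \<and> (\<eta> - e) * B e = - (e * b e)"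
      using L2(2)[OF e'(3)] by (simp add: b_def B_def)
    have ww: "\<eta> + b e - B e = \<eta> + w e" "\<eta> + B e - b e = \<eta> - w e" using bB[of e] by auto
    show "p1 e = z e * (d e)\<^sup>2 / (d e * (\<eta> + b e - B e)) \<and> p2 e = L e * d e / (d e * (\<eta> + b e - B e)) \<and>
      p3 e = (z e - c e) / (d e * (\<eta> + b e - B e)) \<and> q1 e = 2 * L e * d e / (d e * (\<eta> + B e - b e)) \<and>
      q2 e = (b e - e) * (d e)\<^sup>2 / (e * d e * (\<eta> + B e - b e)) \<and> q3 e = z e * (d e)\<^sup>2 / (d e * (\<eta> + B e - b e)) \<and>
      q4 e = (z e - c e) / (d e * (\<eta> + B e - b e)) \<and> cube e = d e / e \<and> cube e = d e / e \<and> cube e = (d e)\<^sup>2 / (e * d e)"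
      unfolding ww using e nz[OF e'(1)]
      by (intro conjI; simp add: p1_def p2_def p3_def q1_def q2_def q3_def q4_def cube_def d_def z_def power2_eq_square power3_eq_cube power4_eq_xxxx)
  qed
  obtain q T \<sigma> G Kh nh f1 f2 x1 x3 where sol:
    "tent_solution \<eta> 1 r L (\<lambda>e. e) z B c b d d p1 p2 p3 q1 q2 q3 q4 cube cube cube q T \<sigma> G Kh nh f1 f2 x1 x3"
    using solution by blast
  interpret tent_solution \<eta> 1 r L "\<lambda>e. e" z B c b d d p1 p2 p3 q1 q2 q3 q4 cube cube cube q T \<sigma> G Kh nh f1 f2 x1 x3
    by (rule sol)
  have at0: "z 0 = C" "B 0 = 0" "w 0 = 0" "c 0 = C" "b 0 = 0" by (simp_all add: z_def B_def c_def w_def b_def)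
  have K0: "K\<^sub>0 = 2" unfolding K\<^sub>0_def q1_def q4_def L0 at0 using \<eta>(1) by simp
  have n0: "n\<^sub>0 = 3" unfolding n\<^sub>0_def p2_def p3_def L0 at0 using \<eta>(1) by simp
  have \<phi>2: "\<phi>\<^sub>2 = - \<eta>/2" unfolding \<phi>\<^sub>2_def L0 using \<eta>(1) by (simp add: power2_eq_square)
  have \<phi>1: "\<phi>\<^sub>1 = (3 + C)/2"
  proof -
    have "C\<^sup>2 + \<eta>\<^sup>2 - (- \<eta>/2)\<^sup>2 + 2 * 0 * (- \<eta>/2) = C\<^sup>2 + \<eta>\<^sup>2 - (\<eta>/2)\<^sup>2" by (simp add: power2_eq_square)
    then show ?thesis unfolding \<phi>\<^sub>1_def \<phi>2 L0 at0 using sq' by (simp add: field_simps)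
  qed
  have id: "((\<lambda>e::real. e) \<longlongrightarrow> 0) (at_right 0)" by (rule tendsto_ident_at)
  have Sl: "(S \<longlongrightarrow> S 0) (at_right 0)" by (rule continuous_on_Icc_at_rightD[OF cS r(1)])
  note lims = id Sl param_lims solution_lims \<tau>_lim
  have "((\<lambda>e. L e - d e) \<longlongrightarrow> \<eta> - 0) (at_right 0)" using lims unfolding L0 by (intro tendsto_intros) auto
  then have h: "\<forall>\<^sub>F e in at_right 0. L e - d e > 0" by (rule order_tendstoD(1)) (use \<eta>(1) in simp)
  have basic: "\<forall>\<^sub>F e in at_right 0. 0 < e \<and> L e > 0 \<and> S e > 0 \<and> \<eta> > e \<and> c e \<ge> e \<and> c e \<le> (S e)\<^sup>2 * L e / 2 \<and>
      (S e)\<^sup>2 = (2 * c e + 4 * L e * e^4) / L e"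
    using near_0
  proof eventually_elim
    case (elim e)
    then have e: "e \<in> {0<..r}" "e \<le> \<eta>/4" using r(2) by auto
    have "(S e)\<^sup>2 * L e = 2 * c e + 4 * L e * e^4" using S2(1)[OF e(1)] L2(1)[OF e(2)] by simp
    moreover have "4 * L e * e^4 > 0" using elim L2(1)[OF e(2)] by simp
    ultimately show ?case using elim e S2[OF e(1)] L2(1)[OF e(2)] \<eta>(1) C by (auto simp: c_def)
  qed
  have "\<forall>\<^sub>F e in at_right 0. pup_tent (vertices e)"
  proof (rule eventually_pup_tent[where \<beta>\<^sub>0 = 0])
    show "K\<^sub>0 > 0" "n\<^sub>0 \<ge> 0" by (simp_all add: K0 n0)
    have "((\<lambda>e. e / (L e - e^4)) \<longlongrightarrow> 0 / (\<eta> - 0^4)) (at_right 0)"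
      using lims(3) \<eta>(1) unfolding L0 by (intro tendsto_intros id) auto
    then have "((\<lambda>e. e / (L e - e^4)) \<longlongrightarrow> 0) (at_right 0)" by simp
    then show "((\<lambda>e. d e * e / ((L e - d e) * d e)) \<longlongrightarrow> 0) (at_right 0)"
      by (rule Lim_transform_eventually) (use basic in \<open>eventually_elim, simp add: d_def\<close>)
    have up: "((\<lambda>e. S e * L e * e\<^sup>2/(4 * (\<eta> - e))) \<longlongrightarrow> S 0 * \<eta> * 0\<^sup>2/(4 * (\<eta> - 0))) (at_right 0)"
      using lims(3) \<eta>(1) unfolding L0 by (intro tendsto_intros id Sl) auto
    show "((\<lambda>e. c e * d e / b e) \<longlongrightarrow> 0) (at_right 0)"
    proof (rule tendsto_sandwich[OF _ _ tendsto_const])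
      show "\<forall>\<^sub>F e in at_right 0. 0 \<le> c e * d e / b e"
        using basic by eventually_elim (auto simp: d_def b_def)
      show "\<forall>\<^sub>F e in at_right 0. c e * d e / b e \<le> S e * L e * e\<^sup>2/(4 * (\<eta> - e))"
        using basic
      proof eventually_elim
        case (elim e)
        have "c e * d e / b e = c e * (e\<^sup>2 / (2 * (\<eta> - e) * S e))"
          using elim by (simp add: d_def b_def power2_eq_square power4_eq_xxxx)
        also have "\<dots> \<le> ((S e)\<^sup>2 * L e / 2) * (e\<^sup>2 / (2 * (\<eta> - e) * S e))"
          using elim by (intro mult_right_mono) auto
        also have "\<dots> = S e * L e * e\<^sup>2/(4 * (\<eta> - e))"
        proof -
          have "a\<^sup>2 * l / 2 * (v / (2 * u * a)) = a * l * v / (4 * u)" if "a \<noteq> 0" for a l u v :: real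
            using that by (cases "u = 0") (auto simp: field_simps power2_eq_square)
          from this[of "S e" "L e" "e\<^sup>2" "\<eta> - e"] show ?thesis using elim by simp
        qed
        finally show ?case .
      qed
      show "((\<lambda>e. S e * L e * e\<^sup>2/(4 * (\<eta> - e))) \<longlongrightarrow> 0) (at_right 0)" using up by simp
    qed
    have "((\<lambda>e. (\<eta> - e) * (2 * e * S e)) \<longlongrightarrow> (\<eta> - 0) * (2 * 0 * S 0)) (at_right 0)"
      by (intro tendsto_intros id Sl)
    then have "((\<lambda>e. (\<eta> - e) * (2 * e * S e)) \<longlongrightarrow> 0) (at_right 0)" by simp
    then show "((\<lambda>e. b e / e) \<longlongrightarrow> 0) (at_right 0)"
      by (rule Lim_transform_eventually) (use basic in \<open>eventually_elim, simp add: b_def power2_eq_square\<close>)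
    show "\<forall>\<^sub>F e in at_right 0. L e - d e > 0" by (rule h)
    \<comment> \<open>For \<open>C = 0\<close> both \<open>S\<close> and \<open>c\<close> tend to 0;
      the bound \<open>e \<le> c\<close> still controls the square of the quotient. This is the
      statement that \<open>b\<close> is small against \<open>c*y\<close>.\<close>
    have se: "((\<lambda>e. S e * e / c e) \<longlongrightarrow> 0) (at_right 0)"
    proof (rule tendsto_sandwich[OF _ _ tendsto_const])
      show "\<forall>\<^sub>F e in at_right 0. 0 \<le> S e * e / c e" using basic by eventually_elim auto
      show "\<forall>\<^sub>F e in at_right 0. S e * e / c e \<le> sqrt (2 * e / L e + 4 * e^4)"
        using basic
      proof eventually_elim
        case (elim e)
        have c: "c e > 0" "e / c e \<le> 1" "e / c e \<ge> 0" using elim by auto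
        have "(S e * e / c e)\<^sup>2 = (2 * c e / L e + 4 * e^4) * (e/c e)\<^sup>2"
          using elim by (simp add: power_mult_distrib power_divide add_divide_distrib)
        also have "\<dots> = (2 * e / L e) * (e / c e) + 4 * e^4 * (e/c e)\<^sup>2"
        proof -
          have cl: "2 * c e / L e * (e / c e) = 2 * e / L e" using c by simp
          show ?thesis by (simp only: distrib_right power2_eq_square mult.assoc[symmetric] cl)
        qed
        also have "\<dots> \<le> (2 * e / L e) * 1 + 4 * e^4 * 1"
          using elim c by (intro add_mono mult_left_mono) (auto simp: power_le_one)
        finally show ?case by (intro real_le_rsqrt) simp
      qed
      have "((\<lambda>e. sqrt (2 * e / L e + 4 * e^4)) \<longlongrightarrow> sqrt (2 * 0 / \<eta> + 4 * 0^4)) (at_right 0)"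
        using lims(3) \<eta>(1) unfolding L0 by (intro tendsto_intros id) auto
      then show "((\<lambda>e. sqrt (2 * e / L e + 4 * e^4)) \<longlongrightarrow> 0) (at_right 0)" by simp
    qed
    have "((\<lambda>e. 1 - e^3 * Kh e + e^6 * \<sigma> e / (2 - cube e * nh e) + 2 * (\<eta> - e) * (S e * e / c e) * x1 e) \<longlongrightarrow>
        1 - 0^3 * K\<^sub>0 + 0^6 * \<sigma> 0 / (2 - 0 * n\<^sub>0) + 2 * (\<eta> - 0) * 0 * (- 1)) (at_right 0)"
      by (intro tendsto_intros lims se) simp
    then have "\<forall>\<^sub>F e in at_right 0. 1 - e^3 * Kh e + e^6 * \<sigma> e / (2 - cube e * nh e) + 2 * (\<eta> - e) * (S e * e / c e) * x1 e > 0"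
      by (rule order_tendstoD(1)) simp
    then show "\<forall>\<^sub>F e in at_right 0. 0 < c e * (e - (d e * Kh e - \<tau> e)) + b e * x1 e"
      using basic
    proof eventually_elim
      case (elim e)
      have t: "\<tau> e = e * (e^6 * \<sigma> e / (2 - cube e * nh e))" by (simp add: \<tau>_def d_def cube_def power_numeral_reduce mult.assoc)
      have bb: "b e = c e * e * (2 * (\<eta> - e) * (S e * e / c e))" using elim by (simp add: b_def power2_eq_square)
      have "c e * (e - (d e * Kh e - \<tau> e)) + b e * x1 e =
         c e * e * (1 - e^3 * Kh e + e^6 * \<sigma> e / (2 - cube e * nh e) + 2 * (\<eta> - e) * (S e * e / c e) * x1 e)"
        unfolding t bb by (simp add: d_def algebra_simps power_numeral_reduce)
      moreover have "c e * e > 0" using elim by simp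
      ultimately show ?case using elim(1) by (metis mult_pos_pos)
    qed
    show "0 < (2 * \<phi>\<^sub>1 - 1 - z 0) * (\<eta> - 0 - B 0) - (\<eta> + 2 * \<phi>\<^sub>2 - 0 - B 0) * (1 - z 0)"
      unfolding \<phi>1 \<phi>2 at0 using \<eta>(1) by (simp add: algebra_simps)
    have "(3 + C)/2 * (1 - (3 + C)/2) < 0" using C by (intro mult_pos_neg) auto
    moreover have "(- \<eta>/2) * (- \<eta>/2) > 0" using \<eta>(1) by simp
    ultimately show "\<phi>\<^sub>1 * (1 - \<phi>\<^sub>1) + (- 0 - \<phi>\<^sub>2) * \<phi>\<^sub>2 < 0" unfolding \<phi>1 \<phi>2 by simp
    show "0 < \<eta> - 0 - B 0" using \<eta>(1) at0 by simp
    have "((\<lambda>e. (x1 e + (d e)\<^sup>2 * (G e * T e) + 2 * f1 e - z e) * (\<eta> + f2 e - e + d e * Kh e) -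
        (\<eta> + 2 * f2 e - e + d e * Kh e - B e) * (x1 e + (d e)\<^sup>2 * (G e * T e) + f1 e)) \<longlongrightarrow>
       (- 1 + 0\<^sup>2 * (G 0 * T 0) + 2 * \<phi>\<^sub>1 - z 0) * (\<eta> + \<phi>\<^sub>2 - 0 + 0 * K\<^sub>0) -
        (\<eta> + 2 * \<phi>\<^sub>2 - 0 + 0 * K\<^sub>0 - B 0) * (- 1 + 0\<^sup>2 * (G 0 * T 0) + \<phi>\<^sub>1)) (at_right 0)"
      by (intro tendsto_intros lims)
    then show "\<forall>\<^sub>F e in at_right 0. 0 < (x1 e + (d e)\<^sup>2 * (G e * T e) + 2 * f1 e - z e) * (\<eta> + f2 e - e + d e * Kh e) -
        (\<eta> + 2 * f2 e - e + d e * Kh e - B e) * (x1 e + (d e)\<^sup>2 * (G e * T e) + f1 e)"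
      by (rule order_tendstoD(1)) (use \<eta>(1) in \<open>simp add: \<phi>1 \<phi>2 at0 algebra_simps\<close>)
  qed
  from pup_tent_path[OF this] show ?thesis unfolding at0 L0 by (simp add: \<eta>_def)
qed

text \<open>Here \<open>L = e^2\<close> tends to 0 and \<open>y\<close> is determined by equation
  \<open>L\<close>. The coefficient \<open>\<eta> + B - b\<close> of \<open>K\<close> is only of
  order \<open>e\<close>, and \<open>z - k\<close> is of order \<open>e^4\<close>, whence
  \<open>K\<close> has order \<open>e^3\<close>; this is the choice of \<open>\<kappa>\<close>. The
  value \<open>d = e^8\<close> is far below \<open>L*\<kappa> = e^5\<close>.\<close>

lemma rectangle_path:
  fixes k \<eta> :: real
  assumes k: "k > 0" and \<eta>: "\<eta> > 0"
  shows "\<exists>s>0::real. \<exists>p. continuous_on {0..s} p \<and>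
    p 0 = tent (vector [k, \<eta>/2, 0]) (vector [- k, - \<eta>/2, 0]) (vector [0, - \<eta>/2, 0]) (vector [k, - \<eta>/2, 0]) \<and>
    (\<forall>e\<in>{0<..s}. pup_tent (p e))"
proof -
  define L where "L e = e\<^sup>2" for e :: real
  define y where "y e = (\<eta>\<^sup>2 - e^4)/(2*\<eta>)" for e
  \<comment> \<open>The deficit \<open>e\<close> decides the sign of \<open>c*(y - m) - b*a\<close>:
    at the limit \<open>c = a = k\<close> and \<open>b = y\<close>, so the whole quantity is about
    \<open>k*e\<close>.\<close>
  define b where "b e = y e - e" for e
  define w where "w e = \<eta> * b e / (\<eta> - y e)" for e
  define B where "B e = - (y e * b e / (\<eta> - y e))" for e
  define c where "c e = k" for e :: real
  \<comment> \<open>The solution of equation \<open>zB\<close>, since \<open>b^2 - B^2\<close>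
    equals \<open>w^2 * L^2 / \<eta>^2\<close>.\<close>
  define z where "z e = sqrt (k\<^sup>2 + (w e)\<^sup>2 * e^4/\<eta>\<^sup>2)" for e
  define E where "E e = (w e)\<^sup>2/\<eta>\<^sup>2/(z e + k)" for e
  define D where "D e = (e^3 + \<eta>)/(\<eta> - y e)" for e
  define d where "d e = e^8" for e :: real
  define \<kappa> where "\<kappa> e = e^3" for e :: real
  have y0: "y 0 = \<eta>/2" using \<eta> by (simp add: y_def power2_eq_square)
  have cy: "continuous_on A y" for A unfolding y_def[abs_def] using \<eta> by (intro continuous_intros) auto
  have cy': "continuous_on {0..1} (\<lambda>e. y e)" "continuous_on {0..1} (\<lambda>e. y e - e)" by (intro continuous_intros cy)+
  have "y 0 > 0" "y 0 - 0 > 0" using \<eta> y0 by simp_all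
  then obtain r where r: "0 < r" "r \<le> 1" "\<And>e. e \<in> {0..r} \<Longrightarrow> y e - e > 0"
    using positive_near_0[OF cy'(2)] by (metis zero_less_one)
  have base: "y e > 0" "b e > 0" "y e \<le> \<eta> - y e" "\<eta> - y e > 0" "w e > 0" "z e \<ge> k" "z e + k > 0" if "e \<in> {0..r}" for e
  proof -
    show b: "b e > 0" using r(3)[OF that] by (simp add: b_def)
    then show y: "y e > 0" using that by (simp add: b_def)
    have "y e \<le> \<eta>/2" using \<eta> by (simp add: y_def power2_eq_square field_simps)
    then show "y e \<le> \<eta> - y e" "\<eta> - y e > 0" using y by simp_all
    then show "w e > 0" using b \<eta> by (simp add: w_def)
    have "k\<^sup>2 \<le> k\<^sup>2 + (w e)\<^sup>2 * e^4/\<eta>\<^sup>2" by simp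
    then show "z e \<ge> k" using k unfolding z_def by (metis real_sqrt_le_iff real_sqrt_abs abs_of_pos)
    then show "z e + k > 0" using k by simp
  qed
  have nz: "\<eta> - y e \<noteq> 0" "z e + k \<noteq> 0" "y e \<noteq> 0" "\<eta> + w e \<noteq> 0" "D e \<noteq> 0" "D e > 0" if "e \<in> {0..r}" for e
  proof -
    show "D e > 0" unfolding D_def using base(4)[OF that] \<eta> that by (intro divide_pos_pos add_nonneg_pos) auto
    then show "\<eta> - y e \<noteq> 0" "z e + k \<noteq> 0" "y e \<noteq> 0" "\<eta> + w e \<noteq> 0" "D e \<noteq> 0"
      using base(1,4,5,7)[OF that] \<eta> by linarith+
  qed
  have cont1: "continuous_on {0..r} y" by (rule cy)
  have cb: "continuous_on {0..r} b" unfolding b_def[abs_def] by (intro continuous_intros cy)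
  have cw: "continuous_on {0..r} w" unfolding w_def[abs_def] by (intro continuous_intros cy cb) (use nz in auto)
  have cB: "continuous_on {0..r} B" unfolding B_def[abs_def] by (intro continuous_intros cy cb) (use nz in auto)
  have cz: "continuous_on {0..r} z" unfolding z_def[abs_def] by (intro continuous_intros cw) (use \<eta> in auto)
  have cE: "continuous_on {0..r} E" unfolding E_def[abs_def] by (intro continuous_intros cw cz) (use \<eta> nz in auto)
  have cD: "continuous_on {0..r} D" unfolding D_def[abs_def] by (intro continuous_intros cy) (use nz in auto)
  have bB: "b e - B e = w e" if "e \<in> {0..r}" for e
    using nz(1)[OF that] by (simp add: b_def B_def w_def field_simps)
  \<comment> \<open>At 0 one has \<open>w = b - B = \<eta>\<close>; the factor \<open>e\<close> is
    split off so that the divided equation for \<open>K\<close> has continuous coefficients.\<close>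
  have \<eta>w: "\<eta> - w e = e * D e" if "e \<in> {0..r}" for e
  proof -
    have "2 * \<eta> * y e = \<eta>\<^sup>2 - e^4" using \<eta> by (simp add: y_def)
    then have "\<eta> * (\<eta> - y e) - \<eta> * b e = e * (e^3 + \<eta>)"
      by (simp add: b_def algebra_simps power2_eq_square power3_eq_cube power4_eq_xxxx)
    then show ?thesis using nz(1)[OF that] by (simp add: w_def D_def field_simps)
  qed
  have zk: "z e - k = e^4 * E e" if "e \<in> {0..r}" for e
  proof -
    have "(z e)\<^sup>2 = k\<^sup>2 + (w e)\<^sup>2 * e^4/\<eta>\<^sup>2" by (simp add: z_def)
    then have "(z e - k) * (z e + k) = (w e)\<^sup>2 * e^4/\<eta>\<^sup>2" by (simp add: algebra_simps power2_eq_square)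
    then have "z e - k = (w e)\<^sup>2 * e^4/\<eta>\<^sup>2/(z e + k)" using nz(2)[OF that] by (metis nonzero_mult_div_cancel_right)
    then show ?thesis by (simp add: E_def)
  qed
  define p1 p2 p3 where "p1 e = z e * e^13/(\<eta> + w e)" and "p2 e = e^7/(\<eta> + w e)" and "p3 e = e * E e/(\<eta> + w e)" for e
  define q1 q2 q3 q4 where "q1 e = 2 * e^6/D e" and "q2 e = - (e^13)/(y e * D e)" and "q3 e = z e * e^12/D e" and "q4 e = E e/D e" for e
  define \<kappa>y dy dd where "\<kappa>y e = e^3/y e" and "dy e = e^8/y e" and "dd e = e^13/y e" for e
  have at0: "L 0 = 0" "b 0 = \<eta>/2" "w 0 = \<eta>" "B 0 = - \<eta>/2" "z 0 = k" "c 0 = k" "E 0 = 1/(2*k)" "D 0 = 2"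
  proof -
    show b0: "b 0 = \<eta>/2" by (simp add: b_def y0)
    show w0: "w 0 = \<eta>" using \<eta> by (simp add: w_def b0 y0)
    show z0: "z 0 = k" using k by (simp add: z_def)
    show "L 0 = 0" "B 0 = - \<eta>/2" "c 0 = k" "E 0 = 1/(2*k)" "D 0 = 2"
      using \<eta> k by (simp_all add: L_def B_def c_def E_def D_def b0 w0 z0 y0)
  qed
  interpret tent_family \<eta> k r L y z B c b d \<kappa> p1 p2 p3 q1 q2 q3 q4 \<kappa>y dy dd
  proof
    show "\<eta> > 0" "k > 0" "r > 0" using \<eta> k r by auto
    show "continuous_on {0..r} L" "continuous_on {0..r} d" "continuous_on {0..r} \<kappa>" "continuous_on {0..r} c"
      unfolding L_def[abs_def] d_def[abs_def] \<kappa>_def[abs_def] c_def[abs_def] by (intro continuous_intros)+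
    show "continuous_on {0..r} y" "continuous_on {0..r} z" "continuous_on {0..r} B" "continuous_on {0..r} b"
      by (fact cont1 cz cB cb)+
    show "continuous_on {0..r} p1" "continuous_on {0..r} p2" "continuous_on {0..r} p3"
      "continuous_on {0..r} q1" "continuous_on {0..r} q2" "continuous_on {0..r} q3" "continuous_on {0..r} q4"
      "continuous_on {0..r} \<kappa>y" "continuous_on {0..r} dy" "continuous_on {0..r} dd"
      unfolding p1_def[abs_def] p2_def[abs_def] p3_def[abs_def] q1_def[abs_def] q2_def[abs_def] q3_def[abs_def] q4_def[abs_def]
        \<kappa>y_def[abs_def] dy_def[abs_def] dd_def[abs_def]
      by (intro continuous_intros cont1 cz cE cD cw; use nz in auto)+
    show "d 0 = 0" "\<kappa> 0 = 0" "p1 0 = 0" "q2 0 = 0" "q3 0 = 0" "\<kappa>y 0 = 0" "dy 0 = 0" "dd 0 = 0"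
      by (simp_all add: d_def \<kappa>_def p1_def q2_def q3_def \<kappa>y_def dy_def dd_def)
    show "0 < (z 0)\<^sup>2 + (L 0)\<^sup>2 - ((L 0)\<^sup>2 / (2 * \<eta>))\<^sup>2 - B 0 * (L 0)\<^sup>2 / \<eta>"
      "0 < z 0 + sqrt ((z 0)\<^sup>2 + (L 0)\<^sup>2 - ((L 0)\<^sup>2 / (2 * \<eta>))\<^sup>2 - B 0 * (L 0)\<^sup>2 / \<eta>)"
      "y 0 * L 0 = 0"
      "2 * k * (z 0 + sqrt ((z 0)\<^sup>2 + (L 0)\<^sup>2 - ((L 0)\<^sup>2 / (2 * \<eta>))\<^sup>2 - B 0 * (L 0)\<^sup>2 / \<eta>)) =
      (z 0 + sqrt ((z 0)\<^sup>2 + (L 0)\<^sup>2 - ((L 0)\<^sup>2 / (2 * \<eta>))\<^sup>2 - B 0 * (L 0)\<^sup>2 / \<eta>))\<^sup>2 + ((L 0)\<^sup>2 / (2 * \<eta>))\<^sup>2"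
      using k by (simp_all add: at0 power2_eq_square)
    fix e :: real assume e: "0 < e" "e \<le> r"
    then have e': "e \<in> {0..r}" by auto
    note bs = base[OF e'] and nze = nz[OF e'] and ew = \<eta>w[OF e'] and bBe = bB[OF e'] and zke = zk[OF e']
    have ww: "\<eta> + b e - B e = \<eta> + w e" "\<eta> + B e - b e = e * D e" using bBe ew by auto
    have eD: "e * D e > 0" using e nze by simp
    have "\<eta> - y e + B e > 0"
    proof -
      have "y e * b e < (\<eta> - y e) * (\<eta> - y e)" using bs e by (intro mult_le_less_imp_less) (auto simp: b_def)
      then have "y e * b e / (\<eta> - y e) < \<eta> - y e" using bs(4) by (simp add: pos_divide_less_eq)
      then show ?thesis by (simp add: B_def)
    qed
    then show "0 < L e \<and> 0 < y e \<and> 0 < z e \<and> 0 < d e \<and> 0 < \<kappa> e \<and> 0 < c e \<and> 0 < b e \<and> y e < \<eta> \<and> 0 < \<eta> - y e + B e \<and>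
      0 < \<eta> + b e - B e \<and> 0 < \<eta> + B e - b e"
      unfolding ww using e eD bs k \<eta> by (simp add: L_def d_def \<kappa>_def c_def add_pos_pos)
    have yb: "(\<eta> - y e) * B e = - (y e * b e)" using nze(1) by (simp add: B_def)
    have L2: "(L e)\<^sup>2 = \<eta>\<^sup>2 - 2 * \<eta> * y e" using \<eta> by (simp add: L_def y_def)
    have bw: "b e = (\<eta> - y e) * w e / \<eta>" "B e = - (y e * w e / \<eta>)" using nze(1) \<eta> by (simp_all add: w_def B_def)
    have "(b e)\<^sup>2 - (B e)\<^sup>2 = (w e)\<^sup>2 * (\<eta>\<^sup>2 - 2 * \<eta> * y e)/\<eta>\<^sup>2"
      unfolding bw using \<eta> by (simp add: field_simps power2_eq_square)
    also have "\<dots> = (z e)\<^sup>2 - (c e)\<^sup>2" unfolding L2[symmetric] by (simp add: L_def z_def c_def)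
    finally show "(L e)\<^sup>2 = \<eta>\<^sup>2 - 2 * \<eta> * y e \<and> (z e)\<^sup>2 + (B e)\<^sup>2 = (c e)\<^sup>2 + (b e)\<^sup>2 \<and> (\<eta> - y e) * B e = - (y e * b e)"
      using L2 yb by simp
    have zc: "z e - c e = e^4 * E e" using zke by (simp add: c_def)
    have by': "b e - y e = - e" by (simp add: b_def)
    show "p1 e = z e * (d e)\<^sup>2 / (\<kappa> e * (\<eta> + b e - B e)) \<and> p2 e = L e * d e / (\<kappa> e * (\<eta> + b e - B e)) \<and>
      p3 e = (z e - c e) / (\<kappa> e * (\<eta> + b e - B e)) \<and> q1 e = 2 * L e * d e / (\<kappa> e * (\<eta> + B e - b e)) \<and>
      q2 e = (b e - y e) * (d e)\<^sup>2 / (y e * \<kappa> e * (\<eta> + B e - b e)) \<and> q3 e = z e * (d e)\<^sup>2 / (\<kappa> e * (\<eta> + B e - b e)) \<and>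
      q4 e = (z e - c e) / (\<kappa> e * (\<eta> + B e - b e)) \<and> \<kappa>y e = \<kappa> e / y e \<and> dy e = d e / y e \<and> dd e = (d e)\<^sup>2 / (y e * \<kappa> e)"
      unfolding ww zc by' using e nze
      by (intro conjI; simp add: p1_def p2_def p3_def q1_def q2_def q3_def q4_def \<kappa>y_def dy_def dd_def L_def d_def \<kappa>_def power_numeral_reduce)
  qed
  obtain q T \<sigma> G Kh nh f1 f2 x1 x3 where sol:
    "tent_solution \<eta> k r L y z B c b d \<kappa> p1 p2 p3 q1 q2 q3 q4 \<kappa>y dy dd q T \<sigma> G Kh nh f1 f2 x1 x3"
    using solution by blast
  interpret tent_solution \<eta> k r L y z B c b d \<kappa> p1 p2 p3 q1 q2 q3 q4 \<kappa>y dy dd q T \<sigma> G Kh nh f1 f2 x1 x3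
    by (rule sol)
  have K0: "K\<^sub>0 = 1/4" unfolding K\<^sub>0_def q1_def q4_def at0 using k by simp
  have n0: "n\<^sub>0 = 0" unfolding n\<^sub>0_def p2_def p3_def by simp
  have \<phi>2: "\<phi>\<^sub>2 = 0" unfolding \<phi>\<^sub>2_def at0 by simp
  have \<phi>1: "\<phi>\<^sub>1 = 2 * k" unfolding \<phi>\<^sub>1_def \<phi>2 at0 using k by simp
  have id: "((\<lambda>e::real. e) \<longlongrightarrow> 0) (at_right 0)" by (rule tendsto_ident_at)
  have El: "(E \<longlongrightarrow> E 0) (at_right 0)" by (rule continuous_on_Icc_at_rightD[OF cE r(1)])
  note lims = id El param_lims[unfolded at0 y0] solution_lims[unfolded K0 n0 \<phi>1 \<phi>2] \<tau>_lim
  \<comment> \<open>Rescaled quantities: the deviation of the solution from its limit is of smaller order than \<open>e\<close>.\<close>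
  define u where "u e = - (e^3 + e^15)/(2*\<eta>) - e\<^sup>2 * Kh e" for e
  define v where "v e = (e * (e - 2*e^7)\<^sup>2 - u e * f2 e + 2 * B e * u e) / f1 e" for e
  define x where "x e = ((f2 e * u e + e^15)/2 - (e^3 * nh e - y e) * u e)/f1 e - e^15 * G e" for e
  define s where "s e = (e^15 * \<sigma> e/(2 - \<kappa>y e * nh e) - e^15 + u e * (2 * y e - e^3 * nh e - e^3 * Kh e))/f1 e - e^15 * G e - e^15 * (G e * T e)" for e
  have ul: "(u \<longlongrightarrow> 0) (at_right 0)"
  proof -
    have "((\<lambda>e. - (e^3 + e^15)/(2*\<eta>) - e\<^sup>2 * Kh e) \<longlongrightarrow> - (0^3 + 0^15)/(2*\<eta>) - 0\<^sup>2 * (1/4)) (at_right 0)"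
      by (intro tendsto_intros lims) (use \<eta> in simp)
    then show ?thesis unfolding u_def[abs_def] by simp
  qed
  have vl: "(v \<longlongrightarrow> 0) (at_right 0)"
  proof -
    have "((\<lambda>e. (e * (e - 2*e^7)\<^sup>2 - u e * f2 e + 2 * B e * u e) / f1 e) \<longlongrightarrow> (0 * (0 - 2*0^7)\<^sup>2 - 0 * 0 + 2 * (- \<eta>/2) * 0) / (2 * k)) (at_right 0)"
      by (intro tendsto_intros lims ul) (use k in simp)
    then show ?thesis unfolding v_def[abs_def] by simp
  qed
  have xl: "(x \<longlongrightarrow> 0) (at_right 0)"
  proof -
    have "((\<lambda>e. ((f2 e * u e + e^15)/2 - (e^3 * nh e - y e) * u e)/f1 e - e^15 * G e) \<longlongrightarrow> ((0 * 0 + 0^15)/2 - (0^3 * 0 - \<eta>/2) * 0)/(2*k) - 0^15 * G 0) (at_right 0)"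
      by (intro tendsto_intros lims ul) (use k in auto)
    then show ?thesis unfolding x_def[abs_def] by simp
  qed
  have sl: "(s \<longlongrightarrow> 0) (at_right 0)"
  proof -
    have "((\<lambda>e. (e^15 * \<sigma> e/(2 - \<kappa>y e * nh e) - e^15 + u e * (2 * y e - e^3 * nh e - e^3 * Kh e))/f1 e - e^15 * G e - e^15 * (G e * T e)) \<longlongrightarrow>
       (0^15 * \<sigma> 0/(2 - 0 * 0) - 0^15 + 0 * (2 * (\<eta>/2) - 0^3 * 0 - 0^3 * (1/4)))/(2*k) - 0^15 * G 0 - 0^15 * (G 0 * T 0)) (at_right 0)"
      by (intro tendsto_intros lims ul) (use k in auto)
    then show ?thesis unfolding s_def[abs_def] by simp
  qed
  have near: "\<forall>\<^sub>F e in at_right 0. 0 < e \<and> e \<le> q \<and> e \<in> {0..r} \<and>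
      f2 e = e * u e \<and> f1 e - 2 * z e = e * v e \<and> x3 e - f1 e/2 = e * x e \<and> x1 e + x3 e = e * s e"
    using near_0
  proof eventually_elim
    case (elim e)
    then have e: "0 < e" "e \<le> q" "e \<in> {0..r}" "e \<in> {0..q}" by auto
    interpret pup_equations \<eta> "L e" "d e" "y e" "b e" "B e" "z e" "c e" "(d e)\<^sup>2 * G e"
       "\<kappa> e * nh e" "x1 e" "x3 e" "(d e)\<^sup>2 * (G e * T e)" "(d e)\<^sup>2 * \<sigma> e / (y e * (2 - \<kappa>y e * nh e))"
       "\<kappa> e * Kh e" "f1 e" "f2 e" using equations[OF e(1,2)] .
    have f1p: "f1 e > 0" "2 - \<kappa>y e * nh e > 0" using sol_pos[OF e(4)] by auto
    have yp: "y e > 0" using base[OF e(3)] by simp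
    have fu: "f2 e = e * u e"
      using f2_eq[OF e(1,2)] \<eta> by (simp add: u_def L_def d_def \<kappa>_def field_simps power_numeral_reduce)
    have "f1 e * (f1 e - 2 * z e) = (L e - 2 * d e)\<^sup>2 - (f2 e)\<^sup>2 + 2 * B e * f2 e"
      using f1 by (simp add: power2_eq_square algebra_simps)
    also have "\<dots> = f1 e * (e * v e)"
    proof -
      have fv: "f1 e * (e * v e) = e * (e * (e - 2*e^7)\<^sup>2 - u e * f2 e + 2 * B e * u e)" unfolding v_def using f1p by simp
      show ?thesis unfolding fv by (simp add: fu L_def d_def power_numeral_reduce algebra_simps)
    qed
    finally have fv: "f1 e - 2 * z e = e * v e" using f1p by simp
    have "f1 e * (x3 e - f1 e / 2) = ((f2 e)\<^sup>2 + (d e)\<^sup>2)/2 - (\<kappa> e * nh e - y e) * f2 e - f1 e * ((d e)\<^sup>2 * G e)"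
      using x3 by (simp add: power2_eq_square field_simps)
    also have "\<dots> = f1 e * (e * x e)"
    proof -
      have "f1 e * x e = (f2 e * u e + e^15)/2 - (e^3 * nh e - y e) * u e - f1 e * (e^15 * G e)"
      proof -
        have "f1 e * (v / f1 e - w) = v - f1 e * w" for v w using f1p by (simp add: right_diff_distrib)
        then show ?thesis unfolding x_def .
      qed
      then have "e * (f1 e * x e) = e * ((f2 e * u e + e^15)/2 - (e^3 * nh e - y e) * u e - f1 e * (e^15 * G e))" by simp
      then show ?thesis by (simp add: fu d_def \<kappa>_def power_numeral_reduce algebra_simps)
    qed
    finally have fx: "x3 e - f1 e / 2 = e * x e" using f1p by simp
    have yt: "y e * ((d e)\<^sup>2 * \<sigma> e / (y e * (2 - \<kappa>y e * nh e))) = e * (e^15 * \<sigma> e / (2 - \<kappa>y e * nh e))"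
      using yp by (simp add: d_def power_numeral_reduce mult.assoc)
    have "f1 e * (x1 e + x3 e) = (x1 e + x3 e + (d e)\<^sup>2 * G e + (d e)\<^sup>2 * (G e * T e)) * f1 e - f1 e * ((d e)\<^sup>2 * G e) - f1 e * ((d e)\<^sup>2 * (G e * T e))"
      by (simp add: algebra_simps)
    also have "\<dots> = f1 e * (e * s e)"
    proof -
      have "f1 e * s e = e^15 * \<sigma> e/(2 - \<kappa>y e * nh e) - e^15 + u e * (2 * y e - e^3 * nh e - e^3 * Kh e) - f1 e * (e^15 * G e) - f1 e * (e^15 * (G e * T e))"
        using f1p by (simp add: s_def right_diff_distrib)
      then have "e * (f1 e * s e) = e * (e^15 * \<sigma> e/(2 - \<kappa>y e * nh e) - e^15 + u e * (2 * y e - e^3 * nh e - e^3 * Kh e) - f1 e * (e^15 * G e) - f1 e * (e^15 * (G e * T e)))" by simp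
      then show ?thesis unfolding x1 yt by (simp add: fu d_def \<kappa>_def power_numeral_reduce algebra_simps)
    qed
    finally have fs: "x1 e + x3 e = e * s e" using f1p by simp
    show ?case using e fu fv fx fs by blast
  qed
  \<comment> \<open>For the two conditions that vanish at 0: their sign is that of the first order
    coefficient in \<open>e\<close>, which is \<open>k\<close> in both cases.\<close>
  have Lim: "\<forall>\<^sub>F e in at_right 0. f e > 0" if "(g \<longlongrightarrow> a) (at_right 0)" "a > 0" "\<forall>\<^sub>F e in at_right 0. f e = e * g e" for f g :: "real \<Rightarrow> real" and a
  proof -
    have "\<forall>\<^sub>F e in at_right 0. g e > 0" using that(1,2) by (rule order_tendstoD(1))
    then show ?thesis using near that(3) by eventually_elim simp
  qed
  have "\<forall>\<^sub>F e in at_right 0. pup_tent (vertices e)"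
  proof (rule eventually_pup_tent[where \<beta>\<^sub>0 = 1])
    show "K\<^sub>0 > 0" "n\<^sub>0 \<ge> 0" by (simp_all add: K0 n0)
    have "((\<lambda>e. e^3 * y e / (1 - e^6)) \<longlongrightarrow> 0^3 * (\<eta>/2) / (1 - 0^6)) (at_right 0)"
      by (intro tendsto_intros lims) simp
    then have "((\<lambda>e. e^3 * y e / (1 - e^6)) \<longlongrightarrow> 0) (at_right 0)" by simp
    then show "((\<lambda>e. d e * y e / ((L e - d e) * \<kappa> e)) \<longlongrightarrow> 0) (at_right 0)"
    proof (rule Lim_transform_eventually)
      show "\<forall>\<^sub>F e in at_right 0. e^3 * y e / (1 - e^6) = d e * y e / ((L e - d e) * \<kappa> e)"
        using near
      proof eventually_elim
        case (elim e)
        have eqs: "(L e - d e) * \<kappa> e = e^5 * (1 - e^6)" "d e * y e = e^5 * (e^3 * y e)" by (simp_all add: L_def d_def \<kappa>_def power_numeral_reduce algebra_simps)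
        show ?case unfolding eqs by (rule mult_divide_mult_cancel_left[symmetric]) (use elim in simp)
      qed
    qed
    have "((\<lambda>e. k * \<kappa> e / b e) \<longlongrightarrow> k * 0 / (\<eta>/2)) (at_right 0)"
      by (intro tendsto_intros lims) (use \<eta> in simp)
    then show "((\<lambda>e. c e * \<kappa> e / b e) \<longlongrightarrow> 0) (at_right 0)" by (simp add: c_def)
    have "((\<lambda>e. b e / y e) \<longlongrightarrow> (\<eta>/2) / (\<eta>/2)) (at_right 0)" by (intro tendsto_intros lims) (use \<eta> in simp)
    then show "((\<lambda>e. b e / y e) \<longlongrightarrow> 1) (at_right 0)" using \<eta> by simp
    have "((\<lambda>e. 1 - e^6) \<longlongrightarrow> 1 - 0^6) (at_right (0::real))" by (intro tendsto_intros id)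
    then have "\<forall>\<^sub>F e in at_right 0. 1 - e^6 > (0::real)" by (rule order_tendstoD(1)) simp
    then show "\<forall>\<^sub>F e in at_right 0. L e - d e > 0" using near
    proof eventually_elim
      case (elim e)
      have "L e - d e = e\<^sup>2 * (1 - e^6)" by (simp add: L_def d_def power_numeral_reduce algebra_simps)
      then show ?case using elim by simp
    qed
    show "\<forall>\<^sub>F e in at_right 0. 0 < c e * (y e - (\<kappa> e * Kh e - \<tau> e)) + b e * x1 e"
    proof (rule Lim)
      let ?g = "\<lambda>e. k - k * (e\<^sup>2 * Kh e) + k * (e^7 * dy e * \<sigma> e/(2 - \<kappa>y e * nh e)) + b e * (s e - x e - v e/2 - e^3 * E e)"
      have "(?g \<longlongrightarrow> k - k * (0\<^sup>2 * (1/4)) + k * (0^7 * 0 * \<sigma> 0/(2 - 0 * 0)) + \<eta>/2 * (0 - 0 - 0/2 - 0^3 * E 0)) (at_right 0)"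
        by (intro tendsto_intros lims ul vl xl sl) simp_all
      then show "(?g \<longlongrightarrow> k) (at_right 0)" by simp
      show "k > 0" by (rule k)
      show "\<forall>\<^sub>F e in at_right 0. c e * (y e - (\<kappa> e * Kh e - \<tau> e)) + b e * x1 e = e * ?g e"
        using near
      proof eventually_elim
        case (elim e)
        have "x1 e = e * s e - e * x e - e * v e/2 - z e" using elim by (simp add: field_simps)
        moreover have "z e = k + e^4 * E e" using zk[of e] elim by simp
        ultimately have xx: "x1 e = - k + e * (s e - x e - v e/2 - e^3 * E e)" by (simp add: algebra_simps power_numeral_reduce)
        have t: "\<tau> e = e * (e^7 * dy e * \<sigma> e/(2 - \<kappa>y e * nh e))" by (simp add: \<tau>_def d_def power_numeral_reduce mult.assoc)
        show ?case unfolding xx t by (simp add: c_def b_def \<kappa>_def power_numeral_reduce algebra_simps)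
      qed
    qed
    show "0 < (2 * \<phi>\<^sub>1 - k - z 0) * (\<eta> - y 0 - B 0) - (\<eta> + 2 * \<phi>\<^sub>2 - y 0 - B 0) * (k - z 0)"
      unfolding \<phi>1 \<phi>2 at0 y0 using \<eta> k by simp
    show "\<phi>\<^sub>1 * (k - \<phi>\<^sub>1) + (- y 0 - \<phi>\<^sub>2) * \<phi>\<^sub>2 < 0" unfolding \<phi>1 \<phi>2 using k by simp
    show "0 < \<eta> - y 0 - B 0" unfolding at0 y0 using \<eta> by simp
    show "\<forall>\<^sub>F e in at_right 0. 0 < (x1 e + (d e)\<^sup>2 * (G e * T e) + 2 * f1 e - z e) * (\<eta> + f2 e - y e + \<kappa> e * Kh e) -
        (\<eta> + 2 * f2 e - y e + \<kappa> e * Kh e - B e) * (x1 e + (d e)\<^sup>2 * (G e * T e) + f1 e)"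
    proof (rule Lim)
      let ?A = "\<lambda>e. s e - x e - v e/2 - e^3 * E e + e^15 * (G e * T e)"
      let ?V = "\<lambda>e. v e + 2 * e^3 * E e"
      let ?M = "\<lambda>e. \<eta> - y e + f2 e + \<kappa> e * Kh e"
      let ?g = "\<lambda>e. k * ((e^3 + y e)/(\<eta> - y e) + e\<^sup>2 * Kh e) + (?A e + 2 * ?V e - e^3 * E e) * ?M e - (?A e + ?V e) * (?M e + f2 e - B e)"
      have "(?g \<longlongrightarrow> k * ((0^3 + \<eta>/2)/(\<eta> - \<eta>/2) + 0\<^sup>2 * (1/4)) + (0 - 0 - 0/2 - 0^3 * E 0 + 0^15 * (G 0 * T 0) + 2 * (0 + 2 * 0^3 * E 0) - 0^3 * E 0) * (\<eta> - \<eta>/2 + 0 + 0 * (1/4))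
         - (0 - 0 - 0/2 - 0^3 * E 0 + 0^15 * (G 0 * T 0) + (0 + 2 * 0^3 * E 0)) * (\<eta> - \<eta>/2 + 0 + 0 * (1/4) + 0 - (- \<eta>/2))) (at_right 0)"
        by (intro tendsto_intros lims ul vl xl sl) (use \<eta> in simp_all)
      then show "(?g \<longlongrightarrow> k) (at_right 0)" using \<eta> by simp
      show "k > 0" by (rule k)
      show "\<forall>\<^sub>F e in at_right 0. (x1 e + (d e)\<^sup>2 * (G e * T e) + 2 * f1 e - z e) * (\<eta> + f2 e - y e + \<kappa> e * Kh e) -
        (\<eta> + 2 * f2 e - y e + \<kappa> e * Kh e - B e) * (x1 e + (d e)\<^sup>2 * (G e * T e) + f1 e) = e * ?g e"
        using near
      proof eventually_elim
        case (elim e)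
        have zz: "z e = k + e * (e^3 * E e)" using zk[of e] elim by (simp add: power_numeral_reduce)
        have "x1 e = e * s e - e * x e - e * v e/2 - z e" using elim by (simp add: field_simps)
        then have xx: "x1 e + (d e)\<^sup>2 * (G e * T e) = - k + e * ?A e" unfolding zz by (simp add: d_def algebra_simps power_numeral_reduce)
        have ff: "f1 e = 2 * k + e * ?V e" using elim zz by (simp add: algebra_simps)
        have yn: "\<eta> - y e \<noteq> 0" using nz(1)[of e] elim by blast
        have "2 * \<eta> * y e = \<eta>\<^sup>2 - e^4" using \<eta> by (simp add: y_def)
        then have "(\<eta> - y e) * (\<eta> - y e) - y e * b e = e * (e^3 + y e)"
          by (simp add: b_def algebra_simps power2_eq_square power_numeral_reduce)
        then have "\<eta> - y e + B e = e * ((e^3 + y e)/(\<eta> - y e))" using yn by (simp add: B_def field_simps)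
        then have MB: "?M e - f2 e + B e = e * ((e^3 + y e)/(\<eta> - y e) + e\<^sup>2 * Kh e)" by (simp add: \<kappa>_def algebra_simps power_numeral_reduce)
        \<comment> \<open>Expansion around \<open>x1 = - k\<close>, \<open>f1 = 2*k\<close>,
          \<open>z = k\<close>. The part of order zero is \<open>k * (M - f + Be)\<close>, which by
          \<open>MB\<close> is itself a multiple of \<open>e\<close>.\<close>
        have gen: "(- k + e * a + 2 * (2 * k + e * V) - (k + e * h)) * M - (M + f - Be) * (- k + e * a + (2 * k + e * V)) =
            k * (M - f + Be) + e * ((a + 2 * V - h) * M - (a + V) * (M + f - Be))" for a V h M f Be :: real
          by (simp add: algebra_simps)
        have m: "\<eta> + f2 e - y e + \<kappa> e * Kh e = ?M e" "\<eta> + 2 * f2 e - y e + \<kappa> e * Kh e - B e = ?M e + f2 e - B e" by simp_all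
        show ?case unfolding xx ff zz m gen MB by (simp add: algebra_simps)
      qed
    qed
  qed
  from pup_tent_path[OF this] show ?thesis unfolding at0 y0 by simp
qed

subsection \<open>Collapsed tori and Hausdorff convergence\<close>

lemma triangle_subset_torus:
  assumes "{i, j, k} \<in> uniform_triangulation" "i \<noteq> j" "i \<noteq> k" "j \<noteq> k"
  shows "convex hull {p $ i, p $ j, p $ k} \<subseteq> torus p"
proof
  fix x assume "x \<in> convex hull {p $ i, p $ j, p $ k}"
  then obtain u v w where c: "0 \<le> u" "0 \<le> v" "0 \<le> w" "u + v + w = 1" and x: "x = u *\<^sub>R p $ i + v *\<^sub>R p $ j + w *\<^sub>R p $ k"
    unfolding convex_hull_3 by blast
  define y :: "real^8" where "y = u *\<^sub>R axis i 1 + v *\<^sub>R axis j 1 + w *\<^sub>R axis k 1"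
  have y: "y $ l = (if l = i then u else 0) + (if l = j then v else 0) + (if l = k then w else 0)" for l
    by (simp add: y_def axis_def)
  have "\<forall>l. 0 \<le> y $ l" using c by (simp add: y)
  moreover have "(\<Sum>l\<in>UNIV. y $ l) = 1" using c by (simp add: y sum.distrib)
  moreover have "{l. y $ l \<noteq> 0} \<subseteq> {i, j, k}" by (auto simp: y)
  ultimately have "y \<in> realization" unfolding realization_def using assms(1) by blast
  moreover have "affine_extension p y = x"
    unfolding affine_extension_def x y by (simp add: scaleR_add_left sum.distrib if_distrib[of "\<lambda>r. r *\<^sub>R _"] cong: if_cong)
  ultimately show "x \<in> torus p" unfolding torus_def by blast
qed

lemma range_tent:
  "range (($) (tent q\<^sub>0 q\<^sub>1 q\<^sub>2 q\<^sub>3)) = {q\<^sub>0, q\<^sub>1, q\<^sub>2, q\<^sub>3, \<rho> q\<^sub>0, \<rho> q\<^sub>1, \<rho> q\<^sub>2, \<rho> q\<^sub>3}"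
proof (rule set_eqI)
  fix x
  have "x \<in> range (($) (tent q\<^sub>0 q\<^sub>1 q\<^sub>2 q\<^sub>3)) \<longleftrightarrow> (\<exists>i. x = tent q\<^sub>0 q\<^sub>1 q\<^sub>2 q\<^sub>3 $ i)" by blast
  also have "\<dots> \<longleftrightarrow> x \<in> {q\<^sub>0, q\<^sub>1, q\<^sub>2, q\<^sub>3, \<rho> q\<^sub>0, \<rho> q\<^sub>1, \<rho> q\<^sub>2, \<rho> q\<^sub>3}"
    unfolding ex_8 tent_nth by blast
  finally show "x \<in> range (($) (tent q\<^sub>0 q\<^sub>1 q\<^sub>2 q\<^sub>3)) \<longleftrightarrow> x \<in> {q\<^sub>0, q\<^sub>1, q\<^sub>2, q\<^sub>3, \<rho> q\<^sub>0, \<rho> q\<^sub>1, \<rho> q\<^sub>2, \<rho> q\<^sub>3}" .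
qed

lemma convex_hull_4_cases:
  assumes "x \<in> convex hull {a, b, c, d}"
  obtains u v w s :: real where "0 \<le> u" "0 \<le> v" "0 \<le> w" "0 \<le> s" "u + v + w + s = 1"
    "x = u *\<^sub>R a + v *\<^sub>R b + w *\<^sub>R c + s *\<^sub>R (d::'a::real_vector)"
proof -
  obtain u y where 1: "0 \<le> u" "u \<le> 1" "y \<in> convex hull {b, c, d}" "x = u *\<^sub>R a + (1 - u) *\<^sub>R y"
  proof -
    have "\<exists>u\<ge>0. \<exists>v\<ge>0. \<exists>y. u + v = 1 \<and> y \<in> convex hull {b, c, d} \<and> x = u *\<^sub>R a + v *\<^sub>R y"
      using assms convex_hull_insert[of "{b, c, d}" a] by auto
    then obtain u v y where uv: "0 \<le> u" "0 \<le> v" "u + v = 1" "y \<in> convex hull {b, c, d}" "x = u *\<^sub>R a + v *\<^sub>R y" by blast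
    then have "v = 1 - u" by simp
    then show ?thesis using that[of u y] uv by simp
  qed
  then obtain v w s where 2: "0 \<le> v" "0 \<le> w" "0 \<le> s" "v + w + s = 1" "y = v *\<^sub>R b + w *\<^sub>R c + s *\<^sub>R d"
    unfolding convex_hull_3 by blast
  have "u + (1 - u) * v + (1 - u) * w + (1 - u) * s = u + (1 - u) * (v + w + s)" by (simp add: algebra_simps)
  then have "u + (1 - u) * v + (1 - u) * w + (1 - u) * s = 1" using 2 by simp
  moreover have "x = u *\<^sub>R a + ((1 - u) * v) *\<^sub>R b + ((1 - u) * w) *\<^sub>R c + ((1 - u) * s) *\<^sub>R d"
    unfolding 1(4) 2(5) by (simp add: scaleR_add_right add.assoc)
  ultimately show ?thesis using 1 2 by (intro that[of u "(1 - u) * v" "(1 - u) * w" "(1 - u) * s"]) simp_all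
qed

lemma in_convex_hull_3:
  assumes "0 \<le> u" "0 \<le> v" "0 \<le> w" "u + v + w = 1" "x = u *\<^sub>R a + v *\<^sub>R b + w *\<^sub>R c"
  shows "x \<in> convex hull {a, b, c}"
  unfolding convex_hull_3 using assms by blast

text \<open>Cut along the diagonal from \<open>a\<close> to \<open>c\<close>: by
  \<open>b + d = a + c\<close> the smaller of the weights at \<open>b\<close> and \<open>d\<close>
  can be moved to \<open>a\<close> and \<open>c\<close>.\<close>

lemma parallelogram_subset:
  fixes a b c d :: "'a::real_vector"
  assumes "a + c = b + d"
  shows "convex hull {a, b, c, d} \<subseteq> convex hull {c, a, b} \<union> convex hull {d, c, a}"
proof
  fix x assume "x \<in> convex hull {a, b, c, d}"
  then obtain u v w s where c: "0 \<le> u" "0 \<le> v" "0 \<le> w" "0 \<le> s" "u + v + w + s = 1"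
    and x: "x = u *\<^sub>R a + v *\<^sub>R b + w *\<^sub>R c + s *\<^sub>R d" by (rule convex_hull_4_cases)
  have d: "d = a + c - b" using assms by simp
  then have b: "b = a + c - d" by simp
  show "x \<in> convex hull {c, a, b} \<union> convex hull {d, c, a}"
  proof (cases "s \<le> v")
    case True
    have "x = (w + s) *\<^sub>R c + (u + s) *\<^sub>R a + (v - s) *\<^sub>R b" unfolding x d by (simp add: algebra_simps)
    then have "x \<in> convex hull {c, a, b}" using c True by (intro in_convex_hull_3) simp_all
    then show ?thesis by blast
  next
    case False
    have "x = (s - v) *\<^sub>R d + (w + v) *\<^sub>R c + (u + v) *\<^sub>R a" unfolding x by (subst b) (simp add: algebra_simps)
    then have "x \<in> convex hull {d, c, a}" using c False by (intro in_convex_hull_3) simp_all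
    then show ?thesis by blast
  qed
qed

text \<open>The parallelism allows trading weight at \<open>a\<close> and \<open>c\<close> for
  weight at \<open>m\<close> and \<open>d\<close> until one of the first two is exhausted.\<close>

lemma half_trapezoid_subset:
  fixes a m c d :: "'a::real_vector"
  assumes t: "0 \<le> t" and cd: "c - d = (2 * t) *\<^sub>R (m - a)"
    and x: "x = u *\<^sub>R a + v *\<^sub>R m + w *\<^sub>R c + s *\<^sub>R d" and k: "0 \<le> u" "0 \<le> v" "0 \<le> w" "0 \<le> s" "u + v + w + s = 1"
  shows "x \<in> convex hull {d, a, m} \<union> convex hull {d, c, m}"
proof (cases "2 * t * w \<le> u")
  case True
  have c: "c = d + (2 * t) *\<^sub>R (m - a)" using cd by (simp add: algebra_simps)
  have "x = (w + s) *\<^sub>R d + (u - 2 * t * w) *\<^sub>R a + (v + 2 * t * w) *\<^sub>R m" unfolding x c by (simp add: algebra_simps)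
  moreover have "0 \<le> t * w" using t k by simp
  ultimately have "x \<in> convex hull {d, a, m}" using k True by (intro in_convex_hull_3[of "w + s" "u - 2 * t * w" "v + 2 * t * w"]) simp_all
  then show ?thesis by blast
next
  case False
  then have tp: "t > 0" using t k by (cases "t = 0") auto
  define r where "r = u / (2 * t)"
  have r: "0 \<le> r" "r \<le> w" "u = 2 * t * r" using False tp k by (simp_all add: r_def field_simps)
  have "u *\<^sub>R a = u *\<^sub>R m - r *\<^sub>R ((2 * t) *\<^sub>R (m - a))" by (simp add: r(3) algebra_simps)
  then have ua: "u *\<^sub>R a = u *\<^sub>R m - r *\<^sub>R c + r *\<^sub>R d" unfolding cd[symmetric] by (simp add: algebra_simps)
  have "x = (s + r) *\<^sub>R d + (w - r) *\<^sub>R c + (v + u) *\<^sub>R m" unfolding x ua by (simp add: algebra_simps)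
  then have "x \<in> convex hull {d, c, m}" using k r(1,2) by (intro in_convex_hull_3) simp_all
  then show ?thesis by blast
qed

text \<open>Balancing the weights at \<open>a\<close> and \<open>b\<close> against the midpoint
  \<open>m\<close> reduces the claim to one half, where the previous lemma applies.\<close>

lemma trapezoid_subset:
  fixes a b c d m :: "'a::real_vector"
  assumes t: "0 \<le> t" and cd: "c - d = t *\<^sub>R (b - a)" and m: "a + b = 2 *\<^sub>R m"
  shows "convex hull {a, b, c, d} \<subseteq> convex hull {d, a, m} \<union> convex hull {d, c, m} \<union> convex hull {c, m, b}"
proof
  fix x assume "x \<in> convex hull {a, b, c, d}"
  then obtain u v w s where k: "0 \<le> u" "0 \<le> v" "0 \<le> w" "0 \<le> s" "u + v + w + s = 1"
    and x: "x = u *\<^sub>R a + v *\<^sub>R b + w *\<^sub>R c + s *\<^sub>R d" by (rule convex_hull_4_cases)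
  have b: "b = 2 *\<^sub>R m - a" using m by (metis add_diff_cancel_left')
  have a: "a = 2 *\<^sub>R m - b" using m by (metis add_diff_cancel_right')
  show "x \<in> convex hull {d, a, m} \<union> convex hull {d, c, m} \<union> convex hull {c, m, b}"
  proof (cases "v \<le> u")
    case True
    have "c - d = (2 * t) *\<^sub>R (m - a)" unfolding cd b by (simp add: algebra_simps flip: scaleR_2)
    moreover have "x = (u - v) *\<^sub>R a + (2 * v) *\<^sub>R m + w *\<^sub>R c + s *\<^sub>R d" unfolding x b by (simp add: algebra_simps)
    ultimately show ?thesis using half_trapezoid_subset[of t c d m a x "u - v" "2 * v" w s] k t True by auto
  next
    case False
    have "d - c = t *\<^sub>R (a - b)" using cd by (metis minus_diff_eq scaleR_minus_right)
    also have "\<dots> = (2 * t) *\<^sub>R (m - b)" unfolding a by (simp add: algebra_simps flip: scaleR_2)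
    finally have "d - c = (2 * t) *\<^sub>R (m - b)" .
    moreover have "x = (v - u) *\<^sub>R b + (2 * u) *\<^sub>R m + s *\<^sub>R d + w *\<^sub>R c" unfolding x by (subst a) (simp add: algebra_simps)
    ultimately have "x \<in> convex hull {c, b, m} \<union> convex hull {c, d, m}"
      using half_trapezoid_subset[of t d c m b x "v - u" "2 * u" s w] k t False by auto
    then show ?thesis by (auto simp: insert_commute)
  qed
qed

text \<open>All vertices lie in the rectangle, and the triangles \<open>{0, 1, 3}\<close> and
  \<open>{4, 6, 7}\<close> already cover it.\<close>

lemma torus_rectangle:
  fixes k h :: real
  defines "A \<equiv> vector [- k, - h, 0] :: real^3" and "B \<equiv> vector [k, - h, 0]" and "C \<equiv> vector [k, h, 0]" and "D \<equiv> vector [- k, h, 0]"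
  shows "torus (tent C A (vector [0, - h, 0]) B) = convex hull {A, B, C, D}"
proof (rule antisym)
  let ?p = "tent C A (vector [0, - h, 0]) B"
  have rho: "\<rho> (vector [r,s,u]) = vector [-r,-s,u]" for r s u
    by (simp add: \<rho>_def vector_3)
  have \<rho>: "\<rho> A = C" "\<rho> B = D" "\<rho> C = A" "\<rho> (vector [0, - h, 0]) = vector [0, h, 0]"
    by (simp_all add: A_def B_def C_def D_def rho)
  have sum: "A + C = B + D" by (simp add: A_def B_def C_def D_def vec_eq_iff forall_3 vector_3)
  have mid: "vector [0, - h, 0] = (1/2) *\<^sub>R A + (1/2) *\<^sub>R B" "vector [0, h, 0] = (1/2) *\<^sub>R C + (1/2) *\<^sub>R D"
    by (simp_all add: A_def B_def C_def D_def vec_eq_iff forall_3 vector_3)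
  have i: "A \<in> convex hull {A, B, C, D}" "B \<in> convex hull {A, B, C, D}" "C \<in> convex hull {A, B, C, D}" "D \<in> convex hull {A, B, C, D}"
    by (simp_all add: hull_inc)
  then have "vector [0, - h, 0] \<in> convex hull {A, B, C, D}" "vector [0, h, 0] \<in> convex hull {A, B, C, D}"
    unfolding mid by (intro convexD convex_convex_hull; simp)+
  then have "convex hull range (($) ?p) \<subseteq> convex hull {A, B, C, D}"
    unfolding range_tent \<rho> using i by (intro hull_minimal convex_convex_hull) auto
  then show "torus ?p \<subseteq> convex hull {A, B, C, D}" using torus_subset_hull by blast
  have "{0, 1, 3::8} \<in> uniform_triangulation" "{4, 6, 7::8} \<in> uniform_triangulation"
    unfolding uniform_triangulation_def using rangeI[of "\<lambda>a::8. {a, a + 1, a + 3}" 0] rangeI[of "\<lambda>a::8. {a, a + 2, a + 3}" 4] by simp_all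
  then have "convex hull {?p $ 0, ?p $ 1, ?p $ 3} \<subseteq> torus ?p" "convex hull {?p $ 4, ?p $ 6, ?p $ 7} \<subseteq> torus ?p"
    by (intro triangle_subset_torus; simp)+
  then have "convex hull {C, A, B} \<subseteq> torus ?p" "convex hull {D, C, A} \<subseteq> torus ?p" unfolding tent_nth \<rho> .
  then show "convex hull {A, B, C, D} \<subseteq> torus ?p" using parallelogram_subset[OF sum] by blast
qed

text \<open>All vertices lie in the trapezoid, and the triangles \<open>{1, 2, 7}\<close>,
  \<open>{0, 2, 7}\<close>, \<open>{0, 2, 3}\<close> already cover it.\<close>

lemma torus_trapezoid:
  fixes t h :: real
  assumes "0 \<le> t"
  defines "A \<equiv> vector [- 1, 0, 0] :: real^3" and "B \<equiv> vector [1, 0, 0]" and "C \<equiv> vector [t, 0, h]" and "D \<equiv> vector [- t, 0, h]"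
  shows "torus (tent C A (vector [0, 0, 0]) B) = convex hull {A, B, C, D}"
proof (rule antisym)
  let ?M = "vector [0, 0, 0] :: real^3"
  let ?p = "tent C A ?M B"
  have rho: "\<rho> (vector [r,s,u]) = vector [-r,-s,u]" for r s u
    by (simp add: \<rho>_def vector_3)
  have \<rho>: "\<rho> A = B" "\<rho> B = A" "\<rho> C = D" "\<rho> ?M = ?M"
    by (simp_all add: A_def B_def C_def D_def rho)
  have cd: "C - D = t *\<^sub>R (B - A)" by (simp add: A_def B_def C_def D_def vec_eq_iff forall_3 vector_3)
  have mid: "?M = (1/2) *\<^sub>R A + (1/2) *\<^sub>R B" and mid': "A + B = 2 *\<^sub>R ?M"
    by (simp_all add: A_def B_def vec_eq_iff forall_3 vector_3)
  have i: "A \<in> convex hull {A, B, C, D}" "B \<in> convex hull {A, B, C, D}" "C \<in> convex hull {A, B, C, D}" "D \<in> convex hull {A, B, C, D}"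
    by (simp_all add: hull_inc)
  then have "?M \<in> convex hull {A, B, C, D}" unfolding mid by (intro convexD convex_convex_hull; simp)
  then have "convex hull range (($) ?p) \<subseteq> convex hull {A, B, C, D}"
    unfolding range_tent \<rho> using i by (intro hull_minimal convex_convex_hull) auto
  then show "torus ?p \<subseteq> convex hull {A, B, C, D}" using torus_subset_hull by blast
  have "{7, 1, 2::8} \<in> uniform_triangulation" "{7, 0, 2::8} \<in> uniform_triangulation" "{0, 2, 3::8} \<in> uniform_triangulation"
    unfolding uniform_triangulation_def using rangeI[of "\<lambda>a::8. {a, a + 1, a + 3}" 7] rangeI[of "\<lambda>a::8. {a, a + 2, a + 3}" 7]
      rangeI[of "\<lambda>a::8. {a, a + 2, a + 3}" 0] by (simp_all add: numeral_mod_8)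
  then have "convex hull {?p $ 7, ?p $ 1, ?p $ 2} \<subseteq> torus ?p" "convex hull {?p $ 7, ?p $ 0, ?p $ 2} \<subseteq> torus ?p"
     "convex hull {?p $ 0, ?p $ 2, ?p $ 3} \<subseteq> torus ?p"
    by (intro triangle_subset_torus; simp)+
  then have "convex hull {D, A, ?M} \<subseteq> torus ?p" "convex hull {D, C, ?M} \<subseteq> torus ?p" "convex hull {C, ?M, B} \<subseteq> torus ?p"
    unfolding tent_nth \<rho> .
  then show "convex hull {A, B, C, D} \<subseteq> torus ?p" using trapezoid_subset[OF assms(1) cd mid'] by blast
qed

section \<open>Similarities and Hausdorff estimates\<close>

lemma frame_similarity:
  fixes o' e\<^sub>1 e\<^sub>2 e\<^sub>3 :: "real^3"
  assumes "norm e\<^sub>1 = 1" "norm e\<^sub>2 = 1" "norm e\<^sub>3 = 1" "e\<^sub>1 \<bullet> e\<^sub>2 = 0" "e\<^sub>1 \<bullet> e\<^sub>3 = 0" "e\<^sub>2 \<bullet> e\<^sub>3 = 0" and l: "l > 0"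
  defines "f \<equiv> \<lambda>x::real^3. x $ 1 *\<^sub>R e\<^sub>1 + x $ 2 *\<^sub>R e\<^sub>2 + x $ 3 *\<^sub>R e\<^sub>3"
  shows "similarity (\<lambda>x. o' + l *\<^sub>R f x)" "(\<lambda>x. o' + l *\<^sub>R f x) ` (convex hull S) = convex hull ((\<lambda>x. o' + l *\<^sub>R f x) ` S)"
proof -
  have lin: "linear f" unfolding f_def by (intro linearI) (simp_all add: algebra_simps)
  have n: "e\<^sub>1 \<bullet> e\<^sub>1 = 1" "e\<^sub>2 \<bullet> e\<^sub>2 = 1" "e\<^sub>3 \<bullet> e\<^sub>3 = 1" using assms(1-3) by (simp_all add: dot_square_norm)
  have o: "e\<^sub>2 \<bullet> e\<^sub>1 = 0" "e\<^sub>3 \<bullet> e\<^sub>1 = 0" "e\<^sub>3 \<bullet> e\<^sub>2 = 0" using assms(4-6) by (simp_all add: inner_commute)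
  have "f v \<bullet> f w = v $ 1 * w $ 1 + v $ 2 * w $ 2 + v $ 3 * w $ 3" for v w
    unfolding f_def by (simp add: inner_add_left inner_add_right n assms(4-6) o)
  then have "f v \<bullet> f w = v \<bullet> w" for v w by (simp add: inner_vec_def sum_3)
  then have orth: "orthogonal_transformation f" unfolding orthogonal_transformation_def using lin by blast
  have "surj (\<lambda>x. o' + l *\<^sub>R f x)"
  proof (rule surjI)
    fix y
    show "o' + l *\<^sub>R f (inv f ((1/l) *\<^sub>R (y - o'))) = y"
      using orthogonal_transformation_surj[OF orth] l by (simp add: surj_f_inv_f)
  qed
  moreover have "dist (o' + l *\<^sub>R f x) (o' + l *\<^sub>R f y) = l * dist x y" for x y
  proof -
    have "dist (o' + l *\<^sub>R f x) (o' + l *\<^sub>R f y) = norm (l *\<^sub>R f (x - y))"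
      by (simp add: dist_norm linear_diff[OF lin] scaleR_diff_right)
    then show ?thesis using l orthogonal_transformation_norm[OF orth] by (simp add: dist_norm)
  qed
  ultimately show "similarity (\<lambda>x. o' + l *\<^sub>R f x)" unfolding similarity_def using l by blast
  have "(\<lambda>x. o' + l *\<^sub>R f x) ` T = (\<lambda>x. o' + l *\<^sub>R x) ` f ` T" for T by (simp add: image_image)
  then show "(\<lambda>x. o' + l *\<^sub>R f x) ` (convex hull S) = convex hull ((\<lambda>x. o' + l *\<^sub>R f x) ` S)"
    by (simp add: convex_hull_affinity convex_hull_linear_image[OF lin])
qed

lemma orthonormal_third:
  fixes e\<^sub>1 e\<^sub>2 :: "real^3"
  assumes "norm e\<^sub>1 = 1" "norm e\<^sub>2 = 1" "e\<^sub>1 \<bullet> e\<^sub>2 = 0"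
  obtains e\<^sub>3 where "norm e\<^sub>3 = 1" "e\<^sub>1 \<bullet> e\<^sub>3 = 0" "e\<^sub>2 \<bullet> e\<^sub>3 = 0"
proof -
  have "(norm (cross3 e\<^sub>1 e\<^sub>2))\<^sup>2 = 1" using norm_cross[of e\<^sub>1 e\<^sub>2] assms by simp
  then have "norm (cross3 e\<^sub>1 e\<^sub>2) = 1" by (simp add: power2_eq_1_iff) (metis norm_ge_zero not_one_le_zero neg_0_le_iff_le)
  then show ?thesis using that by (simp add: dot_cross_self)
qed

text \<open>Points with equal barycentric coordinates are compared. Injectivity plays no part in
  this, so the estimate reaches the collapsed torus as well.\<close>

lemma hausdorff_dist_torus_le:
  assumes F: "\<And>x y. dist (F x) (F y) = l * dist x y" and l: "l > 0"
  shows "hausdorff_dist (F ` torus p) (F ` torus q) \<le> l * dist p q" "0 \<le> hausdorff_dist (F ` torus p) (F ` torus q)"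
proof -
  let ?S = "{\<epsilon>. \<epsilon> > 0 \<and> F ` torus p \<subseteq> (\<Union>b\<in>F ` torus q. ball b \<epsilon>) \<and> F ` torus q \<subseteq> (\<Union>a\<in>F ` torus p. ball a \<epsilon>)}"
  have d: "dist (affine_extension p x) (affine_extension q x) \<le> dist p q" if "x \<in> realization" for x p q
  proof -
    have x: "\<And>i. 0 \<le> x $ i" "(\<Sum>i\<in>UNIV. x $ i) = 1" using that unfolding realization_def by auto
    have "dist (affine_extension p x) (affine_extension q x) = norm (\<Sum>i\<in>UNIV. x $ i *\<^sub>R (p $ i - q $ i))"
      by (simp add: affine_extension_def dist_norm scaleR_diff_right sum_subtractf)
    also have "\<dots> \<le> (\<Sum>i\<in>UNIV. x $ i * dist p q)"
    proof (rule sum_norm_le)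
      fix i
      have "norm (p $ i - q $ i) \<le> dist p q" using Finite_Cartesian_Product.norm_nth_le[of "p - q" i] by (simp add: dist_norm)
      then show "norm (x $ i *\<^sub>R (p $ i - q $ i)) \<le> x $ i * dist p q" using x(1) by (simp add: mult_left_mono)
    qed
    also have "\<dots> = dist p q" using x(2) by (simp flip: sum_distrib_right)
    finally show ?thesis .
  qed
  have sub: "F ` torus p \<subseteq> (\<Union>b\<in>F ` torus q. ball b \<epsilon>)" if "l * dist p q < \<epsilon>" for p q \<epsilon>
  proof
    fix y assume "y \<in> F ` torus p"
    then obtain x where x: "x \<in> realization" "y = F (affine_extension p x)" unfolding torus_def by blast
    have "dist (F (affine_extension q x)) y \<le> l * dist p q"
      unfolding x(2) F using d[OF x(1), of q p] l by (simp add: dist_commute)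
    then have "y \<in> ball (F (affine_extension q x)) \<epsilon>" using that by simp
    moreover have "affine_extension q x \<in> torus q" using x(1) unfolding torus_def by blast
    ultimately show "y \<in> (\<Union>b\<in>F ` torus q. ball b \<epsilon>)" by blast
  qed
  have mem: "\<epsilon> \<in> ?S" if "l * dist p q < \<epsilon>" for \<epsilon>
  proof -
    have "l * dist p q \<ge> 0" using l by simp
    then have "\<epsilon> > 0" using that by linarith
    then show ?thesis using sub[OF that] sub[of q p \<epsilon>] that by (simp add: dist_commute)
  qed
  have bdd: "bdd_below ?S" by (rule bdd_belowI[of _ 0]) simp
  have "hausdorff_dist (F ` torus p) (F ` torus q) \<le> \<epsilon>" if "l * dist p q < \<epsilon>" for \<epsilon>
    unfolding hausdorff_dist_def by (rule cInf_lower[OF mem[OF that] bdd])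
  then show "hausdorff_dist (F ` torus p) (F ` torus q) \<le> l * dist p q" by (rule dense_ge)
  have "?S \<noteq> {}" using mem[of "l * dist p q + 1"] by auto
  then show "0 \<le> hausdorff_dist (F ` torus p) (F ` torus q)"
    unfolding hausdorff_dist_def by (rule cInf_greatest) simp
qed

lemma path_to_limit:
  fixes p :: "real \<Rightarrow> (real^3)^8"
  assumes s: "s > 0" and p: "continuous_on {0..s} p" "\<forall>e\<in>{0<..s}. pup_tent (p e)"
    and F: "similarity F" and Q: "Q = F ` torus (p 0)"
  shows "\<exists>(\<xi> :: real \<Rightarrow> ((real^3)^8) set) (T :: real \<Rightarrow> (real^3) set).
           continuous_map (top_of_set {0..<1}) pup_space \<xi> \<and>
           (\<forall>s\<in>{0..<1}. \<exists>p\<in>\<xi> s. similar (torus p) (T s)) \<and>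
           ((\<lambda>s. hausdorff_dist (T s) Q) \<longlongrightarrow> 0) (at_left 1)"
proof -
  \<comment> \<open>Reversed time: \<open>r = 1\<close> is the collapsed torus, while
    \<open>r\<close> in \<open>[0, 1)\<close> gives parameters in \<open>(0, s]\<close>, where the
    tuples are pup tents.\<close>
  define P where "P r = p (s * (1 - r))" for r
  define \<xi> where "\<xi> r = pup_similarity `` {P r}" for r
  define T where "T r = F ` torus (P r)" for r
  obtain l where l: "l > 0" "\<And>x y. dist (F x) (F y) = l * dist x y" using F unfolding similarity_def by blast
  have P: "P r \<in> pup_tents" if "r \<in> {0..<1}" for r
  proof -
    have "s * (1 - r) \<in> {0<..s}" using that s by (auto simp: mult_le_cancel_left1)
    then show ?thesis using p(2) by (simp add: P_def pup_tents_def)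
  qed
  have cP: "continuous_on {0..1} P" unfolding P_def[abs_def]
    by (rule continuous_on_compose2[OF p(1)]) (use s in \<open>auto intro!: continuous_intros simp: mult_le_cancel_left1\<close>)
  have "continuous_on {0..<1} P" by (rule continuous_on_subset[OF cP]) auto
  then have "continuous_map (top_of_set {0..<1}) (top_of_set pup_tents) P"
    using P by (auto simp: continuous_map_in_subtopology)
  from continuous_map_compose[OF this quotient_imp_continuous_map[OF quotient_map_pup_space]]
  have "continuous_map (top_of_set {0..<1}) pup_space \<xi>" by (simp add: \<xi>_def[abs_def] comp_def)
  moreover have "\<forall>r\<in>{0..<1}. \<exists>p\<in>\<xi> r. similar (torus p) (T r)"
  proof
    fix r :: real assume "r \<in> {0..<1}"
    then have "P r \<in> \<xi> r" unfolding \<xi>_def using equiv_class_self[OF equiv_pup_similarity P] by simp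
    moreover have "similar (torus (P r)) (T r)" unfolding similar_def T_def using F by blast
    ultimately show "\<exists>p\<in>\<xi> r. similar (torus p) (T r)" by blast
  qed
  moreover have "((\<lambda>r. hausdorff_dist (T r) Q) \<longlongrightarrow> 0) (at_left 1)"
  proof (rule tendsto_sandwich[OF _ _ tendsto_const])
    show "\<forall>\<^sub>F r in at_left 1. 0 \<le> hausdorff_dist (T r) Q" "\<forall>\<^sub>F r in at_left 1. hausdorff_dist (T r) Q \<le> l * dist (P r) (p 0)"
      unfolding T_def Q by (simp_all add: hausdorff_dist_torus_le[OF l(2,1)])
    have "P 1 = p 0" by (simp add: P_def)
    then have Pl: "(P \<longlongrightarrow> p 0) (at_left 1)" using continuous_on_Icc_at_leftD[OF cP] by simp
    have "((\<lambda>r. l * dist (P r) (p 0)) \<longlongrightarrow> l * dist (p 0) (p 0)) (at_left 1)" by (intro tendsto_intros Pl)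
    then show "((\<lambda>r. l * dist (P r) (p 0)) \<longlongrightarrow> 0) (at_left 1)" by simp
  qed
  ultimately show ?thesis by blast
qed

section \<open>Normal forms of good polygons up to similarity\<close>

lemma rectangle_image:
  fixes a u v :: "real^3"
  assumes "u \<noteq> 0" "v \<noteq> 0" "u \<bullet> v = 0"
  obtains F k \<eta> where "similarity F" "k > 0" "\<eta> > 0"
    "convex hull {a, a + u, a + u + v, a + v} =
       F ` torus (tent (vector [k, \<eta>/2, 0]) (vector [- k, - \<eta>/2, 0]) (vector [0, - \<eta>/2, 0]) (vector [k, - \<eta>/2, 0]))"
proof -
  define k \<eta> e\<^sub>1 e\<^sub>2 where "k = norm u / 2" and "\<eta> = norm v" and "e\<^sub>1 = (1 / norm u) *\<^sub>R u" and "e\<^sub>2 = (1 / norm v) *\<^sub>R v"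
  have e: "norm e\<^sub>1 = 1" "norm e\<^sub>2 = 1" "e\<^sub>1 \<bullet> e\<^sub>2 = 0" "k *\<^sub>R e\<^sub>1 = (1/2) *\<^sub>R u" "(\<eta>/2) *\<^sub>R e\<^sub>2 = (1/2) *\<^sub>R v"
    using assms by (simp_all add: e\<^sub>1_def e\<^sub>2_def k_def \<eta>_def)
  obtain e\<^sub>3 where e3: "norm e\<^sub>3 = 1" "e\<^sub>1 \<bullet> e\<^sub>3 = 0" "e\<^sub>2 \<bullet> e\<^sub>3 = 0" using orthonormal_third[OF e(1-3)] .
  define F where "F = (\<lambda>x::real^3. (a + (1/2) *\<^sub>R u + (1/2) *\<^sub>R v) + 1 *\<^sub>R (x $ 1 *\<^sub>R e\<^sub>1 + x $ 2 *\<^sub>R e\<^sub>2 + x $ 3 *\<^sub>R e\<^sub>3))"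
  note sim = frame_similarity[OF e(1,2) e3(1) e(3) e3(2,3) zero_less_one, where o' = "a + (1/2) *\<^sub>R u + (1/2) *\<^sub>R v", folded F_def]
  have half: "x = (1/2) *\<^sub>R x + (1/2) *\<^sub>R x" for x :: "real^3" by (simp flip: scaleR_add_left)
  have Fv: "F (vector [- k, - (\<eta>/2), 0]) = a" "F (vector [k, - (\<eta>/2), 0]) = a + u" "F (vector [k, \<eta>/2, 0]) = a + u + v"
    "F (vector [- k, \<eta>/2, 0]) = a + v"
    using half[of u] half[of v] by (simp_all add: F_def vector_3 e(4,5))
  have "F ` torus (tent (vector [k, \<eta>/2, 0]) (vector [- k, - \<eta>/2, 0]) (vector [0, - \<eta>/2, 0]) (vector [k, - \<eta>/2, 0]))
      = convex hull {a, a + u, a + u + v, a + v}"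
    using torus_rectangle[of k "\<eta>/2"] sim(2) by (simp add: Fv)
  then show ?thesis using that[of F k \<eta>] sim(1) assms by (simp add: k_def \<eta>_def)
qed

lemma trapezoid_image:
  fixes a b c d :: "real^3"
  assumes t: "0 \<le> t" "t < 1" and ab: "a \<noteq> b" and cd: "c - d = t *\<^sub>R (b - a)" and diag: "dist a c = dist a b" "dist b d = dist a b"
  obtains F where "similarity F"
    "convex hull {a, b, c, d} =
       F ` torus (tent (vector [t, 0, sqrt (4 - (1 + t)\<^sup>2)]) (vector [- 1, 0, 0]) (vector [0, 0, 0]) (vector [1, 0, 0]))"
proof -
  \<comment> \<open>Half of the base and the vector from the midpoint of the base to the midpoint of
    the top.\<close>
  define e w l where "e = (1/2) *\<^sub>R (b - a)" and "w = c - (1/2) *\<^sub>R (a + b) - t *\<^sub>R e" and "l = norm e"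
  have l: "l > 0" using ab by (simp add: l_def e_def)
  have a: "a = (1/2) *\<^sub>R (a + b) - e" and b: "b = (1/2) *\<^sub>R (a + b) + e" and c: "c = (1/2) *\<^sub>R (a + b) + t *\<^sub>R e + w"
    by (simp_all add: e_def w_def vec_eq_iff field_simps)
  have d: "d = (1/2) *\<^sub>R (a + b) - t *\<^sub>R e + w"
  proof -
    have d': "d = c - t *\<^sub>R (b - a)" using cd by (simp add: algebra_simps)
    show ?thesis by (subst d') (simp add: e_def w_def vec_eq_iff field_simps)
  qed
  have ac: "c - a = w + (1 + t) *\<^sub>R e" using a c by (simp add: algebra_simps)
  have bd: "d - b = w - (1 + t) *\<^sub>R e" using b d by (simp add: algebra_simps)
  have len: "(norm (c - a))\<^sup>2 = 4 * l\<^sup>2" "(norm (d - b))\<^sup>2 = 4 * l\<^sup>2"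
  proof -
    have "dist a b = 2 * l" by (simp add: l_def e_def dist_norm norm_minus_commute)
    then show "(norm (c - a))\<^sup>2 = 4 * l\<^sup>2" "(norm (d - b))\<^sup>2 = 4 * l\<^sup>2"
      using diag by (simp_all add: dist_norm norm_minus_commute power2_eq_square)
  qed
  \<comment> \<open>Equality of the two diagonals makes \<open>w\<close> orthogonal to the base, so
    the trapezoid is isosceles; their length then fixes its height
    \<open>l * \<eta>\<close>.\<close>
  have ww: "w \<bullet> w + (1 + t)\<^sup>2 * l\<^sup>2 + 2 * (1 + t) * (e \<bullet> w) = 4 * l\<^sup>2" "w \<bullet> w + (1 + t)\<^sup>2 * l\<^sup>2 - 2 * (1 + t) * (e \<bullet> w) = 4 * l\<^sup>2"
    using len unfolding ac bd l_def power2_norm_eq_inner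
    by (simp_all add: inner_add_left inner_add_right inner_diff_left inner_diff_right inner_commute power2_eq_square algebra_simps)
  then have "2 * (1 + t) * (e \<bullet> w) = 0" by linarith
  then have ew: "e \<bullet> w = 0" using t by simp
  define \<eta> where "\<eta> = sqrt (4 - (1 + t)\<^sup>2)"
  have "(1 + t)\<^sup>2 < 2\<^sup>2" using t by (intro power_strict_mono) auto
  then have \<eta>: "\<eta> > 0" "\<eta>\<^sup>2 = 4 - (1 + t)\<^sup>2" by (simp_all add: \<eta>_def)
  have "(norm w)\<^sup>2 = (l * \<eta>)\<^sup>2" using ww(1) ew unfolding power_mult_distrib \<eta>(2) power2_norm_eq_inner by (simp add: algebra_simps)
  then have nw: "norm w = l * \<eta>" using l \<eta>(1) by (simp add: power2_eq_iff_nonneg)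
  define e\<^sub>1 e\<^sub>3 where "e\<^sub>1 = (1/l) *\<^sub>R e" and "e\<^sub>3 = (1/(l * \<eta>)) *\<^sub>R w"
  have u: "norm e\<^sub>1 = 1" "norm e\<^sub>3 = 1" "e\<^sub>1 \<bullet> e\<^sub>3 = 0" "l *\<^sub>R e\<^sub>1 = e" "(l * \<eta>) *\<^sub>R e\<^sub>3 = w"
    using l \<eta>(1) nw ew by (simp_all add: e\<^sub>1_def e\<^sub>3_def l_def[symmetric])
  obtain e\<^sub>2 where e2: "norm e\<^sub>2 = 1" "e\<^sub>1 \<bullet> e\<^sub>2 = 0" "e\<^sub>3 \<bullet> e\<^sub>2 = 0" using orthonormal_third[OF u(1-3)] .
  then have e2': "e\<^sub>2 \<bullet> e\<^sub>3 = 0" by (simp add: inner_commute)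
  define F where "F = (\<lambda>x::real^3. (1/2) *\<^sub>R (a + b) + l *\<^sub>R (x $ 1 *\<^sub>R e\<^sub>1 + x $ 2 *\<^sub>R e\<^sub>2 + x $ 3 *\<^sub>R e\<^sub>3))"
  note sim = frame_similarity[OF u(1) e2(1) u(2) e2(2) u(3) e2' l, where o' = "(1/2) *\<^sub>R (a + b)", folded F_def]
  have Fv: "F (vector [r, 0, s]) = (1/2) *\<^sub>R (a + b) + r *\<^sub>R e + l *\<^sub>R (s *\<^sub>R e\<^sub>3)" for r s
    by (simp add: F_def vector_3 scaleR_add_right add.assoc mult.commute flip: u(4))
  have w3: "l *\<^sub>R (\<eta> *\<^sub>R e\<^sub>3) = w" using u(5) by simp
  have "F (vector [- 1, 0, 0]) = a" "F (vector [1, 0, 0]) = b" "F (vector [t, 0, \<eta>]) = c" "F (vector [- t, 0, \<eta>]) = d"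
    unfolding Fv w3 using a b c d by simp_all
  then have "F ` torus (tent (vector [t, 0, \<eta>]) (vector [- 1, 0, 0]) (vector [0, 0, 0]) (vector [1, 0, 0])) = convex hull {a, b, c, d}"
    unfolding torus_trapezoid[OF t(1)] sim(2) by simp
  then show ?thesis using that[OF sim(1)] unfolding \<eta>_def by simp
qed

lemma good_polygon_cases:
  assumes "good_polygon Q"
  obtains (rectangle) a u v where "u \<noteq> 0" "v \<noteq> 0" "u \<bullet> v = 0" "Q = convex hull {a, a + u, a + u + v, a + v}"
  | (trapezoid) a b c d t where "0 \<le> t" "t < 1" "a \<noteq> b" "c - d = t *\<^sub>R (b - a)" "dist a c = dist a b" "dist b d = dist a b"
      "Q = convex hull {a, b, c, d}"
  using assms unfolding good_polygon_def
proof (elim disjE)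
  assume "is_rectangle Q"
  then show ?thesis using rectangle unfolding is_rectangle_def by blast
next
  assume "is_long_diagonal_trapezoid Q"
  then obtain a b c d t where 1: "\<not> collinear {a, b, d}" "0 < t" "t < 1" "c - d = t *\<^sub>R (b - a)"
    "dist a c = dist a b" "dist b d = dist a b" "Q = convex hull {a, b, c, d}"
    unfolding is_long_diagonal_trapezoid_def by blast
  have "a \<noteq> b" using 1(1) by auto
  then show ?thesis using trapezoid[of t a b c d] 1 by simp
next
  assume "is_equilateral_triangle Q"
  then obtain a b c where 1: "a \<noteq> b" "dist a b = dist b c" "dist b c = dist c a" "Q = convex hull {a, b, c}"
    unfolding is_equilateral_triangle_def by blast
  \<comment> \<open>The top side shrinks to the apex: \<open>t = 0\<close> and \<open>d = c\<close>,
    and the diagonals become the other two sides.\<close>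
  then show ?thesis using trapezoid[of 0 a b c c] by (simp add: dist_commute)
qed

theorem theorem1p3:
  fixes Q :: "(real^3) set"
  assumes "good_polygon Q"
  shows "\<exists>(\<xi> :: real \<Rightarrow> ((real^3)^8) set) (T :: real \<Rightarrow> (real^3) set).
           continuous_map (top_of_set {0..<1}) pup_space \<xi> \<and>
           (\<forall>s\<in>{0..<1}. \<exists>p\<in>\<xi> s. similar (torus p) (T s)) \<and>
           ((\<lambda>s. hausdorff_dist (T s) Q) \<longlongrightarrow> 0) (at_left 1)"
  using assms
proof (cases rule: good_polygon_cases[consumes 1])
  case (rectangle a u v)
  obtain F k \<eta> where F: "similarity F" "k > 0" "\<eta> > 0"
    "convex hull {a, a + u, a + u + v, a + v} =
       F ` torus (tent (vector [k, \<eta>/2, 0]) (vector [- k, - \<eta>/2, 0]) (vector [0, - \<eta>/2, 0]) (vector [k, - \<eta>/2, 0]))"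
    by (rule rectangle_image[OF rectangle(1-3)])
  obtain s :: real and p where p: "s > 0" "continuous_on {0..s} p" "\<forall>e\<in>{0<..s}. pup_tent (p e)"
    "p 0 = tent (vector [k, \<eta>/2, 0]) (vector [- k, - \<eta>/2, 0]) (vector [0, - \<eta>/2, 0]) (vector [k, - \<eta>/2, 0])"
    using rectangle_path[OF F(2,3)] by blast
  have "Q = F ` torus (p 0)" unfolding rectangle(4) F(4) p(4) ..
  then show ?thesis by (rule path_to_limit[OF p(1-3) F(1)])
next
  case (trapezoid a b c d t)
  obtain F where F: "similarity F" "convex hull {a, b, c, d} =
       F ` torus (tent (vector [t, 0, sqrt (4 - (1 + t)\<^sup>2)]) (vector [- 1, 0, 0]) (vector [0, 0, 0]) (vector [1, 0, 0]))"
    by (rule trapezoid_image[OF trapezoid(1-6)])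
  obtain s :: real and p where p: "s > 0" "continuous_on {0..s} p" "\<forall>e\<in>{0<..s}. pup_tent (p e)"
    "p 0 = tent (vector [t, 0, sqrt (4 - (1 + t)\<^sup>2)]) (vector [- 1, 0, 0]) (vector [0, 0, 0]) (vector [1, 0, 0])"
    using trapezoid_path[OF trapezoid(1,2)] by blast
  have "Q = F ` torus (p 0)" unfolding trapezoid(7) F(2) p(4) ..
  then show ?thesis by (rule path_to_limit[OF p(1-3) F(1)])
qed

end
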